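(* Let $\beta>0$, let $\Omega\subset\mathbf{R}^2\simeq\mathbf{C}$ be the interior of a convex polygon with vertices $z_1,\dots,z_n$ and sides $\Gamma_i=(z_i,z_{i+1})$, and let $q_i,\partial_{\mathbf n}q_i\in\mathcal{E}'[0,1]$ for $i=1,\dots,n$ be given distributions (here $\partial_{\mathbf n}q_i$ is merely the name of a distribution). For $\lambda\in\mathbf{C}\setminus\{0\}$ define \[ \rho_i(\lambda)=\mathrm{i}|\Gamma_i|\left[\left\langle \partial_{\mathbf n}q_i,\ \psi_i^*\!\left(e^{-\mathrm{i}\lambda z'+\mathrm{i}\beta^2\bar z'/\lambda}\right)\right\rangle+\left(\lambda e^{\mathrm{i}\alpha_i}+\frac{\beta^2}{\lambda e^{\mathrm{i}\alpha_i}}\right)\left\langle q_i,\ \psi_i^*\!\left(e^{-\mathrm{i}\lambda z'+\mathrm{i}\beta^2\bar z'/\lambda}\right)\right\rangle\right], \] and \[ Q(z,\bar z)=\frac{1}{4\pi \mathrm{i}}\sum_{i=1}^n\int_{\ell_i}e^{\mathrm{i}\lambda z-\mathrm{i}\beta^2\bar z/\lambda}\rho_i(\lambda)\,\frac{\mathrm{d}\lambda}{\lambda},\qquad z\in\Omega. \] If the global relation $\sum_{i=1}^n\rho_i(\lambda)=0$ holds for all $\lambda\in\mathbf{C}\setminus\{0\}$, then for every $i=1,\dots,n$ and every $\varphi\in\mathcal{S}(0,1)$, \[ \lim_{\epsilon\downarrow0}\left\langle(\partial Q/\partial\mathbf{n})_i^\epsilon,\varphi\right\rangle=\langle\partial_{\mathbf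 n}q_i,\varphi\rangle, \] where $\mathbf{n}$ is the outward unit normal to $\Gamma_i^\epsilon$ (equivalently, to $\Gamma_i$).
   Context: The polygon is bounded and convex, its vertices $z_1,\dots,z_n$ are listed counterclockwise (indices modulo $n$), $\Gamma_i=(z_i,z_{i+1})$ is the open side, $\alpha_i=\arg(z_{i+1}-z_i)$, and $|\Gamma_i|$ is the length of $\Gamma_i$. The parametrisation is $\psi_i(\tau)=\tau z_{i+1}+(1-\tau)z_i$, $\tau\in[0,1]$, and $\psi_i^*(f)(\tau)=f(\psi_i(\tau))$. The ray $\ell_i=\{\lambda\in\mathbf C:\arg\lambda=-\alpha_i\}$ is oriented from $0$ to $\infty$. $\mathcal{E}[0,1]$ is the Fréchet space of smooth functions $[0,1]\to\mathbf{C}$ with semi-norms $\delta_n(\varphi)=\max_{[0,1]}|\varphi^{(n)}|$, $n\ge 0$; $\mathcal{E}'[0,1]$ is its topological dual, with pairing $\langle\cdot,\cdot\rangle$. $\mathcal{S}(0,1)$ is the space of smooth $\varphi:(0,1)\to\mathbf{C}$ with $\sup_{\tau\in(0,1)}|\tau^{-m}(1-\tau)^{-m}\varphi^{(n)}(\tau)|<\infty$ for all $m,n\ge0$; its elements extend by zero to elements of $\mathcal{E}[0,1]$. For small $\epsilon>0$ let $\Omega_\epsilon=\{z\in\Omega:\mathrm{dist}(z,\partial\Omega)\ge\epsilon\}$, a polygon whose sides $\Gamma_i^\epsilon$ correspond to (are parallel to) the sides $\Gamma_i$; let $\psi_i^\epsilon:[0,1]\to \mathrm{cl}(\Gamma_i^\epsilon)$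 be the affine parametrisation with the same direction as $\psi_i$, so that $\psi_i^\epsilon\to\psi_i$ as $\epsilon\to0$. Define $\langle(\partial Q/\partial\mathbf{n})_i^\epsilon,\varphi\rangle=\int_0^1\frac{\partial Q}{\partial\mathbf n}(\psi_i^\epsilon(\tau))\,\varphi(\tau)\,\mathrm{d}\tau$ for $\varphi\in\mathcal{S}(0,1)$. *)

theory Defs
  imports "HOL-Analysis.Analysis"
begin

section \<open>Smooth functions on an interval and the space of distributions\<close>

text \<open>Derivatives are taken within the set \<open>S\<close>, hence one-sided at the end points of a closed
  interval. Only the values of a function on \<open>S\<close> matter for its derivatives on \<open>S\<close>.\<close>

definition nth_deriv_within :: "real set \<Rightarrow> nat \<Rightarrow> (real \<Rightarrow> complex) \<Rightarrow> real \<Rightarrow> complex" where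
  "nth_deriv_within S n f = ((\<lambda>g x. vector_derivative g (at x within S)) ^^ n) f"

definition smooth_within :: "real set \<Rightarrow> (real \<Rightarrow> complex) \<Rightarrow> bool" where
  "smooth_within S f \<longleftrightarrow> (\<forall>n. \<forall>x\<in>S. nth_deriv_within S n f differentiable (at x within S))"

text \<open>Elements of the Frechet space of smooth functions on \<open>[0,1]\<close> are represented by total
  functions whose values outside \<open>[0,1]\<close> are irrelevant: no semi-norm sees these values, so a
  continuous linear functional takes the same value on two representatives of the same
  function on \<open>[0,1]\<close>.\<close>

definition E01 :: "(real \<Rightarrow> complex) set" where
  "E01 = {\<phi>. smooth_within {0..1} \<phi>}"

definition E01_seminorm :: "nat \<Rightarrow> (real \<Rightarrow> complex) \<Rightarrow> real" where
  "E01_seminorm n \<phi> = (SUP x\<in>{0..1}. norm (nth_deriv_within {0..1} n \<phi> x))"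

definition E01_topology :: "(real \<Rightarrow> complex) topology" where
  "E01_topology = topology_generated_by
     {{\<psi> \<in> E01. E01_seminorm n (\<lambda>x. \<psi> x - \<phi> x) < r} | n \<phi> r. \<phi> \<in> E01 \<and> r > 0}"

definition E01_dual :: "((real \<Rightarrow> complex) \<Rightarrow> complex) set" where
  "E01_dual = {T. (\<forall>\<phi>\<in>E01. \<forall>\<psi>\<in>E01. T (\<lambda>x. \<phi> x + \<psi> x) = T \<phi> + T \<psi>) \<and>
                  (\<forall>c. \<forall>\<phi>\<in>E01. T (\<lambda>x. c * \<phi> x) = c * T \<phi>) \<and>
                  continuous_map E01_topology euclidean T}"

text \<open>Here only the values on the open interval \<open>(0,1)\<close> matter.\<close>

definition S01 :: "(real \<Rightarrow> complex) set" where
  "S01 = {\<phi>. smooth_within {0<..<1} \<phi> \<and>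
     (\<forall>m n. bdd_above ((\<lambda>\<tau>. norm (nth_deriv_within {0<..<1} n \<phi> \<tau> /
                                complex_of_real (\<tau> ^ m * (1 - \<tau>) ^ m))) ` {0<..<1}))}"

definition zero_ext :: "(real \<Rightarrow> complex) \<Rightarrow> real \<Rightarrow> complex" where
  "zero_ext \<phi> = (\<lambda>\<tau>. if \<tau> \<in> {0<..<1} then \<phi> \<tau> else 0)"


section \<open>The polygon\<close>

text \<open>The vertices are \<open>z 0, \<dots>, z (n - 1)\<close>.\<close>

definition next_vertex :: "nat \<Rightarrow> (nat \<Rightarrow> complex) \<Rightarrow> nat \<Rightarrow> complex" where
  "next_vertex n z i = z (Suc i mod n)"

text \<open>The imaginary part below is positive iff \<open>z k\<close> lies strictly to the left of the directed
  line from \<open>z i\<close> to its successor. Requiring this for all other vertices says that these are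
  the (pairwise distinct, non-flat) vertices of a convex polygon in counterclockwise order.\<close>

definition convex_polygon_ccw :: "nat \<Rightarrow> (nat \<Rightarrow> complex) \<Rightarrow> bool" where
  "convex_polygon_ccw n z \<longleftrightarrow> n \<ge> 3 \<and>
     (\<forall>i<n. \<forall>k<n. k \<noteq> i \<and> k \<noteq> Suc i mod n \<longrightarrow>
        Im (cnj (next_vertex n z i - z i) * (z k - z i)) > 0)"

definition polygon_interior :: "nat \<Rightarrow> (nat \<Rightarrow> complex) \<Rightarrow> complex set" where
  "polygon_interior n z = interior (convex hull (z ` {..<n}))"

definition side :: "nat \<Rightarrow> (nat \<Rightarrow> complex) \<Rightarrow> nat \<Rightarrow> complex set" where
  "side n z i = open_segment (z i) (next_vertex n z i)"

definition side_length :: "nat \<Rightarrow> (nat \<Rightarrow> complex) \<Rightarrow> nat \<Rightarrow> real" where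
  "side_length n z i = dist (z i) (next_vertex n z i)"

definition side_angle :: "nat \<Rightarrow> (nat \<Rightarrow> complex) \<Rightarrow> nat \<Rightarrow> real" where
  "side_angle n z i = Arg (next_vertex n z i - z i)"

text \<open>The parametrisation \<open>\<tau> z\<^sub>i\<^sub>+\<^sub>1 + (1 - \<tau>) z\<^sub>i\<close> is the library's \<^const>\<open>linepath\<close>.\<close>

definition side_param :: "nat \<Rightarrow> (nat \<Rightarrow> complex) \<Rightarrow> nat \<Rightarrow> real \<Rightarrow> complex" where
  "side_param n z i = linepath (z i) (next_vertex n z i)"

text \<open>The polygon is to the left of its sides, so the outward normal is the direction of the
  side turned clockwise by a right angle.\<close>

definition outward_normal :: "nat \<Rightarrow> (nat \<Rightarrow> complex) \<Rightarrow> nat \<Rightarrow> complex" where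
  "outward_normal n z i = - \<i> * sgn (next_vertex n z i - z i)"

definition inner_polygon :: "nat \<Rightarrow> (nat \<Rightarrow> complex) \<Rightarrow> real \<Rightarrow> complex set" where
  "inner_polygon n z \<epsilon> =
     {w \<in> polygon_interior n z. infdist w (frontier (polygon_interior n z)) \<ge> \<epsilon>}"

text \<open>The closed side of the inner polygon that corresponds to side \<open>i\<close>. For small \<open>\<epsilon>\<close> it is a
  non-degenerate segment parallel to side \<open>i\<close>.\<close>

definition inner_side :: "nat \<Rightarrow> (nat \<Rightarrow> complex) \<Rightarrow> real \<Rightarrow> nat \<Rightarrow> complex set" where
  "inner_side n z \<epsilon> i = {w \<in> inner_polygon n z \<epsilon>. infdist w (side n z i) = \<epsilon>}"

text \<open>The end points of the inner side, in the order that gives it the direction of side \<open>i\<close>;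
  they exist and are unique for all sufficiently small \<open>\<epsilon> > 0\<close>.\<close>

definition inner_ends :: "nat \<Rightarrow> (nat \<Rightarrow> complex) \<Rightarrow> real \<Rightarrow> nat \<Rightarrow> complex \<times> complex" where
  "inner_ends n z \<epsilon> i = (THE (a, b).
     closed_segment a b = inner_side n z \<epsilon> i \<and>
     (\<exists>c>0. b - a = c *\<^sub>R (next_vertex n z i - z i)))"

definition inner_param :: "nat \<Rightarrow> (nat \<Rightarrow> complex) \<Rightarrow> real \<Rightarrow> nat \<Rightarrow> real \<Rightarrow> complex" where
  "inner_param n z \<epsilon> i = linepath (fst (inner_ends n z \<epsilon> i)) (snd (inner_ends n z \<epsilon> i))"


section \<open>The integral representation\<close>

text \<open>Integral over the ray \<open>arg \<mu> = - \<alpha>\<close>, oriented from \<open>0\<close> to infinity. The spectral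
  variable is called \<open>\<mu>\<close> throughout, because lambda is reserved for abstractions.\<close>

definition ray_integral :: "real \<Rightarrow> (complex \<Rightarrow> complex) \<Rightarrow> complex" where
  "ray_integral \<alpha> f = (LBINT r:{0<..}. f (complex_of_real r * cis (- \<alpha>)) * cis (- \<alpha>))"

definition exp_kernel :: "real \<Rightarrow> complex \<Rightarrow> complex \<Rightarrow> complex" where
  "exp_kernel \<beta> \<mu> w = exp (- \<i> * \<mu> * w + \<i> * (complex_of_real \<beta>)\<^sup>2 * cnj w / \<mu>)"

text \<open>In the following, \<open>q i\<close> and \<open>dq i\<close> are the distributions \<open>q\<^sub>i\<close> and \<open>\<partial>\<^sub>n q\<^sub>i\<close>.\<close>

definition spectral_rho ::
  "real \<Rightarrow> nat \<Rightarrow> (nat \<Rightarrow> complex) \<Rightarrow> (nat \<Rightarrow> (real \<Rightarrow> complex) \<Rightarrow> complex) \<Rightarrow>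
   (nat \<Rightarrow> (real \<Rightarrow> complex) \<Rightarrow> complex) \<Rightarrow> nat \<Rightarrow> complex \<Rightarrow> complex" where
  "spectral_rho \<beta> n z q dq i \<mu> =
     \<i> * complex_of_real (side_length n z i) *
     (dq i (exp_kernel \<beta> \<mu> \<circ> side_param n z i) +
      (\<mu> * cis (side_angle n z i) + (complex_of_real \<beta>)\<^sup>2 / (\<mu> * cis (side_angle n z i))) *
        q i (exp_kernel \<beta> \<mu> \<circ> side_param n z i))"

definition Q_fun ::
  "real \<Rightarrow> nat \<Rightarrow> (nat \<Rightarrow> complex) \<Rightarrow> (nat \<Rightarrow> (real \<Rightarrow> complex) \<Rightarrow> complex) \<Rightarrow>
   (nat \<Rightarrow> (real \<Rightarrow> complex) \<Rightarrow> complex) \<Rightarrow> complex \<Rightarrow> complex" where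
  "Q_fun \<beta> n z q dq w = 1 / (4 * complex_of_real pi * \<i>) *
     (\<Sum>i<n. ray_integral (side_angle n z i)
        (\<lambda>\<mu>. exp (\<i> * \<mu> * w - \<i> * (complex_of_real \<beta>)\<^sup>2 * cnj w / \<mu>) *
             spectral_rho \<beta> n z q dq i \<mu> / \<mu>))"

definition directional_deriv :: "(complex \<Rightarrow> complex) \<Rightarrow> complex \<Rightarrow> complex \<Rightarrow> complex" where
  "directional_deriv F v w = vector_derivative (\<lambda>t::real. F (w + t *\<^sub>R v)) (at 0)"

definition normal_deriv_pairing ::
  "real \<Rightarrow> nat \<Rightarrow> (nat \<Rightarrow> complex) \<Rightarrow> (nat \<Rightarrow> (real \<Rightarrow> complex) \<Rightarrow> complex) \<Rightarrow>
   (nat \<Rightarrow> (real \<Rightarrow> complex) \<Rightarrow> complex) \<Rightarrow> nat \<Rightarrow> real \<Rightarrow> (real \<Rightarrow> complex) \<Rightarrow> complex" where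
  "normal_deriv_pairing \<beta> n z q dq i \<epsilon> \<phi> =
     (LBINT \<tau>:{0<..<1}. directional_deriv (Q_fun \<beta> n z q dq) (outward_normal n z i)
                          (inner_param n z \<epsilon> i \<tau>) * \<phi> \<tau>)"

end

theory Submission
  imports Defs "HOL-Probability.Probability"
begin

text \<open>The function \<open>Q\<close> is a sum of layer potentials of the modified Helmholtz equation, one for each
  side, written as integrals over rays \<open>\<mu> = \<beta> e\<^sup>t u\<close> with \<open>\<bar>u\<bar> = 1\<close>: the single layers have the densities
  \<open>\<partial>\<^sub>n q\<^sub>j\<close>, the double layers the densities \<open>q\<^sub>j\<close>. The theorem is the jump relation of potential
  theory. It is carried out under the spectral integral, where a distribution is only ever applied
  to exponentials, so that densities of arbitrary order cause no difficulty.

  Let \<open>w\<close> lie on the inner side near side \<open>i\<close> and let \<open>w\<^sup>*\<close> be its mirror image in side \<open>i\<close>. The whole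
  polygon lies on one side of \<open>w\<^sup>*\<close>, so that the ray opposite to that of side \<open>i\<close> is
  admissible for all sides at once; on this common ray the global relation makes the integrand
  vanish identically (\<open>normal_potential_sum_zero\<close>). Hence nothing changes if the contributions of
  all sides at \<open>w\<^sup>*\<close> are subtracted from the normal derivative at \<open>w\<close>
  (\<open>normal_derivative_eq\<close>), and the differences can be discussed side by side.

  For side \<open>i\<close> itself, reflection combined with the reversal \<open>t \<mapsto> - t\<close> of the ray shows that the double
  layers cancel and the single layer is doubled (\<open>potential_reflect\<close>). Paired with a test
  function \<open>\<phi>\<close>, what remains is an integral over the Fourier transform of \<open>\<phi>\<close> at \<open>2 \<beta> L sinh t\<close>,
  times an exponential factor that disappears with the distance to the side; Fourier inversion
  identifies the limit as \<open>\<partial>\<^sub>n q\<^sub>i\<close> applied to \<open>\<phi>\<close> (\<open>own_side_tendsto\<close>).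

  For every other side the two rays, the one used at \<open>w\<close> and the one used at \<open>w\<^sup>*\<close>, can be turned into
  one common direction (\<open>potential_turn\<close>, \<open>common_direction\<close>). There the potential is bounded by a
  negative power of the distance to the corners, which the test function
  absorbs, and it extends continuously to the open side \<open>i\<close>, where \<open>w\<close> and \<open>w\<^sup>*\<close> merge. By dominated
  convergence the difference tends to zero (\<open>pairing_tendsto\<close>).

  A functional on smooth functions is used through its finite order
  (\<open>E01_dual_finite_order\<close>), from which it follows that it commutes with parameter integrals
  (\<open>E01_dual_integral\<close>).\<close>

section \<open>Towers of derivatives and continuous functionals\<close>

text \<open>All derivatives are carried along as explicit data, so that no computation has to go through the
  iterated choice operator behind \<open>nth_deriv_within\<close>.\<close>

definition deriv_tower :: "real set \<Rightarrow> (nat \<Rightarrow> real \<Rightarrow> complex) \<Rightarrow> bool" where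
  "deriv_tower S F \<longleftrightarrow> (\<forall>k. \<forall>x\<in>S. (F k has_vector_derivative F (Suc k) x) (at x within S))"

lemma deriv_towerD:
  "deriv_tower S F \<Longrightarrow> x \<in> S \<Longrightarrow> (F k has_vector_derivative F (Suc k) x) (at x within S)"
  by (auto simp: deriv_tower_def)

lemma deriv_tower_continuous_on: "deriv_tower S F \<Longrightarrow> continuous_on S (F k)"
  by (auto simp: continuous_on_eq_continuous_within deriv_tower_def
      intro: has_vector_derivative_continuous)

lemma deriv_tower_nth_deriv:
  assumes "smooth_within S f"
  shows "deriv_tower S (\<lambda>k. nth_deriv_within S k f)"
  using assms unfolding deriv_tower_def smooth_within_def nth_deriv_within_def
  by (simp add: vector_derivative_works)

lemma nth_deriv_within_eq:
  assumes S: "\<And>x. x \<in> S \<Longrightarrow> at x within S \<noteq> bot"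
    and F: "deriv_tower S F" and f: "\<And>x. x \<in> S \<Longrightarrow> f x = F 0 x" and x: "x \<in> S"
  shows "nth_deriv_within S k f x = F k x"
  using x
proof (induction k arbitrary: x)
  case 0
  then show ?case using f by (simp add: nth_deriv_within_def)
next
  case (Suc k)
  have "(nth_deriv_within S k f has_vector_derivative F (Suc k) x) (at x within S)"
    by (rule has_vector_derivative_transform[OF Suc.prems _ deriv_towerD[OF F Suc.prems]])
      (use Suc.IH in auto)
  then show ?case
    using S[OF Suc.prems] by (simp add: nth_deriv_within_def vector_derivative_within)
qed

lemma smooth_within_tower:
  assumes S: "\<And>x. x \<in> S \<Longrightarrow> at x within S \<noteq> bot"
    and F: "deriv_tower S F" and f: "\<And>x. x \<in> S \<Longrightarrow> f x = F 0 x"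
  shows "smooth_within S f"
  unfolding smooth_within_def
proof (intro allI ballI)
  fix k x assume x: "x \<in> S"
  have "(nth_deriv_within S k f has_vector_derivative F (Suc k) x) (at x within S)"
    by (rule has_vector_derivative_transform[OF x _ deriv_towerD[OF F x]])
      (use nth_deriv_within_eq[OF S F f] in auto)
  then show "nth_deriv_within S k f differentiable at x within S"
    by (auto simp: differentiable_def has_vector_derivative_def)
qed

lemma at_within_unit_nontrivial: "x \<in> {0..1} \<Longrightarrow> at x within {0..1::real} \<noteq> bot"
  by (simp add: trivial_limit_within islimpt_Icc)

lemma E01_tower:
  assumes "deriv_tower {0..1} F" "\<And>x. x \<in> {0..1} \<Longrightarrow> f x = F 0 x"
  shows "f \<in> E01"
  unfolding E01_def using smooth_within_tower[OF at_within_unit_nontrivial assms] by simp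

lemma E01_obtains_tower:
  assumes "f \<in> E01"
  obtains F where "deriv_tower {0..1} F" "F 0 = f"
proof
  show "deriv_tower {0..1} (\<lambda>k. nth_deriv_within {0..1} k f)"
    using assms by (simp add: E01_def deriv_tower_nth_deriv)
qed (simp add: nth_deriv_within_def)

lemma E01_seminorm_le:
  assumes "deriv_tower {0..1} F" "\<And>x. x \<in> {0..1} \<Longrightarrow> f x = F 0 x"
    and "\<And>x. x \<in> {0..1} \<Longrightarrow> norm (F k x) \<le> B"
  shows "E01_seminorm k f \<le> B"
  unfolding E01_seminorm_def
  by (rule cSUP_least)
    (use assms nth_deriv_within_eq[OF at_within_unit_nontrivial assms(1,2)] in auto)

lemma E01_seminorm_ge:
  assumes "deriv_tower {0..1} F" "\<And>x. x \<in> {0..1} \<Longrightarrow> f x = F 0 x" "x \<in> {0..1}"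
  shows "norm (F k x) \<le> E01_seminorm k f"
proof -
  have "compact ((\<lambda>x. norm (F k x)) ` {0..1})"
    by (intro compact_continuous_image continuous_intros deriv_tower_continuous_on[OF assms(1)])
      auto
  then have "bdd_above ((\<lambda>x. norm (F k x)) ` {0..1})"
    by (simp add: bounded_imp_bdd_above compact_imp_bounded)
  moreover have "(\<lambda>x. norm (nth_deriv_within {0..1} k f x)) ` {0..1} = (\<lambda>x. norm (F k x)) ` {0..1}"
    using nth_deriv_within_eq[OF at_within_unit_nontrivial assms(1,2)] by (intro image_cong) auto
  ultimately show ?thesis
    unfolding E01_seminorm_def using assms(3) by (auto intro: cSUP_upper)
qed

lemma deriv_tower_add:
  "deriv_tower S F \<Longrightarrow> deriv_tower S G \<Longrightarrow> deriv_tower S (\<lambda>k x. F k x + G k x)"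
  by (auto simp: deriv_tower_def intro: has_vector_derivative_add)

lemma deriv_tower_diff:
  "deriv_tower S F \<Longrightarrow> deriv_tower S G \<Longrightarrow> deriv_tower S (\<lambda>k x. F k x - G k x)"
  by (auto simp: deriv_tower_def intro: has_vector_derivative_diff)

lemma deriv_tower_cmult:
  "deriv_tower S F \<Longrightarrow> deriv_tower S (\<lambda>k x. c * F k x)"
  by (auto simp: deriv_tower_def intro: has_vector_derivative_mult_right)

lemma deriv_tower_0: "deriv_tower S (\<lambda>k x. 0)"
  by (auto simp: deriv_tower_def)

lemma E01_diff: "f \<in> E01 \<Longrightarrow> g \<in> E01 \<Longrightarrow> (\<lambda>x. f x - g x) \<in> E01"
  by (metis (mono_tags, lifting) E01_obtains_tower E01_tower deriv_tower_diff)

lemma E01_cmult: "f \<in> E01 \<Longrightarrow> (\<lambda>x. c * f x) \<in> E01"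
  by (metis (mono_tags, lifting) E01_obtains_tower E01_tower deriv_tower_cmult)

lemma E01_zero: "(\<lambda>x. 0) \<in> E01"
  by (rule E01_tower[OF deriv_tower_0]) auto

lemma E01_seminorm_zero: "E01_seminorm k (\<lambda>x. 0) = 0"
  using E01_seminorm_le[OF deriv_tower_0, of "\<lambda>x. 0" 0 k]
    E01_seminorm_ge[OF deriv_tower_0, of "\<lambda>x. 0" 0 k] by auto

lemma E01_seminorm_triangle:
  assumes "f \<in> E01" "g \<in> E01"
  shows "E01_seminorm k (\<lambda>x. f x + g x) \<le> E01_seminorm k f + E01_seminorm k g"
proof -
  obtain F where F: "deriv_tower {0..1} F" "F 0 = f" using E01_obtains_tower assms(1) by blast
  obtain G where G: "deriv_tower {0..1} G" "G 0 = g" using E01_obtains_tower assms(2) by blast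
  show ?thesis
  proof (rule E01_seminorm_le[OF deriv_tower_add[OF F(1) G(1)]])
    fix x :: real assume "x \<in> {0..1}"
    then have "norm (F k x) \<le> E01_seminorm k f" "norm (G k x) \<le> E01_seminorm k g"
      using E01_seminorm_ge F G by auto
    then show "norm (F k x + G k x) \<le> E01_seminorm k f + E01_seminorm k g"
      using norm_triangle_ineq[of "F k x" "G k x"] by linarith
  qed (use F G in auto)
qed

text \<open>The generating sets are balls about arbitrary centres; the triangle inequality recentres them at
  the point under consideration.\<close>

lemma E01_topology_nbhd:
  assumes "generate_topology_on
     {{\<psi> \<in> E01. E01_seminorm n (\<lambda>x. \<psi> x - \<phi> x) < r} | n \<phi> r. \<phi> \<in> E01 \<and> r > 0} U"
    and "f \<in> U"
  shows "\<exists>N. \<exists>\<delta>>0. \<forall>g\<in>E01. (\<forall>k\<le>N. E01_seminorm k (\<lambda>x. g x - f x) < \<delta>) \<longrightarrow> g \<in> U"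
  using assms
proof (induction rule: generate_topology_on.induct)
  case (Int a b)
  then obtain N1 d1 N2 d2 where *: "d1 > 0" "d2 > 0"
    "\<And>g. g\<in>E01 \<Longrightarrow> (\<forall>k\<le>N1. E01_seminorm k (\<lambda>x. g x - f x) < d1) \<Longrightarrow> g \<in> a"
    "\<And>g. g\<in>E01 \<Longrightarrow> (\<forall>k\<le>N2. E01_seminorm k (\<lambda>x. g x - f x) < d2) \<Longrightarrow> g \<in> b"
    by blast
  show ?case
    by (rule exI[of _ "max N1 N2"], rule exI[of _ "min d1 d2"]) (use * in auto)
next
  case (UN K)
  then obtain A where "A \<in> K" "f \<in> A" by blast
  then show ?case using UN.IH[of A] by blast
next
  case (Basis s)
  then obtain n \<phi> r where s: "s = {\<psi> \<in> E01. E01_seminorm n (\<lambda>x. \<psi> x - \<phi> x) < r}" "\<phi> \<in> E01" "r > 0"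
    by blast
  with Basis.prems have f: "f \<in> E01" "E01_seminorm n (\<lambda>x. f x - \<phi> x) < r" by auto
  have "g \<in> s" if g: "g \<in> E01"
    "\<forall>k\<le>n. E01_seminorm k (\<lambda>x. g x - f x) < r - E01_seminorm n (\<lambda>x. f x - \<phi> x)" for g
  proof -
    have "E01_seminorm n (\<lambda>x. (g x - f x) + (f x - \<phi> x))
        \<le> E01_seminorm n (\<lambda>x. g x - f x) + E01_seminorm n (\<lambda>x. f x - \<phi> x)"
      by (intro E01_seminorm_triangle E01_diff f g s)
    also have "\<dots> < r" using g(2) by (metis add.commute less_diff_eq order_refl)
    finally show ?thesis using s g by simp
  qed
  then show ?case using f
    by (intro exI[of _ n] exI[of _ "r - E01_seminorm n (\<lambda>x. f x - \<phi> x)"]) auto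
qed auto

lemma topspace_E01_topology: "topspace E01_topology = E01"
  unfolding E01_topology_def topology_generated_by_topspace
proof (rule antisym)
  show "E01 \<subseteq> \<Union> {{\<psi> \<in> E01. E01_seminorm n (\<lambda>x. \<psi> x - \<phi> x) < r} | n \<phi> r. \<phi> \<in> E01 \<and> r > 0}"
  proof
    fix f assume "f \<in> E01"
    then have "f \<in> {\<psi> \<in> E01. E01_seminorm 0 (\<lambda>x. \<psi> x - f x) < 1}"
      using E01_seminorm_zero[of 0] by simp
    with \<open>f \<in> E01\<close>
    show "f \<in> \<Union> {{\<psi> \<in> E01. E01_seminorm n (\<lambda>x. \<psi> x - \<phi> x) < r} | n \<phi> r. \<phi> \<in> E01 \<and> r > 0}"
      by (intro UnionI[of "{\<psi> \<in> E01. E01_seminorm 0 (\<lambda>x. \<psi> x - f x) < 1}"]) (auto intro: zero_less_one)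
  qed
qed auto

lemma E01_dual_add: "T \<in> E01_dual \<Longrightarrow> f \<in> E01 \<Longrightarrow> g \<in> E01 \<Longrightarrow> T (\<lambda>x. f x + g x) = T f + T g"
  and E01_dual_cmult: "T \<in> E01_dual \<Longrightarrow> f \<in> E01 \<Longrightarrow> T (\<lambda>x. c * f x) = c * T f"
  by (auto simp: E01_dual_def)

lemma E01_dual_diff:
  assumes "T \<in> E01_dual" "f \<in> E01" "g \<in> E01"
  shows "T (\<lambda>x. f x - g x) = T f - T g"
  using E01_dual_add[OF assms(1) E01_diff[OF assms(2,3)] assms(3)] by simp

definition has_order :: "((real \<Rightarrow> complex) \<Rightarrow> complex) \<Rightarrow> nat \<Rightarrow> real \<Rightarrow> bool" where
  "has_order T N C \<longleftrightarrow> (\<forall>F f B. deriv_tower {0..1} F \<longrightarrow> (\<forall>x\<in>{0..1}. f x = F 0 x) \<longrightarrow>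
     (\<forall>k\<le>N. \<forall>x\<in>{0..1}. norm (F k x) \<le> B) \<longrightarrow> norm (T f) \<le> C * B)"

lemma has_orderD:
  assumes "has_order T N C" "deriv_tower {0..1} F" "\<And>x. x \<in> {0..1} \<Longrightarrow> f x = F 0 x"
    and "\<And>k x. k \<le> N \<Longrightarrow> x \<in> {0..1} \<Longrightarrow> norm (F k x) \<le> B"
  shows "norm (T f) \<le> C * B"
  using assms unfolding has_order_def by blast

text \<open>Continuity for the Frechet topology amounts to finite order: finitely many derivatives
  control the functional. Everything that follows uses functionals only through this bound
  and linearity.\<close>

lemma E01_dual_finite_order:
  assumes T: "T \<in> E01_dual"
  obtains N C where "C > 0" "has_order T N C"
proof -
  have T0: "T (\<lambda>x. 0) = 0" using E01_dual_cmult[OF T E01_zero, of 0] by simp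
  have "openin E01_topology {f \<in> topspace E01_topology. T f \<in> ball 0 1}"
  proof (rule openin_continuous_map_preimage)
    show "continuous_map E01_topology euclidean T" using T unfolding E01_dual_def by blast
  qed simp
  then have "generate_topology_on
     {{\<psi> \<in> E01. E01_seminorm n (\<lambda>x. \<psi> x - \<phi> x) < r} | n \<phi> r. \<phi> \<in> E01 \<and> r > 0}
     {f \<in> E01. T f \<in> ball 0 1}"
    unfolding topspace_E01_topology unfolding E01_topology_def openin_topology_generated_by_iff .
  from E01_topology_nbhd[OF this, of "\<lambda>x. 0"] obtain N \<delta> where "\<delta> > 0" and
    *: "\<And>g. g\<in>E01 \<Longrightarrow> (\<forall>k\<le>N. E01_seminorm k g < \<delta>) \<Longrightarrow> norm (T g) < 1"
    using E01_zero T0 by auto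
  have "norm (T f) \<le> 2 / \<delta> * B"
    if F: "deriv_tower {0..1} F" "\<And>x. x \<in> {0..1} \<Longrightarrow> f x = F 0 x"
      and B: "\<And>k x. k \<le> N \<Longrightarrow> x \<in> {0..1} \<Longrightarrow> norm (F k x) \<le> B" for F f B
  proof -
    have "0 \<le> B" using order_trans[OF norm_ge_zero B[of 0 0]] by simp
    have f: "f \<in> E01" by (rule E01_tower[OF F])
    \<comment> \<open>scale \<open>f\<close> into the neighbourhood; \<open>b > 0\<close> allows for \<open>B = 0\<close>\<close>
    have key: "norm (T f) \<le> 2 / \<delta> * b" if "B \<le> b" "b > 0" for b
    proof -
      let ?c = "complex_of_real (\<delta> / (2 * b))"
      have "E01_seminorm k (\<lambda>x. ?c * f x) < \<delta>" if "k \<le> N" for k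
      proof -
        have "E01_seminorm k (\<lambda>x. ?c * f x) \<le> \<delta> / 2"
        proof (rule E01_seminorm_le[OF deriv_tower_cmult[OF F(1), of ?c]])
          fix x :: real assume "x \<in> {0..1}"
          then have "norm (F k x) \<le> b" using B that \<open>B \<le> b\<close> order_trans by blast
          then show "norm (?c * F k x) \<le> \<delta> / 2"
            using \<open>b > 0\<close> \<open>\<delta> > 0\<close> by (simp add: norm_mult norm_divide field_simps)
        qed (use F in auto)
        then show ?thesis using \<open>\<delta> > 0\<close> by simp
      qed
      then have "norm (T (\<lambda>x. ?c * f x)) < 1" by (intro * E01_cmult f) auto
      then show ?thesis
        using \<open>b > 0\<close> \<open>\<delta> > 0\<close>
        by (simp only: E01_dual_cmult[OF T f]) (simp add: norm_mult norm_divide field_simps)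
    qed
    show "norm (T f) \<le> 2 / \<delta> * B"
    proof (cases "B = 0")
      case False
      then show ?thesis using key[of B] \<open>0 \<le> B\<close> by simp
    next
      case True
      have "norm (T f) \<le> 0"
      proof (rule field_le_epsilon)
        fix e :: real assume "e > 0"
        then show "norm (T f) \<le> 0 + e"
          using key[of "\<delta> / 2 * e"] True \<open>\<delta> > 0\<close> by simp
      qed
      then show ?thesis using True by simp
    qed
  qed
  then have "has_order T N (2 / \<delta>)" unfolding has_order_def by blast
  with that[of "2 / \<delta>" N] \<open>\<delta> > 0\<close> show ?thesis by simp
qed

lemma E01_dual_cong:
  assumes T: "T \<in> E01_dual" and f: "f \<in> E01" and eq: "\<And>x. x \<in> {0..1} \<Longrightarrow> g x = f x"
  shows "T g = T f"
proof -
  obtain N C where "C > 0" "has_order T N C" using E01_dual_finite_order[OF T] .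
  note NC = this(1) has_orderD[OF this(2)]
  obtain F where F: "deriv_tower {0..1} F" "F 0 = f" using E01_obtains_tower f by blast
  have g: "g \<in> E01" by (rule E01_tower[OF F(1)]) (use eq F in auto)
  have "norm (T (\<lambda>x. g x - f x)) \<le> C * 0"
    by (rule NC(2)[OF deriv_tower_0]) (use eq in auto)
  then show ?thesis using E01_dual_diff[OF T g f] by simp
qed

section \<open>Differentiation and functionals under the integral sign\<close>

lemma has_vector_derivative_iff_quotient:
  fixes f :: "real \<Rightarrow> 'a::real_normed_vector"
  shows "(f has_vector_derivative f') (at x within S) \<longleftrightarrow>
    ((\<lambda>y. (1 / (y - x)) *\<^sub>R (f y - f x)) \<longlongrightarrow> f') (at x within S)"
proof -
  have "(f has_vector_derivative f') (at x within S) \<longleftrightarrow>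
      ((\<lambda>y. norm (f y - (f x + (y - x) *\<^sub>R f')) / norm (y - x)) \<longlongrightarrow> 0) (at x within S)"
    unfolding has_vector_derivative_def has_derivative_iff_norm
    by (simp add: bounded_linear_scaleR_left diff_diff_eq)
  also have "\<dots> \<longleftrightarrow> ((\<lambda>y. norm ((1 / (y - x)) *\<^sub>R (f y - f x) - f')) \<longlongrightarrow> 0) (at x within S)"
  proof (rule filterlim_cong[OF refl refl])
    show "\<forall>\<^sub>F y in at x within S. norm (f y - (f x + (y - x) *\<^sub>R f')) / norm (y - x)
        = norm ((1 / (y - x)) *\<^sub>R (f y - f x) - f')"
      unfolding eventually_at_filter
    proof (rule always_eventually, intro allI impI)
      fix y assume "y \<noteq> x"
      then have "f y - (f x + (y - x) *\<^sub>R f') = (y - x) *\<^sub>R ((1 / (y - x)) *\<^sub>R (f y - f x) - f')"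
        by (simp add: scaleR_diff_right)
      then show "norm (f y - (f x + (y - x) *\<^sub>R f')) / norm (y - x)
          = norm ((1 / (y - x)) *\<^sub>R (f y - f x) - f')"
        using \<open>y \<noteq> x\<close> by simp
    qed
  qed
  also have "\<dots> \<longleftrightarrow> ((\<lambda>y. (1 / (y - x)) *\<^sub>R (f y - f x)) \<longlongrightarrow> f') (at x within S)"
    by (simp add: tendsto_norm_zero_iff LIM_zero_iff)
  finally show ?thesis .
qed

lemma vector_derivative_bound:
  fixes f :: "real \<Rightarrow> 'a::real_normed_vector"
  assumes "convex S" "\<And>x. x \<in> S \<Longrightarrow> (f has_vector_derivative f' x) (at x within S)"
    and "\<And>x. x \<in> S \<Longrightarrow> norm (f' x) \<le> B" "x \<in> S" "y \<in> S"
  shows "norm (f y - f x) \<le> B * \<bar>y - x\<bar>"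
proof -
  have "norm (f y - f x) \<le> B * norm (y - x)"
  proof (rule differentiable_bound[OF assms(1)])
    show "(f has_derivative (\<lambda>h. h *\<^sub>R f' x)) (at x within S)" if "x \<in> S" for x
      using assms(2)[OF that] by (simp add: has_vector_derivative_def)
    show "onorm (\<lambda>h. h *\<^sub>R f' x) \<le> B" if "x \<in> S" for x
      by (rule onorm_le) (use assms(3)[OF that] in \<open>simp add: mult.commute[of _ "norm (f' x)"] mult_right_mono\<close>)
  qed fact+
  then show ?thesis by simp
qed

text \<open>The bound on the derivative dominates the difference quotients, by the mean value inequality.\<close>

lemma has_vector_derivative_integral:
  fixes f :: "'b \<Rightarrow> real \<Rightarrow> 'a::{banach, second_countable_topology}"
  assumes X: "convex X" "x0 \<in> X"
    and f: "\<And>s x. x \<in> X \<Longrightarrow> (f s has_vector_derivative f' s x) (at x within X)"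
    and bound: "\<And>s x. x \<in> X \<Longrightarrow> norm (f' s x) \<le> g s"
    and g: "integrable M g"
    and int: "\<And>x. x \<in> X \<Longrightarrow> integrable M (\<lambda>s. f s x)"
    and meas: "(\<lambda>s. f' s x0) \<in> borel_measurable M"
  shows "((\<lambda>x. \<integral>s. f s x \<partial>M) has_vector_derivative (\<integral>s. f' s x0 \<partial>M)) (at x0 within X)"
  unfolding has_vector_derivative_iff_quotient tendsto_at_iff_sequentially
proof (intro allI impI)
  fix Y assume Y: "\<forall>i. Y i \<in> X - {x0}" "Y \<longlonglongrightarrow> x0"
  have "(\<lambda>i. \<integral>s. (1 / (Y i - x0)) *\<^sub>R (f s (Y i) - f s x0) \<partial>M) \<longlonglongrightarrow> (\<integral>s. f' s x0 \<partial>M)"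
  proof (rule integral_dominated_convergence[where w = g])
    show "AE s in M. (\<lambda>i. (1 / (Y i - x0)) *\<^sub>R (f s (Y i) - f s x0)) \<longlonglongrightarrow> f' s x0"
      using f[OF X(2)] Y unfolding has_vector_derivative_iff_quotient tendsto_at_iff_sequentially
      by (auto simp: o_def)
    show "AE s in M. norm ((1 / (Y i - x0)) *\<^sub>R (f s (Y i) - f s x0)) \<le> g s" for i
    proof (rule always_eventually, rule allI)
      fix s
      have "norm (f s (Y i) - f s x0) \<le> g s * \<bar>Y i - x0\<bar>"
        by (rule vector_derivative_bound[OF X(1) f bound]) (use Y X in auto)
      moreover have "\<bar>Y i - x0\<bar> > 0" using Y(1) by auto
      ultimately show "norm ((1 / (Y i - x0)) *\<^sub>R (f s (Y i) - f s x0)) \<le> g s"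
        by (simp add: divide_le_eq del: scaleR_diff_right)
    qed
    show "(\<lambda>s. (1 / (Y i - x0)) *\<^sub>R (f s (Y i) - f s x0)) \<in> borel_measurable M" for i
      using int[of "Y i"] int[OF X(2)] Y(1)
      by (intro borel_measurable_scaleR borel_measurable_diff borel_measurable_const
          borel_measurable_integrable) auto
  qed (use meas g in auto)
  moreover have "(\<lambda>i. \<integral>s. (1 / (Y i - x0)) *\<^sub>R (f s (Y i) - f s x0) \<partial>M)
      = (\<lambda>y. (1 / (y - x0)) *\<^sub>R ((\<integral>s. f s y \<partial>M) - (\<integral>s. f s x0 \<partial>M))) \<circ> Y"
  proof
    fix i
    show "(\<integral>s. (1 / (Y i - x0)) *\<^sub>R (f s (Y i) - f s x0) \<partial>M)
      = ((\<lambda>y. (1 / (y - x0)) *\<^sub>R ((\<integral>s. f s y \<partial>M) - (\<integral>s. f s x0 \<partial>M))) \<circ> Y) i"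
      unfolding integral_scaleR_right o_def
      using int[of "Y i"] int[OF X(2)] Y(1) by (subst Bochner_Integration.integral_diff) auto
  qed
  ultimately show "((\<lambda>y. (1 / (y - x0)) *\<^sub>R ((\<integral>s. f s y \<partial>M) - (\<integral>s. f s x0 \<partial>M))) \<circ> Y)
      \<longlonglongrightarrow> (\<integral>s. f' s x0 \<partial>M)"
    by simp
qed

lemma uniform_in_second_argument:
  fixes f :: "real \<Rightarrow> real \<Rightarrow> 'a::metric_space"
  assumes cont: "continuous_on (UNIV \<times> {0..1}) (\<lambda>(s, x). f s x)" and "e > 0"
  shows "\<exists>d>0. \<forall>s. \<bar>s - s0\<bar> < d \<longrightarrow> (\<forall>x\<in>{0..1}. dist (f s x) (f s0 x) < e)"
proof -
  have "uniformly_continuous_on ({s0 - 1..s0 + 1} \<times> {0..1::real}) (\<lambda>(s, x). f s x)"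
    by (intro compact_uniformly_continuous continuous_on_subset[OF cont] compact_Times) auto
  from uniformly_continuous_onE[OF this \<open>e > 0\<close>] obtain d where d: "d > 0"
    "\<And>p q. p \<in> {s0 - 1..s0 + 1} \<times> {0..1} \<Longrightarrow> q \<in> {s0 - 1..s0 + 1} \<times> {0..1} \<Longrightarrow> dist q p < d
      \<Longrightarrow> dist (case q of (s, x) \<Rightarrow> f s x) (case p of (s, x) \<Rightarrow> f s x) < e"
    by metis
  show ?thesis
  proof (intro exI[of _ "min d 1"] conjI allI impI ballI)
    fix s x :: real assume "\<bar>s - s0\<bar> < min d 1" "x \<in> {0..1}"
    then show "dist (f s x) (f s0 x) < e"
      using d(2)[of "(s0, x)" "(s, x)"] by (auto simp: dist_Pair_Pair dist_real_def abs_le_iff abs_less_iff)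
  qed (use d in auto)
qed

text \<open>Together with finite order, this is continuity of \<open>s \<mapsto> F s\<close> for all semi-norms that a given
  functional feels.\<close>

lemma uniform_in_second_argument_finite:
  fixes F :: "nat \<Rightarrow> real \<Rightarrow> real \<Rightarrow> 'a::metric_space"
  assumes cont: "\<And>k. continuous_on (UNIV \<times> {0..1}) (\<lambda>(s, x). F k s x)" and "e > 0"
  shows "\<exists>d>0. \<forall>s. \<bar>s - s0\<bar> < d \<longrightarrow> (\<forall>k\<le>N::nat. \<forall>x\<in>{0..1}. dist (F k s x) (F k s0 x) < e)"
proof (induction N)
  case 0
  then show ?case using uniform_in_second_argument[OF cont \<open>e > 0\<close>, of s0 0] by simp
next
  case (Suc N)
  then obtain d where d: "d > 0"
    "\<And>s k x. \<bar>s - s0\<bar> < d \<Longrightarrow> k \<le> N \<Longrightarrow> x \<in> {0..1} \<Longrightarrow> dist (F k s x) (F k s0 x) < e" by blast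
  obtain d' where d': "d' > 0"
    "\<And>s x. \<bar>s - s0\<bar> < d' \<Longrightarrow> x \<in> {0..1} \<Longrightarrow> dist (F (Suc N) s x) (F (Suc N) s0 x) < e"
    using uniform_in_second_argument[OF cont \<open>e > 0\<close>, of s0 "Suc N"] by blast
  show ?case
    by (rule exI[of _ "min d d'"]) (use d d' le_Suc_eq in auto)
qed

lemma E01_dual_continuous:
  fixes F :: "nat \<Rightarrow> real \<Rightarrow> real \<Rightarrow> complex"
  assumes T: "T \<in> E01_dual"
    and F: "\<And>s. deriv_tower {0..1} (\<lambda>k. F k s)"
    and cont: "\<And>k. continuous_on (UNIV \<times> {0..1}) (\<lambda>(s, x). F k s x)"
  shows "continuous_on UNIV (\<lambda>s. T (F 0 s))"
  unfolding continuous_on_iff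
proof (intro ballI allI impI)
  fix s0 e :: real assume "e > 0"
  have "\<exists>d>0. \<forall>s. dist s s0 < d \<longrightarrow> dist (T (F 0 s)) (T (F 0 s0)) < e"
  proof -
  obtain N C where "C > 0" "has_order T N C" using E01_dual_finite_order[OF T] .
  note NC = this(1) has_orderD[OF this(2)]
  obtain d where d: "d > 0"
    "\<And>s k x. \<bar>s - s0\<bar> < d \<Longrightarrow> k \<le> N \<Longrightarrow> x \<in> {0..1} \<Longrightarrow> dist (F k s x) (F k s0 x) < e / (2 * C)"
    using uniform_in_second_argument_finite[of F "e / (2 * C)" s0 N, OF cont] \<open>e > 0\<close> NC(1) by auto
  have in_E: "F 0 s \<in> E01" for s by (rule E01_tower[OF F]) auto
  have "norm (T (F 0 s) - T (F 0 s0)) < e" if "\<bar>s - s0\<bar> < d" for s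
  proof -
    have "norm (T (\<lambda>x. F 0 s x - F 0 s0 x)) \<le> C * (e / (2 * C))"
      by (rule NC(2)[OF deriv_tower_diff[OF F F]])
        (use d(2)[OF that] in \<open>auto simp: dist_norm intro: less_imp_le\<close>)
    also have "\<dots> < e" using NC(1) \<open>e > 0\<close> by simp
    finally show ?thesis by (simp add: E01_dual_diff[OF T in_E in_E])
  qed
  then show ?thesis
    using d(1) by (auto simp: dist_norm)
  qed
  then show "\<exists>d>0. \<forall>s\<in>UNIV. dist s s0 < d \<longrightarrow> dist (T (F 0 s)) (T (F 0 s0)) < e"
    by simp
qed

lemma deriv_tower_integral:
  fixes F :: "nat \<Rightarrow> 'b \<Rightarrow> real \<Rightarrow> complex"
  assumes F: "\<And>s. deriv_tower {0..1} (\<lambda>k. F k s)"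
    and meas: "\<And>k x. x \<in> {0..1} \<Longrightarrow> (\<lambda>s. F k s x) \<in> borel_measurable M"
    and bound: "\<And>k s x. x \<in> {0..1} \<Longrightarrow> norm (F k s x) \<le> g k s"
    and g: "\<And>k. integrable M (g k)"
  shows "deriv_tower {0..1} (\<lambda>k x. \<integral>s. F k s x \<partial>M)"
  unfolding deriv_tower_def
proof (intro allI ballI)
  fix k and x :: real assume x: "x \<in> {0..1}"
  show "((\<lambda>x. \<integral>s. F k s x \<partial>M) has_vector_derivative (\<integral>s. F (Suc k) s x \<partial>M)) (at x within {0..1})"
  proof (rule has_vector_derivative_integral[where g = "g (Suc k)"])
    show "integrable M (\<lambda>s. F k s x)" if "x \<in> {0..1}" for x
      using bound[OF that, of k] by (intro Bochner_Integration.integrable_bound[OF g[of k] meas[OF that]]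
        always_eventually allI) (auto intro: order_trans[OF _ abs_ge_self])
  qed (use x g meas bound deriv_towerD[OF F] in auto)
qed

text \<open>The function \<open>H s = T (\<integral>\<^sub>-\<^sub>\<infinity>\<^sup>s F)\<close> and the primitive of \<open>s \<mapsto> T (F s)\<close> that vanishes at \<open>-\<infinity>\<close> have the same derivative,
  because \<open>T\<close> is linear and continuous along difference quotients. Hence they agree, also in the
  limit at \<open>\<infinity>\<close>.\<close>

lemma E01_dual_integral:
  fixes F :: "nat \<Rightarrow> real \<Rightarrow> real \<Rightarrow> complex"
  assumes T: "T \<in> E01_dual"
    and F: "\<And>s. deriv_tower {0..1} (\<lambda>k. F k s)"
    and cont: "\<And>k. continuous_on (UNIV \<times> {0..1}) (\<lambda>(s, x). F k s x)"
    and bound: "\<And>k s x. x \<in> {0..1} \<Longrightarrow> norm (F k s x) \<le> g k s"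
    and g: "\<And>k. integrable lborel (g k)"
  shows "integrable lborel (\<lambda>s. T (F 0 s))"
    and "T (\<lambda>x. LBINT s. F 0 s x) = (LBINT s. T (F 0 s))"
proof -
  obtain N C where "C > 0" "has_order T N C" using E01_dual_finite_order[OF T] .
  note NC = this(1) has_orderD[OF this(2)]
  have cont1: "continuous_on UNIV (\<lambda>s. F k s x)" if "x \<in> {0..1}" for k x
  proof -
    have "continuous_on UNIV (\<lambda>s. case (s, x) of (s, x) \<Rightarrow> F k s x)"
      by (rule continuous_on_compose2[OF cont[of k]]) (use that in \<open>auto intro!: continuous_intros\<close>)
    then show ?thesis by simp
  qed
  have meas[measurable]: "(\<lambda>s. F k s x) \<in> borel_measurable borel" if "x \<in> {0..1}" for k x
    using cont1[OF that] by (rule borel_measurable_continuous_onI)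
  have g0: "0 \<le> g k s" for k s using order_trans[OF norm_ge_zero bound[of 0 k s]] by simp
  define h where "h s = (\<Sum>k\<le>N. g k s)" for s
  have h_int: "integrable lborel h" unfolding h_def by (intro Bochner_Integration.integrable_sum g)
  have g_h: "g k s \<le> h s" if "k \<le> N" for k s
    unfolding h_def using that by (intro member_le_sum) (auto simp: g0)
  have Fi: "integrable lborel (\<lambda>s. F k s x)" if "x \<in> {0..1}" for k x
    using bound[OF that, of k] meas[OF that, of k]
    by (intro Bochner_Integration.integrable_bound[OF g[of k]] always_eventually allI)
      (auto intro: order_trans[OF _ abs_ge_self])
  have Fi': "integrable lborel (\<lambda>r. indicator A r *\<^sub>R F k r x)" if "x \<in> {0..1}" "A \<in> sets borel" for k x A
    using Fi[OF that(1)] that(2) by (intro integrable_mult_indicator) auto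
  define P where "P k A x = (LBINT r. indicator A r *\<^sub>R F k r x)" for k A x
  have P_tower: "deriv_tower {0..1} (\<lambda>k. P k A)" if A[measurable]: "A \<in> sets borel" for A
    unfolding P_def
  proof (rule deriv_tower_integral[where g = g])
    show "deriv_tower {0..1} (\<lambda>k x. indicat_real A s *\<^sub>R F k s x)" for s
      using F[of s] by (auto simp: deriv_tower_def indicator_def)
    show "norm (indicat_real A s *\<^sub>R F k s x) \<le> g k s" if "x \<in> {0..1}" for k s x
      using bound[OF that, of k s] g0[of k s] by (auto simp: indicator_def)
    show "(\<lambda>s. indicat_real A s *\<^sub>R F k s x) \<in> borel_measurable lborel" if "x \<in> {0..1}" for k x
      using meas[OF that, of k] by measurable
  qed (rule g)
  have P_E: "P 0 A \<in> E01" if "A \<in> sets borel" for A by (rule E01_tower[OF P_tower[OF that]]) simp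
  have P_bound: "norm (P k A x) \<le> (LBINT r. indicator A r *\<^sub>R h r)"
    if "A \<in> sets borel" "x \<in> {0..1}" "k \<le> N" for k A x
    unfolding P_def
  proof (rule Bochner_Integration.integral_norm_bound_integral)
    show "integrable lborel (\<lambda>r. indicat_real A r *\<^sub>R h r)"
      using h_int that(1) by (intro integrable_mult_indicator) auto
    show "norm (indicat_real A r *\<^sub>R F k r x) \<le> indicat_real A r *\<^sub>R h r" for r
      using bound[OF that(2), of k r] g_h[OF that(3), of r] by (auto simp: indicator_def)
  qed (use Fi' that in auto)
  have TP_bound: "norm (T (P 0 A)) \<le> C * (LBINT r. indicator A r *\<^sub>R h r)"
    if "A \<in> sets borel" for A
    by (rule NC(2)[OF P_tower[OF that]]) (use P_bound that in auto)
  have P_diff: "P k {..b} x - P k {..a} x = P k {a<..b} x" if "a \<le> b" "x \<in> {0..1}" for k a b x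
  proof -
    have "P k {..b} x - P k {..a} x
        = (LBINT r. indicator {..b} r *\<^sub>R F k r x - indicator {..a} r *\<^sub>R F k r x)"
      unfolding P_def using Fi'[OF that(2)] by (intro Bochner_Integration.integral_diff[symmetric]) auto
    also have "\<dots> = P k {a<..b} x"
      unfolding P_def by (rule Bochner_Integration.integral_cong) (use that(1) in \<open>auto simp: indicator_def\<close>)
    finally show ?thesis .
  qed
  \<comment> \<open>uniformly in \<open>x\<close>, so that it also controls the functional\<close>
  have P_lin: "norm (P k {..b} x - P k {..a} x - (b - a) *\<^sub>R c) \<le> e * (b - a)"
    if "a \<le> b" "x \<in> {0..1}" "\<And>r. r \<in> {a..b} \<Longrightarrow> norm (F k r x - c) \<le> e" for k a b x c e
  proof -
    have "P k {..b} x - P k {..a} x - (b - a) *\<^sub>R c = P k {a<..b} x - (LBINT r. indicator {a<..b} r *\<^sub>R c)"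
      using P_diff[OF that(1,2)] that(1) by simp
    also have "\<dots> = (LBINT r. indicator {a<..b} r *\<^sub>R F k r x - indicator {a<..b} r *\<^sub>R c)"
      unfolding P_def using Fi'[OF that(2)]
      by (intro Bochner_Integration.integral_diff[symmetric]) (auto simp: that(1))
    also have "norm \<dots> \<le> (LBINT r. indicator {a<..b} r *\<^sub>R e)"
    proof (rule Bochner_Integration.integral_norm_bound_integral)
      show "norm (indicat_real {a<..b} r *\<^sub>R F k r x - indicat_real {a<..b} r *\<^sub>R c)
          \<le> indicat_real {a<..b} r *\<^sub>R e" for r
        using that(3)[of r] by (auto simp: indicator_def)
    qed (auto intro!: Fi' that Bochner_Integration.integrable_diff simp: that(1))
    finally show ?thesis using that(1) by (simp add: mult.commute)
  qed
  define H where "H s = T (P 0 {..s})" for s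
  have in_E: "F 0 s \<in> E01" for s by (rule E01_tower[OF F]) auto
  have H_deriv: "(H has_vector_derivative T (F 0 s0)) (at s0)" for s0
    unfolding has_vector_derivative_def has_derivative_at_alt
  proof (intro conjI allI impI)
    show "bounded_linear (\<lambda>h. h *\<^sub>R T (F 0 s0))" by (rule bounded_linear_scaleR_left)
    fix e :: real assume "e > 0"
    obtain d where d: "d > 0"
      "\<And>s k x. \<bar>s - s0\<bar> < d \<Longrightarrow> k \<le> N \<Longrightarrow> x \<in> {0..1} \<Longrightarrow> dist (F k s x) (F k s0 x) < e / C"
      using uniform_in_second_argument_finite[of F "e / C" s0 N, OF cont] \<open>e > 0\<close> NC(1) by auto
    have "norm (H y - H s0 - (y - s0) *\<^sub>R T (F 0 s0)) \<le> e * norm (y - s0)" if y: "norm (y - s0) < d" for y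
    proof -
      let ?D = "\<lambda>k x. P k {..y} x - P k {..s0} x - of_real (y - s0) * F k s0 x"
      have "norm (?D k x) \<le> e / C * \<bar>y - s0\<bar>" if "k \<le> N" "x \<in> {0..1}" for k x
      proof (cases "s0 \<le> y")
        case True
        have "norm (P k {..y} x - P k {..s0} x - (y - s0) *\<^sub>R F k s0 x) \<le> e / C * (y - s0)"
          by (rule P_lin[OF True that(2)])
            (use d(2)[OF _ that] y in \<open>auto simp: dist_norm intro: less_imp_le\<close>)
        then show ?thesis using True by (simp add: scaleR_conv_of_real)
      next
        case False
        have "norm (P k {..s0} x - P k {..y} x - (s0 - y) *\<^sub>R F k s0 x) \<le> e / C * (s0 - y)"
          by (rule P_lin[OF _ that(2)])
            (use d(2)[OF _ that] y False in \<open>auto simp: dist_norm intro: less_imp_le\<close>)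
        moreover have "?D k x = - (P k {..s0} x - P k {..y} x - (s0 - y) *\<^sub>R F k s0 x)"
          by (simp add: scaleR_conv_of_real algebra_simps)
        ultimately show ?thesis using False by (simp only: norm_minus_cancel) simp
      qed
      then have "norm (T (?D 0)) \<le> C * (e / C * \<bar>y - s0\<bar>)"
        by (intro NC(2)[where F = ?D]) (auto intro!: deriv_tower_diff P_tower deriv_tower_cmult F)
      moreover have "T (?D 0) = H y - H s0 - (y - s0) *\<^sub>R T (F 0 s0)"
        unfolding H_def scaleR_conv_of_real
        by (simp add: E01_dual_diff[OF T] E01_dual_cmult[OF T] E01_diff P_E E01_cmult in_E)
      ultimately show ?thesis using NC(1) by simp
    qed
    then show "\<exists>d>0. \<forall>y. norm (y - s0) < d \<longrightarrow>
        norm (H y - H s0 - (y - s0) *\<^sub>R T (F 0 s0)) \<le> e * norm (y - s0)"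
      using d(1) by blast
  qed
  have T_cont: "continuous_on UNIV (\<lambda>s. T (F 0 s))" by (rule E01_dual_continuous[OF T F cont])
  show T_int: "integrable lborel (\<lambda>s. T (F 0 s))"
  proof (rule Bochner_Integration.integrable_bound)
    show "integrable lborel (\<lambda>s. C * h s)" using h_int by simp
    show "(\<lambda>s. T (F 0 s)) \<in> borel_measurable lborel"
      using borel_measurable_continuous_onI[OF T_cont] by simp
    have "norm (T (F 0 s)) \<le> C * h s" for s
      by (rule NC(2)[OF F]) (auto intro: order_trans[OF bound g_h])
    then show "AE s in lborel. norm (T (F 0 s)) \<le> norm (C * h s)"
      by (intro always_eventually allI) (auto intro: order_trans abs_ge_self)
  qed
  \<comment> \<open>the limit of \<open>H\<close> at \<open>-\<infinity>\<close>\<close>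
  have tail: "((\<lambda>s. LBINT r. indicator {..s} r *\<^sub>R h r) \<longlongrightarrow> 0) at_bot"
    unfolding filterlim_at_bot_mirror
  proof (rule tendsto_at_topI_sequentially)
    fix X :: "nat \<Rightarrow> real" assume X: "filterlim X at_top sequentially"
    have "(\<lambda>n. LBINT r. indicator {..- X n} r *\<^sub>R h r) \<longlonglongrightarrow> integral\<^sup>L lborel (\<lambda>r::real. 0)"
    proof (rule integral_dominated_convergence[where w = "\<lambda>r. norm (h r)"])
      show "AE r in lborel. (\<lambda>n. indicat_real {..- X n} r *\<^sub>R h r) \<longlonglongrightarrow> 0"
      proof (rule AE_I2, rule tendsto_eventually)
        fix r
        show "\<forall>\<^sub>F n in sequentially. indicat_real {..- X n} r *\<^sub>R h r = 0"
          using filterlim_at_top_dense[THEN iffD1, OF X, rule_format, of "- r"]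
          by eventually_elim (auto simp: indicator_def)
      qed
    qed (use h_int in \<open>auto simp: indicator_def\<close>)
    then show "(\<lambda>n. LBINT r. indicator {..- X n} r *\<^sub>R h r) \<longlonglongrightarrow> 0" by simp
  qed
  have "(LBINT s=-\<infinity>..\<infinity>. T (F 0 s)) = T (P 0 UNIV) - 0"
  proof (rule interval_integral_FTC_integrable)
    show "((H \<circ> real_of_ereal) \<longlongrightarrow> 0) (at_right (- \<infinity>))"
      unfolding ereal_tendsto_simps H_def
      by (rule Lim_null_comparison[OF always_eventually tendsto_mult_right_zero[OF tail, of C]])
        (use TP_bound in auto)
    show "((H \<circ> real_of_ereal) \<longlongrightarrow> T (P 0 UNIV)) (at_left \<infinity>)"
      unfolding ereal_tendsto_simps
    proof (rule LIM_zero_cancel, rule Lim_null_comparison)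
      show "\<forall>\<^sub>F s in at_top. norm (H s - T (P 0 UNIV))
          \<le> C * ((LBINT r. h r) - (LBINT r. indicator {..s} r *\<^sub>R h r))"
      proof (rule always_eventually, rule allI)
        fix s
        have "norm (T (\<lambda>x. P 0 UNIV x - P 0 {..s} x)) \<le> C * (LBINT r. indicator {s<..} r *\<^sub>R h r)"
        proof (rule NC(2)[OF deriv_tower_diff[OF P_tower P_tower]])
          fix k x assume k: "k \<le> N" and x: "x \<in> {0..1::real}"
          have "P k UNIV x - P k {..s} x
              = (LBINT r. indicator UNIV r *\<^sub>R F k r x - indicator {..s} r *\<^sub>R F k r x)"
            unfolding P_def by (intro Bochner_Integration.integral_diff[symmetric] Fi'[OF x]) simp_all
          also have "\<dots> = P k {s<..} x"
            unfolding P_def by (rule Bochner_Integration.integral_cong) (auto simp: indicator_def)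
          finally show "norm (P k UNIV x - P k {..s} x) \<le> (LBINT r. indicator {s<..} r *\<^sub>R h r)"
            using P_bound[OF _ x k] by simp
        qed auto
        moreover have "(LBINT r. indicator {s<..} r *\<^sub>R h r)
            = (LBINT r. h r - indicator {..s} r *\<^sub>R h r)"
          by (rule Bochner_Integration.integral_cong) (auto simp: indicator_def)
        moreover have "\<dots> = (LBINT r. h r) - (LBINT r. indicator {..s} r *\<^sub>R h r)"
          by (intro Bochner_Integration.integral_diff h_int integrable_mult_indicator) auto
        ultimately show "norm (H s - T (P 0 UNIV))
            \<le> C * ((LBINT r. h r) - (LBINT r. indicator {..s} r *\<^sub>R h r))"
          unfolding H_def by (simp add: E01_dual_diff[OF T P_E P_E] norm_minus_commute)
      qed
      have "((\<lambda>s. C * ((LBINT r. h r) - (LBINT r. indicator {..s} r *\<^sub>R h r)))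
          \<longlongrightarrow> C * ((LBINT r. h r) - (LBINT r. h r))) at_top"
        by (intro tendsto_intros tendsto_integral_at_top h_int) simp
      then show "((\<lambda>s. C * ((LBINT r. h r) - (LBINT r. indicator {..s} r *\<^sub>R h r)))
          \<longlongrightarrow> 0) at_top" by simp
    qed
    show "isCont (\<lambda>s. T (F 0 s)) s" for s
      using T_cont by (simp add: continuous_on_eq_continuous_at)
    show "set_integrable lborel (einterval (- \<infinity>) \<infinity>) (\<lambda>s. T (F 0 s))"
      using T_int by (simp add: set_integrable_def)
  qed (use H_deriv in auto)
  then show "T (\<lambda>x. LBINT s. F 0 s x) = (LBINT s. T (F 0 s))"
    by (simp add: P_def[abs_def] interval_lebesgue_integral_def set_lebesgue_integral_def)
qed

section \<open>Fourier inversion for functions vanishing to infinite order\<close>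

lemma has_vector_derivative_zero_if_quadratic:
  fixes f :: "real \<Rightarrow> 'a::real_normed_vector"
  assumes "\<And>y. norm (f y) \<le> M * (y - x)\<^sup>2"
  shows "(f has_vector_derivative 0) (at x)"
  unfolding has_vector_derivative_iff_quotient
proof (rule Lim_null_comparison)
  have "f x = 0" using assms[of x] by simp
  show "\<forall>\<^sub>F y in at x. norm ((1 / (y - x)) *\<^sub>R (f y - f x)) \<le> M * \<bar>y - x\<bar>"
    unfolding eventually_at_filter
  proof (rule always_eventually, intro allI impI)
    fix y assume "y \<noteq> x"
    then show "norm ((1 / (y - x)) *\<^sub>R (f y - f x)) \<le> M * \<bar>y - x\<bar>"
      using assms[of y] \<open>f x = 0\<close>
      by (simp add: divide_le_eq power2_eq_square mult.assoc flip: abs_mult)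
  qed
  have "((\<lambda>y. M * \<bar>y - x\<bar>) \<longlongrightarrow> M * \<bar>x - x\<bar>) (at x)" by (intro tendsto_intros)
  then show "((\<lambda>y. M * \<bar>y - x\<bar>) \<longlongrightarrow> 0) (at x)" by simp
qed

text \<open>Every derivative is bounded by the squared distance to the end points. Extended by zero, it is
  therefore differentiable there with derivative zero.\<close>

lemma S01_tower:
  assumes "\<phi> \<in> S01"
  obtains Z where "deriv_tower UNIV Z" "Z 0 = zero_ext \<phi>"
    "\<And>k x. x \<notin> {0<..<1} \<Longrightarrow> Z k x = 0"
    "\<And>m. \<exists>C\<ge>0. \<forall>x\<in>{0..1}. norm (Z 0 x) \<le> C * (x ^ m * (1 - x) ^ m)"
proof -
  define D where "D k = nth_deriv_within {0<..<1} k \<phi>" for k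
  define Z where "Z k x = (if x \<in> {0<..<1} then D k x else 0)" for k x
  have D: "deriv_tower {0<..<1} D"
    using assms deriv_tower_nth_deriv unfolding D_def S01_def by blast
  have bound: "\<exists>C\<ge>0. \<forall>x\<in>{0<..<1}. norm (D k x) \<le> C * (x ^ m * (1 - x) ^ m)" for k m
  proof -
    have "bdd_above ((\<lambda>\<tau>. norm (D k \<tau> / complex_of_real (\<tau> ^ m * (1 - \<tau>) ^ m))) ` {0<..<1})"
      unfolding D_def by (rule conjunct2[OF assms[unfolded S01_def mem_Collect_eq], rule_format])
    then obtain C where "\<forall>y\<in>(\<lambda>\<tau>. norm (D k \<tau> / complex_of_real (\<tau> ^ m * (1 - \<tau>) ^ m))) ` {0<..<1}. y \<le> C"
      unfolding bdd_above_def by blast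
    then have C: "norm (D k x / complex_of_real (x ^ m * (1 - x) ^ m)) \<le> C" if "x \<in> {0<..<1}" for x
      using that by blast
    have "norm (D k x) \<le> max C 0 * (x ^ m * (1 - x) ^ m)" if x: "x \<in> {0<..<1}" for x
    proof -
      have pos: "0 < x ^ m * (1 - x) ^ m" using x by simp
      define p where "p = x ^ m * (1 - x) ^ m"
      have "norm (D k x) / p \<le> max C 0"
        using C[OF x] pos unfolding p_def[symmetric] by (simp add: norm_divide le_max_iff_disj)
      then show ?thesis using pos unfolding p_def[symmetric] by (simp add: pos_divide_le_eq)
    qed
    then show ?thesis by (intro exI[of _ "max C 0"]) auto
  qed
  have "(Z k has_vector_derivative Z (Suc k) x) (at x)" for k x
  proof (cases "x \<in> {0<..<1}")
    case True
    then have "(D k has_vector_derivative D (Suc k) x) (at x)"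
      using deriv_towerD[OF D True, of k]
        has_vector_derivative_within_open[OF True open_greaterThanLessThan] by blast
    then have "(Z k has_vector_derivative D (Suc k) x) (at x)"
      by (rule has_vector_derivative_transform_within_open[of _ _ _ "{0<..<1}"])
        (use True in \<open>auto simp: Z_def\<close>)
    then show ?thesis using True by (simp add: Z_def)
  next
    case False
    obtain C where C: "C \<ge> 0" "\<And>x. x \<in> {0<..<1} \<Longrightarrow> norm (D k x) \<le> C * (x ^ 2 * (1 - x) ^ 2)"
      using bound[of k 2] by blast
    have "norm (Z k y) \<le> C * (y - x)\<^sup>2" for y
    proof (cases "y \<in> {0<..<1}")
      case True
      have "(y * (1 - y))\<^sup>2 \<le> \<bar>y - x\<bar>\<^sup>2"
      proof (rule power_mono)
        have "y * (1 - y) \<le> y" "y * (1 - y) \<le> 1 - y"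
          using True by (simp_all add: mult_left_le mult_left_le_one_le)
        moreover have "x \<le> 0 \<or> 1 \<le> x" using False by auto
        moreover have "0 < y" "y < 1" using True by auto
        ultimately show "y * (1 - y) \<le> \<bar>y - x\<bar>" by linarith
      qed (use True in auto)
      then have "C * (y ^ 2 * (1 - y) ^ 2) \<le> C * (y - x)\<^sup>2"
        using C(1) by (intro mult_left_mono) (auto simp: power_mult_distrib)
      then show ?thesis using C(2)[OF True] True by (simp add: Z_def)
    next
      case out: False
      then show ?thesis using C(1) by (auto simp: Z_def)
    qed
    then have "(Z k has_vector_derivative 0) (at x)"
      by (rule has_vector_derivative_zero_if_quadratic)
    moreover have "Z (Suc k) x = 0" unfolding Z_def by (rule if_not_P[OF False])
    ultimately show ?thesis by simp
  qed
  then have "deriv_tower UNIV Z" by (simp add: deriv_tower_def)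
  moreover have "Z 0 = zero_ext \<phi>"
    by (auto simp: Z_def D_def zero_ext_def nth_deriv_within_def)
  moreover have "\<exists>C\<ge>0. \<forall>x\<in>{0..1}. norm (Z 0 x) \<le> C * (x ^ m * (1 - x) ^ m)" for m
  proof -
    obtain C where C: "C \<ge> 0" "\<And>x. x \<in> {0<..<1} \<Longrightarrow> norm (D 0 x) \<le> C * (x ^ m * (1 - x) ^ m)"
      using bound[of 0 m] by blast
    then have "norm (Z 0 x) \<le> C * (x ^ m * (1 - x) ^ m)" if "x \<in> {0..1}" for x
      using that by (auto simp: Z_def)
    then show ?thesis using C(1) by blast
  qed
  moreover have "Z k x = 0" if "x \<notin> {0<..<1}" for k x
    unfolding Z_def by (rule if_not_P[OF that])
  ultimately show ?thesis using that by blast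
qed

definition fourier :: "(real \<Rightarrow> complex) \<Rightarrow> real \<Rightarrow> complex" where
  "fourier f \<xi> = (LBINT x. f x * cis (\<xi> * x))"

lemma integrable_supported:
  fixes f :: "real \<Rightarrow> complex"
  assumes "continuous_on UNIV f" "\<And>x. x \<notin> {0<..<1} \<Longrightarrow> f x = 0"
  shows "integrable lborel f"
proof -
  have "integrable lborel (\<lambda>x. indicator {0..1} x *\<^sub>R f x)"
    by (intro borel_integrable_compact continuous_on_subset[OF assms(1)]) auto
  also have "(\<lambda>x. indicator {0..1} x *\<^sub>R f x) = f"
  proof
    fix x
    show "indicator {0..1} x *\<^sub>R f x = f x"
      using assms(2)[of x] by (cases "x \<in> {0<..<1}") auto
  qed
  finally show ?thesis .
qed

text \<open>Integration by parts; the boundary terms vanish.\<close>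

lemma fourier_deriv:
  assumes Z: "deriv_tower UNIV Z" "\<And>k x. x \<notin> {0<..<1} \<Longrightarrow> Z k x = 0"
  shows "fourier (Z (Suc k)) \<xi> = - \<i> * \<xi> * fourier (Z k) \<xi>"
proof -
  have c: "continuous_on UNIV (Z k)" for k by (rule deriv_tower_continuous_on[OF Z(1)])
  have cc: "continuous_on UNIV (\<lambda>x. cis (\<xi> * x))" by (intro continuous_intros)
  have i: "integrable lborel (\<lambda>x. Z k x * cis (\<xi> * x))" for k
    by (rule integrable_supported) (auto simp: Z(2) intro!: continuous_intros c)
  have "(LBINT x. indicator {0..1} x *\<^sub>R (Z (Suc k) x * cis (\<xi> * x) + \<i> * \<xi> * (Z k x * cis (\<xi> * x))))
      = Z k 1 * cis (\<xi> * 1) - Z k 0 * cis (\<xi> * 0)"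
  proof (rule integral_FTC_Icc)
    show "((\<lambda>x. Z k x * cis (\<xi> * x)) has_vector_derivative
        Z (Suc k) x * cis (\<xi> * x) + \<i> * \<xi> * (Z k x * cis (\<xi> * x))) (at x within {0..1})" for x
    proof -
      have "(Z k has_vector_derivative Z (Suc k) x) (at x within {0..1})"
        using deriv_towerD[OF Z(1), of x k] has_vector_derivative_at_within by blast
      moreover have "((\<lambda>x. cis (\<xi> * x)) has_vector_derivative \<i> * \<xi> * cis (\<xi> * x)) (at x within {0..1})"
        unfolding cis_conv_exp
        by (auto intro!: derivative_eq_intros has_vector_derivative_real_field simp: mult_ac)
      ultimately show ?thesis
        by (auto intro!: derivative_eq_intros simp: algebra_simps)
    qed
    show "continuous_on {0..1} (\<lambda>x. Z (Suc k) x * cis (\<xi> * x) + \<i> * \<xi> * (Z k x * cis (\<xi> * x)))"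
      by (intro continuous_intros continuous_on_subset[OF c]) auto
  qed simp
  also have "\<dots> = 0" by (simp add: Z(2))
  also have "(\<lambda>x. indicator {0..1} x *\<^sub>R (Z (Suc k) x * cis (\<xi> * x) + \<i> * \<xi> * (Z k x * cis (\<xi> * x))))
      = (\<lambda>x. Z (Suc k) x * cis (\<xi> * x) + \<i> * \<xi> * (Z k x * cis (\<xi> * x)))"
  proof
    fix x
    show "indicator {0..1} x *\<^sub>R (Z (Suc k) x * cis (\<xi> * x) + \<i> * \<xi> * (Z k x * cis (\<xi> * x)))
      = Z (Suc k) x * cis (\<xi> * x) + \<i> * \<xi> * (Z k x * cis (\<xi> * x))"
      using Z(2)[of x k] Z(2)[of x "Suc k"] by (cases "x \<in> {0<..<1}") auto
  qed
  finally show ?thesis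
    unfolding fourier_def using i[of k] i[of "Suc k"]
    by (simp add: add_eq_0_iff2 mult.assoc)
qed

lemma norm_fourier_le: "norm (fourier f \<xi>) \<le> (LBINT x. norm (f x))"
  unfolding fourier_def
  using integral_norm_bound[of lborel "\<lambda>x. f x * cis (\<xi> * x)"] by (simp add: norm_mult)

lemma fourier_rapid_decay:
  assumes Z: "deriv_tower UNIV Z" "\<And>k x. x \<notin> {0<..<1} \<Longrightarrow> Z k x = 0"
  shows "\<exists>C\<ge>0. \<forall>\<xi>. norm (fourier (Z 0) \<xi>) * (1 + \<xi>\<^sup>2) ^ m \<le> C"
proof -
  define c where "c k = (LBINT x. norm (Z k x))" for k
  have F: "norm (fourier (Z k) \<xi>) = \<bar>\<xi>\<bar> ^ k * norm (fourier (Z 0) \<xi>)" for k \<xi>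
  proof (induction k)
    case (Suc k)
    have "norm (fourier (Z (Suc k)) \<xi>) = \<bar>\<xi>\<bar> * norm (fourier (Z k) \<xi>)"
      by (subst fourier_deriv[OF Z]) (simp_all add: norm_mult)
    then show ?case using Suc by simp
  qed simp
  have b: "\<bar>\<xi>\<bar> ^ k * norm (fourier (Z 0) \<xi>) \<le> c k" for k \<xi>
    unfolding F[symmetric] c_def by (rule norm_fourier_le)
  have "norm (fourier (Z 0) \<xi>) * (1 + \<xi>\<^sup>2) ^ m \<le> 2 ^ m * (c 0 + c (2 * m))" for \<xi>
  proof -
    have "(1 + \<xi>\<^sup>2) ^ m \<le> (2 * max 1 (\<xi>\<^sup>2)) ^ m" by (intro power_mono) auto
    also have "\<dots> \<le> 2 ^ m * (1 + \<bar>\<xi>\<bar> ^ (2 * m))"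
      by (auto simp: power_mult_distrib power_mult max_def)
    finally have "norm (fourier (Z 0) \<xi>) * (1 + \<xi>\<^sup>2) ^ m
        \<le> norm (fourier (Z 0) \<xi>) * (2 ^ m * (1 + \<bar>\<xi>\<bar> ^ (2 * m)))"
      by (rule mult_left_mono) simp
    also have "\<dots> = 2 ^ m * (\<bar>\<xi>\<bar> ^ 0 * norm (fourier (Z 0) \<xi>)
        + \<bar>\<xi>\<bar> ^ (2 * m) * norm (fourier (Z 0) \<xi>))" by (simp add: algebra_simps)
    also have "\<dots> \<le> 2 ^ m * (c 0 + c (2 * m))" by (intro mult_left_mono add_mono b) auto
    finally show ?thesis .
  qed
  moreover have "0 \<le> c k" for k by (simp add: c_def)
  ultimately show ?thesis by (intro exI[of _ "2 ^ m * (c 0 + c (2 * m))"]) auto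
qed

lemma Fubini_dominated:
  fixes f :: "real \<Rightarrow> real \<Rightarrow> complex"
  assumes f: "(\<lambda>(x, y). f x y) \<in> borel_measurable (lborel \<Otimes>\<^sub>M lborel)"
    and ab: "integrable lborel a" "integrable lborel b"
    and bound: "\<And>x y. norm (f x y) \<le> a x * b y"
  shows "(LBINT x. (LBINT y. f x y)) = (LBINT y. (LBINT x. f x y))"
    and "integrable lborel (\<lambda>x. LBINT y. f x y)"
proof -
  have fx: "integrable lborel (\<lambda>y. f x y)" for x
  proof (rule Bochner_Integration.integrable_bound[of _ "\<lambda>y. a x * b y"])
    show "(\<lambda>y. f x y) \<in> borel_measurable lborel"
      using measurable_compose[OF measurable_Pair1' f, of x] by simp
    show "AE y in lborel. norm (f x y) \<le> norm (a x * b y)"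
      using order_trans[OF bound abs_ge_self] by (intro AE_I2) simp
  qed (use ab in auto)
  have 1: "integrable (lborel \<Otimes>\<^sub>M lborel) (\<lambda>(x, y). f x y)"
  proof (rule lborel_pair.Fubini_integrable[OF f])
    show "AE x in lborel. integrable lborel (\<lambda>y. case (x, y) of (x, y) \<Rightarrow> f x y)"
      using fx by simp
    show "integrable lborel (\<lambda>x. LBINT y. norm (case (x, y) of (x, y) \<Rightarrow> f x y))"
    proof (rule Bochner_Integration.integrable_bound[of _ "\<lambda>x. a x * (LBINT y. b y)"])
      show "(\<lambda>x. LBINT y. norm (case (x, y) of (x, y) \<Rightarrow> f x y)) \<in> borel_measurable lborel"
        using f by (intro lborel.borel_measurable_lebesgue_integral) (simp add: case_prod_unfold)
      show "AE x in lborel. norm (LBINT y. norm (case (x, y) of (x, y) \<Rightarrow> f x y))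
          \<le> norm (a x * (LBINT y. b y))"
      proof (rule AE_I2)
        fix x
        have "(LBINT y. norm (f x y)) \<le> (LBINT y. a x * b y)"
          by (intro Bochner_Integration.integral_mono integrable_norm fx bound) (use ab in auto)
        moreover have "0 \<le> (LBINT y. norm (f x y))" by simp
        ultimately show "norm (LBINT y. norm (case (x, y) of (x, y) \<Rightarrow> f x y))
            \<le> norm (a x * (LBINT y. b y))" by simp
      qed
    qed (use ab in auto)
  qed
  from lborel_pair.Fubini_integral[OF this]
  show "(LBINT x. (LBINT y. f x y)) = (LBINT y. (LBINT x. f x y))" by simp
  show "integrable lborel (\<lambda>x. LBINT y. f x y)"
    using lborel_pair.integrable_fst'[OF 1] by simp
qed

lemma borel_measurable_pair_continuous:
  fixes f :: "real \<Rightarrow> real \<Rightarrow> complex"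
  assumes "continuous_on UNIV (\<lambda>(x, y). f x y)"
  shows "(\<lambda>(x, y). f x y) \<in> borel_measurable (lborel \<Otimes>\<^sub>M lborel)"
proof -
  have "(\<lambda>(x, y). f x y) \<in> borel_measurable (borel \<Otimes>\<^sub>M borel)"
    unfolding borel_prod by (rule borel_measurable_continuous_onI[OF assms])
  then show ?thesis
    by (subst measurable_cong_sets[of "lborel \<Otimes>\<^sub>M lborel" "borel \<Otimes>\<^sub>M borel"])
      (auto intro: sets_pair_measure_cong)
qed

text \<open>This is the characteristic function of the standard normal distribution.\<close>

lemma integral_gauss_cis:
  "(LBINT u. complex_of_real (exp (- u\<^sup>2 / 2)) * cis (u * t))
     = sqrt (2 * pi) * exp (- t\<^sup>2 / 2)"
proof -
  have "complex_of_real (exp (- (t^2) / 2)) = (\<integral>u. cis (t * u) \<partial>std_normal_distribution)"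
    using fun_cong[OF char_std_normal_distribution, of t] by (simp add: char_def cis_conv_exp)
  also have "\<dots> = (LBINT u. std_normal_density u *\<^sub>R cis (t * u))"
    by (subst integral_density) (auto intro!: borel_measurable_continuous_onI continuous_intros)
  also have "\<dots> = (LBINT u. complex_of_real (1 / sqrt (2 * pi)) *
      (complex_of_real (exp (- u\<^sup>2 / 2)) * cis (u * t)))"
    by (rule Bochner_Integration.integral_cong)
      (auto simp: std_normal_density_def scaleR_conv_of_real mult_ac)
  finally show ?thesis by (simp add: field_simps)
qed

lemma integrable_gauss: "integrable lborel (\<lambda>u::real. exp (- u\<^sup>2 / 2))"
proof -
  have "integrable lborel (\<lambda>u. sqrt (2 * pi) * (std_normal_density u * u ^ 0))"
    by (intro integrable_mult_right integrable_std_normal_moment)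
  then show ?thesis by (simp add: std_normal_density_def)
qed

abbreviation (input) gauss :: "real \<Rightarrow> real \<Rightarrow> complex" where
  "gauss \<eta> \<xi> \<equiv> complex_of_real (exp (- (\<eta> * \<xi>)\<^sup>2 / 2))"

lemma gauss_scaled:
  assumes "\<eta> > 0"
  shows "(LBINT \<xi>. gauss \<eta> \<xi> * cis (\<xi> * y))
     = sqrt (2 * pi) / \<eta> * exp (- (y / \<eta>)\<^sup>2 / 2)"
proof -
  have "complex_of_real (sqrt (2 * pi) * exp (- (y / \<eta>)\<^sup>2 / 2))
      = \<bar>\<eta>\<bar> *\<^sub>R (LBINT \<xi>. complex_of_real (exp (- (0 + \<eta> * \<xi>)\<^sup>2 / 2)) * cis ((0 + \<eta> * \<xi>) * (y / \<eta>)))"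
    unfolding integral_gauss_cis[of "y / \<eta>", symmetric] using assms
    by (intro lborel_integral_real_affine) simp
  then show ?thesis using assms by (simp add: field_simps scaleR_conv_of_real)
qed

lemma fourier_continuous:
  assumes "continuous_on UNIV f" "\<And>x. x \<notin> {0<..<1} \<Longrightarrow> f x = 0"
  shows "continuous_on UNIV (fourier f)"
  unfolding continuous_on_sequentially
proof (intro allI ballI impI)
  fix X and a :: real assume X: "(\<forall>n. X n \<in> UNIV) \<and> X \<longlonglongrightarrow> a"
  have c: "continuous_on UNIV (\<lambda>x. f x * cis (\<xi> * x))" for \<xi>
    by (intro continuous_intros assms)
  have "(\<lambda>n. LBINT x. f x * cis (X n * x)) \<longlonglongrightarrow> (LBINT x. f x * cis (a * x))"
  proof (rule integral_dominated_convergence[where w = "\<lambda>x. norm (f x)"])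
    show "integrable lborel (\<lambda>x. norm (f x))"
      using integrable_supported[OF assms] by simp
    show "AE x in lborel. (\<lambda>n. f x * cis (X n * x)) \<longlonglongrightarrow> f x * cis (a * x)"
      using X by (intro AE_I2) (auto intro!: tendsto_intros)
  qed (auto intro!: borel_measurable_continuous_onI c simp: norm_mult)
  then show "(fourier f \<circ> X) \<longlonglongrightarrow> fourier f a" by (simp add: o_def fourier_def)
qed

text \<open>Inversion by Gaussian regularisation: with the extra factor
  \<open>exp (- (\<eta>\<xi>)\<^sup>2 / 2)\<close> the order of integration may be changed, and the inner integral
  becomes an approximate identity of width \<open>\<eta>\<close>.\<close>

lemma fourier_inversion:
  fixes f :: "real \<Rightarrow> complex"
  assumes f: "continuous_on UNIV f" "\<And>x. x \<notin> {0<..<1} \<Longrightarrow> f x = 0"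
    and int: "integrable lborel (fourier f)"
  shows "(LBINT \<xi>. fourier f \<xi> * cis (- \<xi> * x)) = 2 * pi * f x"
proof -
  have fi: "integrable lborel f" by (rule integrable_supported[OF f])
  obtain B where B: "\<And>x. norm (f x) \<le> B"
  proof -
    have "compact (f ` {0..1})" by (intro compact_continuous_image continuous_on_subset[OF f(1)]) auto
    from compact_imp_bounded[OF this] obtain B where B: "\<forall>y\<in>f ` {0..1}. norm y \<le> B"
      unfolding bounded_iff by blast
    have "norm (f x) \<le> max B 0" for x
    proof (cases "x \<in> {0..1}")
      case True
      then show ?thesis using B by (simp add: le_max_iff_disj)
    next
      case False
      then have "x \<notin> {0<..<1}" by auto
      then show ?thesis using f(2)[of x] by simp
    qed
    then show ?thesis using that by blast
  qed
  define A where "A \<eta> = (LBINT \<xi>. gauss \<eta> \<xi> * (fourier f \<xi> * cis (- \<xi> * x)))" for \<eta>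
  define e where "e n = 1 / real (Suc n)" for n
  have e: "e \<longlonglongrightarrow> 0" "\<And>n. e n > 0"
    unfolding e_def using LIMSEQ_inverse_real_of_nat by (auto simp: inverse_eq_divide)
  have Fmeas[measurable]: "fourier f \<in> borel_measurable borel"
    by (intro borel_measurable_continuous_onI fourier_continuous f)
  have cismeas[measurable]: "(\<lambda>\<xi>. cis (- \<xi> * x)) \<in> borel_measurable borel"
    by (intro borel_measurable_continuous_onI continuous_intros)
  have "(\<lambda>n. A (e n)) \<longlonglongrightarrow> (LBINT \<xi>. fourier f \<xi> * cis (- \<xi> * x))"
    unfolding A_def
  proof (rule integral_dominated_convergence[where w = "\<lambda>\<xi>. norm (fourier f \<xi>)"])
    show "AE \<xi> in lborel. (\<lambda>n. gauss (e n) \<xi> * (fourier f \<xi> * cis (- \<xi> * x)))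
        \<longlonglongrightarrow> fourier f \<xi> * cis (- \<xi> * x)"
    proof (rule AE_I2)
      fix \<xi>
      have "(\<lambda>n. gauss (e n) \<xi> * (fourier f \<xi> * cis (- \<xi> * x)))
        \<longlonglongrightarrow> gauss 0 \<xi> * (fourier f \<xi> * cis (- \<xi> * x))"
        by (intro tendsto_intros e) simp
      then show "(\<lambda>n. gauss (e n) \<xi> * (fourier f \<xi> * cis (- \<xi> * x)))
        \<longlonglongrightarrow> fourier f \<xi> * cis (- \<xi> * x)" by simp
    qed
    show "AE \<xi> in lborel. norm (gauss (e n) \<xi> * (fourier f \<xi> * cis (- \<xi> * x)))
        \<le> norm (fourier f \<xi>)" for n
      by (rule AE_I2) (simp add: norm_mult mult_left_le_one_le)
    show "integrable lborel (\<lambda>\<xi>. norm (fourier f \<xi>))" using int by simp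
  qed measurable
  moreover have "(\<lambda>n. A (e n)) \<longlonglongrightarrow> 2 * pi * f x"
  proof -
    have A_eq: "A \<eta> = sqrt (2 * pi) * (LBINT v. complex_of_real (exp (- v\<^sup>2 / 2)) * f (x + \<eta> * v))" if "\<eta> > 0" for \<eta>
    proof -
      let ?G = "\<lambda>\<xi> \<tau>. gauss \<eta> \<xi> * (f \<tau> * cis (\<xi> * (\<tau> - x)))"
      have "A \<eta> = (LBINT \<xi>. (LBINT \<tau>. ?G \<xi> \<tau>))"
        unfolding A_def fourier_def
      proof (intro Bochner_Integration.integral_cong refl)
        fix \<xi>
        have "cis (\<xi> * \<tau>) * cis (- \<xi> * x) = cis (\<xi> * (\<tau> - x))" for \<tau>
          by (simp add: cis_mult right_diff_distrib)
        then have "(LBINT \<tau>. ?G \<xi> \<tau>) = (LBINT \<tau>. gauss \<eta> \<xi> *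
            ((f \<tau> * cis (\<xi> * \<tau>)) * cis (- \<xi> * x)))"
          by (simp only: mult.assoc)
        also have "\<dots> = gauss \<eta> \<xi> *
            ((LBINT \<tau>. f \<tau> * cis (\<xi> * \<tau>)) * cis (- \<xi> * x))"
          by (simp only: integral_mult_right_zero integral_mult_left_zero)
        finally show "gauss \<eta> \<xi> *
            ((LBINT \<tau>. f \<tau> * cis (\<xi> * \<tau>)) * cis (- \<xi> * x)) = (LBINT \<tau>. ?G \<xi> \<tau>)" ..
      qed
      also have "\<dots> = (LBINT \<tau>. (LBINT \<xi>. ?G \<xi> \<tau>))"
      proof (rule Fubini_dominated(1))
        show "(\<lambda>(\<xi>, \<tau>). ?G \<xi> \<tau>) \<in> borel_measurable (lborel \<Otimes>\<^sub>M lborel)"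
        proof (rule borel_measurable_pair_continuous)
          have "continuous_on UNIV (\<lambda>p. f (snd p))"
            by (rule continuous_on_compose2[OF f(1)]) (auto intro: continuous_intros)
          then show "continuous_on UNIV (\<lambda>(\<xi>, \<tau>). ?G \<xi> \<tau>)"
            unfolding case_prod_unfold by (intro continuous_intros) auto
        qed
        have "integrable lborel (\<lambda>\<xi>::real. exp (- (0 + \<eta> * \<xi>)\<^sup>2 / 2))"
          using lborel_integrable_real_affine[OF integrable_gauss, of \<eta> 0] that by simp
        then show "integrable lborel (\<lambda>\<xi>::real. exp (- (\<eta> * \<xi>)\<^sup>2 / 2))" by simp
        show "integrable lborel (\<lambda>x. norm (f x))" using fi by simp
      qed (simp add: norm_mult)
      also have "\<dots> = (LBINT \<tau>. f \<tau> * (sqrt (2 * pi) / \<eta> * exp (- ((\<tau> - x) / \<eta>)\<^sup>2 / 2)))"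
      proof (intro Bochner_Integration.integral_cong refl)
        fix \<tau>
        have "(LBINT \<xi>. ?G \<xi> \<tau>)
          = (LBINT \<xi>. f \<tau> * (gauss \<eta> \<xi> * cis (\<xi> * (\<tau> - x))))"
          by (simp add: mult_ac)
        also have "\<dots> = f \<tau> * (LBINT \<xi>. (gauss \<eta> \<xi> * cis (\<xi> * (\<tau> - x))))"
          by (rule integral_mult_right_zero)
        finally show "(LBINT \<xi>. ?G \<xi> \<tau>) = f \<tau> * (sqrt (2 * pi) / \<eta> * exp (- ((\<tau> - x) / \<eta>)\<^sup>2 / 2))"
          unfolding gauss_scaled[OF that] by simp
      qed
      also have "\<dots> = \<bar>\<eta>\<bar> *\<^sub>R (LBINT v. f (x + \<eta> * v) * (sqrt (2 * pi) / \<eta> * exp (- ((x + \<eta> * v - x) / \<eta>)\<^sup>2 / 2)))"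
        by (rule lborel_integral_real_affine) (use that in simp)
      also have "\<dots> = \<eta> * (LBINT v. (sqrt (2 * pi) / \<eta>) * (complex_of_real (exp (- v\<^sup>2 / 2)) * f (x + \<eta> * v)))"
      proof -
        have e: "(x + \<eta> * v - x) / \<eta> = v" for v using that by simp
        have "f (x + \<eta> * v) * complex_of_real (sqrt (2 * pi) / \<eta> * exp (- ((x + \<eta> * v - x) / \<eta>)\<^sup>2 / 2))
            = complex_of_real (sqrt (2 * pi) / \<eta>) * (complex_of_real (exp (- v\<^sup>2 / 2)) * f (x + \<eta> * v))" for v
          unfolding e by (simp only: of_real_mult mult_ac)
        then show ?thesis using that by (simp only: scaleR_conv_of_real abs_of_pos)
      qed
      also have "\<dots> = \<eta> * (complex_of_real (sqrt (2 * pi) / \<eta>) * (LBINT v. (complex_of_real (exp (- v\<^sup>2 / 2)) * f (x + \<eta> * v))))"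
        by (simp only: integral_mult_right_zero)
      also have "\<dots> = sqrt (2 * pi) * (LBINT v. complex_of_real (exp (- v\<^sup>2 / 2)) * f (x + \<eta> * v))"
      proof -
        have "complex_of_real \<eta> * (complex_of_real (c / \<eta>) * I) = complex_of_real c * I" for c I
          using that by simp
        then show ?thesis .
      qed
      finally show ?thesis .
    qed
    have "(\<lambda>n. LBINT v. complex_of_real (exp (- v\<^sup>2 / 2)) * f (x + e n * v)) \<longlonglongrightarrow> (LBINT v. complex_of_real (exp (- v\<^sup>2 / 2)) * f x)"
    proof (rule integral_dominated_convergence[where w = "\<lambda>v. exp (- v\<^sup>2 / 2) * B"])
      show "AE v in lborel. (\<lambda>n. complex_of_real (exp (- v\<^sup>2 / 2)) * f (x + e n * v)) \<longlonglongrightarrow> complex_of_real (exp (- v\<^sup>2 / 2)) * f x"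
      proof (rule AE_I2)
        fix v
        have "(\<lambda>n. x + e n * v) \<longlonglongrightarrow> x + 0 * v" by (intro tendsto_intros e)
        then have "(\<lambda>n. f (x + e n * v)) \<longlonglongrightarrow> f (x + 0 * v)"
          using f(1) by (intro isCont_tendsto_compose[of _ f]) (auto simp: continuous_on_eq_continuous_at)
        then show "(\<lambda>n. complex_of_real (exp (- v\<^sup>2 / 2)) * f (x + e n * v)) \<longlonglongrightarrow> complex_of_real (exp (- v\<^sup>2 / 2)) * f x"
          by (auto intro: tendsto_intros)
      qed
      have fc: "continuous_on UNIV (\<lambda>v. f (x + c * v))" for c
        by (rule continuous_on_compose2[OF f(1)]) (auto intro!: continuous_intros)
      have "continuous_on UNIV (\<lambda>v. complex_of_real (exp (- v\<^sup>2 / 2)) * f (x + e n * v))" for n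
        by (intro continuous_intros fc) auto
      then show "(\<lambda>v. complex_of_real (exp (- v\<^sup>2 / 2)) * f (x + e n * v)) \<in> borel_measurable lborel" for n
        by (simp add: borel_measurable_continuous_onI del: of_real_exp)
      show "AE v in lborel. norm (complex_of_real (exp (- v\<^sup>2 / 2)) * f (x + e n * v)) \<le> exp (- v\<^sup>2 / 2) * B" for n
        by (rule AE_I2) (simp add: norm_mult B)
      show "integrable lborel (\<lambda>v::real. exp (- v\<^sup>2 / 2) * B)"
        by (intro integrable_mult_left integrable_gauss)
    qed (auto intro!: borel_measurable_continuous_onI continuous_intros)
    then have "(\<lambda>n. A (e n)) \<longlonglongrightarrow> sqrt (2 * pi) * (LBINT v. complex_of_real (exp (- v\<^sup>2 / 2)) * f x)"
      unfolding A_eq[OF e(2)] by (rule tendsto_mult_left)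
    moreover have "(LBINT v. complex_of_real (exp (- v\<^sup>2 / 2)) * f x) = sqrt (2 * pi) * f x"
    proof -
      have "(LBINT v. complex_of_real (exp (- v\<^sup>2 / 2)) * cis (v * 0)) * f x = sqrt (2 * pi) * f x"
        by (simp only: integral_gauss_cis) simp
      then show ?thesis by (simp only: mult_zero_right cis_zero mult_1_right integral_mult_left_zero)
    qed
    moreover have "complex_of_real (sqrt (2 * pi)) * (complex_of_real (sqrt (2 * pi)) * f x)
        = complex_of_real (sqrt (2 * pi) * sqrt (2 * pi)) * f x"
      by (simp only: of_real_mult mult.assoc)
    moreover have "sqrt (2 * pi) * sqrt (2 * pi) = 2 * pi" by simp
    ultimately show ?thesis by (simp only:)
  qed
  ultimately show ?thesis by (rule LIMSEQ_unique)
qed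

section \<open>Substitution on the whole line\<close>

text \<open>Change of variables for real functions, applied to real and imaginary parts.\<close>

lemma integral_substitution_line:
  fixes f :: "real \<Rightarrow> complex"
  assumes g: "\<And>t. (g has_real_derivative g' t) (at t)" "\<And>t. g' t > 0"
    and S: "range g = S" "S \<in> sets borel"
    and f[measurable]: "f \<in> borel_measurable borel"
    and int: "integrable lborel (\<lambda>t. g' t *\<^sub>R f (g t))"
  shows "(LBINT t. g' t *\<^sub>R f (g t)) = (LBINT s. indicator S s *\<^sub>R f s)"
proof -
  have inj: "inj g"
  proof (rule strict_mono_imp_inj_on[OF strict_monoI])
    fix x y :: real assume "x < y"
    then show "g x < g y"
      by (rule DERIV_pos_imp_increasing) (use g in blast)
  qed
  have real: "(LBINT t. g' t * h (g t)) = (LBINT s. indicator S s *\<^sub>R h s) \<and>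
      integrable lborel (\<lambda>s. indicator S s *\<^sub>R h s)"
    if h[measurable]: "h \<in> borel_measurable borel" and i: "integrable lborel (\<lambda>t. g' t * h (g t))"
    for h :: "real \<Rightarrow> real"
  proof -
    have ih: "(\<lambda>t. \<bar>g' t\<bar> * h (g t)) absolutely_integrable_on UNIV"
      using i g(2) by (simp add: set_integrable_def integrable_completion abs_of_pos)
    have *: "h absolutely_integrable_on S \<and> integral S h = integral UNIV (\<lambda>t. \<bar>g' t\<bar> * h (g t))"
      using has_absolute_integral_change_of_variables_1'[of UNIV g g' h "integral UNIV (\<lambda>t. \<bar>g' t\<bar> * h (g t))"]
        g(1) inj ih S(1) by auto
    have m: "(\<lambda>s. indicator S s *\<^sub>R h s) \<in> borel_measurable lborel" using S(2) by measurable
    have "integrable lborel (\<lambda>s. indicator S s *\<^sub>R h s)"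
      using * m by (simp add: set_integrable_def integrable_completion)
    moreover have "integral S h = (LBINT s. indicator S s *\<^sub>R h s)"
      using set_lebesgue_integral_eq_integral(2)[OF conjunct1[OF *]] m
      by (simp add: set_lebesgue_integral_def integral_completion)
    moreover have "integral UNIV (\<lambda>t. \<bar>g' t\<bar> * h (g t)) = (LBINT t. g' t * h (g t))"
      using set_lebesgue_integral_eq_integral(2)[OF ih] i g(2)
      by (simp add: set_lebesgue_integral_def integral_completion abs_of_pos)
    ultimately show ?thesis using * by simp
  qed
  have re: "(LBINT t. g' t * Re (f (g t))) = (LBINT s. indicator S s *\<^sub>R Re (f s)) \<and>
      integrable lborel (\<lambda>s. indicator S s *\<^sub>R Re (f s))"
  proof (rule real)
    show "integrable lborel (\<lambda>t. g' t * Re (f (g t)))" using integrable_Re[OF int] by simp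
  qed measurable
  have im: "(LBINT t. g' t * Im (f (g t))) = (LBINT s. indicator S s *\<^sub>R Im (f s)) \<and>
      integrable lborel (\<lambda>s. indicator S s *\<^sub>R Im (f s))"
  proof (rule real)
    show "integrable lborel (\<lambda>t. g' t * Im (f (g t)))" using integrable_Im[OF int] by simp
  qed measurable
  have "integrable lborel (\<lambda>s. complex_of_real (indicator S s *\<^sub>R Re (f s))
      + \<i> * complex_of_real (indicator S s *\<^sub>R Im (f s)))"
    by (intro Bochner_Integration.integrable_add integrable_mult_right integrable_of_real
        conjunct2[OF re] conjunct2[OF im])
  also have "(\<lambda>s. complex_of_real (indicator S s *\<^sub>R Re (f s))
      + \<i> * complex_of_real (indicator S s *\<^sub>R Im (f s))) = (\<lambda>s. indicator S s *\<^sub>R f s)"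
    by (rule ext, rule complex_eqI) simp_all
  finally have i2: "integrable lborel (\<lambda>s. indicator S s *\<^sub>R f s)" .
  show ?thesis
  proof (rule complex_eqI)
    show "Re (LBINT t. g' t *\<^sub>R f (g t)) = Re (LBINT s. indicator S s *\<^sub>R f s)"
      using re integral_Re[OF int] integral_Re[OF i2] by simp
    show "Im (LBINT t. g' t *\<^sub>R f (g t)) = Im (LBINT s. indicator S s *\<^sub>R f s)"
      using im integral_Im[OF int] integral_Im[OF i2] by simp
  qed
qed

section \<open>Geometry of the inner polygon\<close>

definition side_dir :: "nat \<Rightarrow> (nat \<Rightarrow> complex) \<Rightarrow> nat \<Rightarrow> complex" where
  "side_dir n z j = cis (side_angle n z j)"

text \<open>The signed distance from the line through side \<open>j\<close>, positive on the left.\<close>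

definition line_dist :: "nat \<Rightarrow> (nat \<Rightarrow> complex) \<Rightarrow> nat \<Rightarrow> complex \<Rightarrow> real" where
  "line_dist n z j w = Im (cnj (side_dir n z j) * (w - z j))"

lemma norm_side_dir [simp]: "norm (side_dir n z j) = 1"
  by (simp add: side_dir_def)

lemma next_vertex_eq: "next_vertex n z j - z j = complex_of_real (side_length n z j) * side_dir n z j"
  using rcis_cmod_Arg[of "next_vertex n z j - z j"]
  by (simp add: rcis_def side_length_def side_dir_def side_angle_def dist_norm norm_minus_commute)

lemma cnj_mult_side_dir [simp]: "cnj (side_dir n z j) * side_dir n z j = 1"
  using complex_norm_square[of "side_dir n z j"] by (simp add: mult.commute)

lemma Im_of_real_mult: "Im (complex_of_real c * x) = c * Im x"
  and Re_of_real_mult: "Re (complex_of_real c * x) = c * Re x"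
  by simp_all

lemma polygon_third_vertex:
  fixes n :: nat
  assumes "n \<ge> 3" shows "\<exists>k<n. k \<noteq> i \<and> k \<noteq> j"
proof -
  have "\<not> {..<n} \<subseteq> {i, j}"
  proof
    assume "{..<n} \<subseteq> {i, j}"
    from card_mono[OF _ this] have "n \<le> card {i, j}" by simp
    also have "\<dots> \<le> 2" by (simp add: card_insert_if)
    finally show False using assms by simp
  qed
  then show ?thesis by blast
qed

locale convex_polygon =
  fixes n :: nat and z :: "nat \<Rightarrow> complex"
  assumes convex_polygon: "convex_polygon_ccw n z"
begin

abbreviation (input) "dir \<equiv> side_dir n z"
abbreviation (input) "ldist \<equiv> line_dist n z"
abbreviation (input) "nv \<equiv> next_vertex n z"

lemma at_least_three: "n \<ge> 3" using convex_polygon by (simp add: convex_polygon_ccw_def)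

lemma side_length_pos:
  assumes "j < n" shows "side_length n z j > 0"
proof -
  obtain k where "k < n" "k \<noteq> j" "k \<noteq> Suc j mod n" using polygon_third_vertex[OF at_least_three] by blast
  then have "Im (cnj (nv j - z j) * (z k - z j)) > 0"
    using convex_polygon assms unfolding convex_polygon_ccw_def by blast
  then have "nv j \<noteq> z j" by auto
  then show ?thesis by (simp add: side_length_def)
qed

lemma side_dir_sgn: "j < n \<Longrightarrow> sgn (nv j - z j) = dir j"
  using side_length_pos[of j] cis_Arg[of "nv j - z j"]
  by (simp add: side_dir_def side_angle_def side_length_def)

lemma line_dist_vertex_pos:
  assumes "j < n" "k < n" "k \<noteq> j" "k \<noteq> Suc j mod n"
  shows "ldist j (z k) > 0"
proof -
  have "Im (cnj (nv j - z j) * (z k - z j)) > 0"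
    using convex_polygon assms unfolding convex_polygon_ccw_def by blast
  moreover have "cnj (nv j - z j) * (z k - z j)
      = complex_of_real (side_length n z j) * (cnj (dir j) * (z k - z j))"
    unfolding next_vertex_eq by (simp add: mult.assoc)
  ultimately have "side_length n z j * ldist j (z k) > 0"
    unfolding line_dist_def by (simp only: Im_of_real_mult)
  then show ?thesis using side_length_pos[OF assms(1)] by (simp add: zero_less_mult_iff)
qed

lemma line_dist_start [simp]: "ldist j (z j) = 0" by (simp add: line_dist_def)

lemma line_dist_end [simp]: "ldist j (nv j) = 0"
  by (simp add: line_dist_def next_vertex_eq mult.left_commute[of _ "complex_of_real _"])

lemma line_dist_vertex_nonneg:
  assumes "j < n" "k < n" shows "ldist j (z k) \<ge> 0"
  using line_dist_vertex_pos[OF assms] line_dist_end[of j] line_dist_start[of j]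
  by (cases "k = j \<or> k = Suc j mod n") (auto simp: next_vertex_def less_imp_le)

lemma line_dist_linepath:
  "ldist j ((1 - t) *\<^sub>R v + t *\<^sub>R w) = (1 - t) * ldist j v + t * ldist j w"
proof -
  have "(1 - t) *\<^sub>R v + t *\<^sub>R w - z j = (1 - t) *\<^sub>R (v - z j) + t *\<^sub>R (w - z j)"
    by (simp add: algebra_simps scaleR_conv_of_real)
  then show ?thesis by (simp add: line_dist_def algebra_simps scaleR_conv_of_real)
qed

lemma line_dist_diff_le: "\<bar>ldist j v - ldist j w\<bar> \<le> dist v w"
proof -
  have "ldist j v - ldist j w = Im (cnj (dir j) * (v - w))"
    by (simp add: line_dist_def algebra_simps)
  also have "\<bar>\<dots>\<bar> \<le> norm (cnj (dir j) * (v - w))" by (rule abs_Im_le_cmod)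
  finally show ?thesis by (simp add: norm_mult dist_norm)
qed

lemma hull_line_dist_nonneg:
  assumes "j < n" "w \<in> convex hull (z ` {..<n})" shows "ldist j w \<ge> 0"
proof -
  have "convex {w. ldist j w \<ge> 0}"
    unfolding convex_alt by (auto simp: line_dist_linepath)
  then have "convex hull (z ` {..<n}) \<subseteq> {w. ldist j w \<ge> 0}"
    by (intro hull_minimal) (auto simp: line_dist_vertex_nonneg assms)
  then show ?thesis using assms by blast
qed

lemma interior_line_dist_pos:
  assumes "j < n" "w \<in> polygon_interior n z" shows "ldist j w > 0"
proof -
  obtain r where r: "r > 0" "ball w r \<subseteq> convex hull (z ` {..<n})"
    using assms(2) unfolding polygon_interior_def mem_interior by blast
  let ?v = "w - complex_of_real (r / 2) * (\<i> * dir j)"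
  have "?v \<in> ball w r" using r(1) by (simp add: dist_norm norm_mult)
  then have "ldist j ?v \<ge> 0" using hull_line_dist_nonneg[OF assms(1)] r(2) by blast
  moreover
  have "cnj (dir j) * (?v - z j)
      = cnj (dir j) * (w - z j) - complex_of_real (r / 2) * \<i> * (cnj (dir j) * dir j)"
    by (simp add: algebra_simps)
  then have "ldist j ?v = ldist j w - r / 2"
    unfolding line_dist_def cnj_mult_side_dir by simp
  ultimately show ?thesis using r(1) by simp
qed

text \<open>The segment from \<open>w\<close> to its foot on the line of side \<open>j\<close> ends outside the interior, so it meets
  the frontier on its way.\<close>

lemma infdist_frontier_le_line_dist:
  assumes "j < n" "w \<in> polygon_interior n z"
  shows "infdist w (frontier (polygon_interior n z)) \<le> ldist j w"
proof -
  let ?d = "ldist j w"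
  let ?p = "w - complex_of_real ?d * (\<i> * dir j)"
  have "cnj (dir j) * (?p - z j)
      = cnj (dir j) * (w - z j) - complex_of_real ?d * \<i> * (cnj (dir j) * dir j)"
    by (simp add: algebra_simps)
  then have "ldist j ?p = 0" by (simp add: line_dist_def)
  then have "?p \<notin> polygon_interior n z" using interior_line_dist_pos[OF assms(1), of ?p] by auto
  then have "closed_segment w ?p \<inter> frontier (polygon_interior n z) \<noteq> {}"
    using assms(2) by (intro connected_Int_frontier) auto
  then obtain q where q: "q \<in> closed_segment w ?p" "q \<in> frontier (polygon_interior n z)" by blast
  have "infdist w (frontier (polygon_interior n z)) \<le> dist w q" by (rule infdist_le[OF q(2)])
  also have "\<dots> \<le> dist w ?p"
    using segment_bound(1)[OF q(1)] by (simp add: dist_norm norm_minus_commute)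
  also have "\<dots> = ?d" using interior_line_dist_pos[OF assms] by (simp add: dist_norm norm_mult)
  finally show ?thesis .
qed

end

text \<open>By Cramer's rule, \<open>q - a = s (b - a) + t (p - a)\<close>. Near the half of \<open>[a, b]\<close> at \<open>a\<close> the third
  barycentric coordinate is automatically positive.\<close>

lemma near_side_in_triangle:
  fixes a b p :: complex
  defines "D \<equiv> Im (cnj (b - a) * (p - a))"
  assumes D: "D \<noteq> 0"
  shows "\<exists>\<delta>>0. \<forall>q. 0 < Im (cnj (b - a) * (q - a)) / D \<longrightarrow> Im (cnj (b - a) * (q - a)) / D < \<delta> \<longrightarrow>
     0 < Im (cnj (q - a) * (p - a)) / D \<longrightarrow> Re (cnj (b - a) * (q - a)) \<le> (norm (b - a))\<^sup>2 / 2 \<longrightarrow>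
     q \<in> convex hull {a, b, p}"
proof -
  define R where "R = Re (cnj (b - a) * (p - a))"
  define K where "K = \<bar>R\<bar> / (norm (b - a))\<^sup>2"
  have ab: "(norm (b - a))\<^sup>2 > 0" using D by (auto simp: D_def)
  have K: "K \<ge> 0" by (simp add: K_def)
  show ?thesis
  proof (intro exI[of _ "1 / (2 * (1 + K))"] conjI allI impI)
    show "0 < 1 / (2 * (1 + K))" using K by simp
    fix q
    define t s where "t = Im (cnj (b - a) * (q - a)) / D" and "s = Im (cnj (q - a) * (p - a)) / D"
    assume t: "0 < Im (cnj (b - a) * (q - a)) / D" "Im (cnj (b - a) * (q - a)) / D < 1 / (2 * (1 + K))"
      and s: "0 < Im (cnj (q - a) * (p - a)) / D"
      and x: "Re (cnj (b - a) * (q - a)) \<le> (norm (b - a))\<^sup>2 / 2"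
    define A B where "A = Im (cnj (q - a) * (p - a))" and "B = Im (cnj (b - a) * (q - a))"
    have "complex_of_real D * (q - a) = complex_of_real A * (b - a) + complex_of_real B * (p - a)"
      unfolding D_def A_def B_def by (simp add: complex_eq_iff algebra_simps)
    moreover have "q - a = (complex_of_real D * (q - a)) / complex_of_real D"
      using D by simp
    ultimately have "q - a = (complex_of_real A * (b - a) + complex_of_real B * (p - a)) / complex_of_real D"
      by (simp only:)
    then have qa: "q - a = complex_of_real s * (b - a) + complex_of_real t * (p - a)"
      unfolding s_def t_def A_def[symmetric] B_def[symmetric] by (simp add: add_divide_distrib)
    have "cnj (b - a) * (q - a) = complex_of_real s * (cnj (b - a) * (b - a)) + complex_of_real t * (cnj (b - a) * (p - a))"
      unfolding qa by (simp add: algebra_simps)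
    also have "cnj (b - a) * (b - a) = complex_of_real ((norm (b - a))\<^sup>2)"
      by (subst complex_norm_square) (simp add: mult.commute)
    finally have "Re (cnj (b - a) * (q - a)) = s * (norm (b - a))\<^sup>2 + t * R"
      unfolding R_def by (simp only: plus_complex.sel Re_of_real_mult Re_complex_of_real)
    moreover have "t * - R \<le> t * \<bar>R\<bar>"
      using t(1) unfolding t_def[symmetric] by (intro mult_left_mono) auto
    ultimately have "s * (norm (b - a))\<^sup>2 \<le> (norm (b - a))\<^sup>2 / 2 + t * \<bar>R\<bar>"
      using x by simp
    also have "\<dots> = (1 / 2 + t * K) * (norm (b - a))\<^sup>2"
      using ab by (simp add: K_def field_simps)
    finally have "s \<le> 1 / 2 + t * K" using ab by (simp only: mult_le_cancel_right_pos)
    moreover have "t * (1 + K) < 1 / 2"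
      using t(2) K unfolding t_def[symmetric] by (simp add: field_simps)
    ultimately have st: "s + t < 1" by (simp add: algebra_simps)
    have "q = a + (s *\<^sub>R (b - a) + t *\<^sub>R (p - a))" using qa by (simp add: scaleR_conv_of_real algebra_simps)
    then have "q = (1 - s - t) *\<^sub>R a + s *\<^sub>R b + t *\<^sub>R p" by (simp add: algebra_simps)
    then show "q \<in> convex hull {a, b, p}"
      unfolding convex_hull_3 using st s t(1) unfolding s_def[symmetric] t_def[symmetric]
      by (intro CollectI exI[of _ "1 - s - t"] exI[of _ s] exI[of _ t]) auto
  qed
qed

locale polygon_side = convex_polygon +
  fixes i :: nat
  assumes i_less: "i < n"
begin

abbreviation (input) "A \<equiv> z i"
abbreviation (input) "B \<equiv> nv i"
abbreviation (input) "e \<equiv> dir i"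
abbreviation (input) "L \<equiv> side_length n z i"

definition prv :: nat where "prv = (if i = 0 then n - 1 else i - 1)"
definition nxt :: nat where "nxt = Suc i mod n"

lemma prv_nxt: "prv < n" "nxt < n" "Suc prv mod n = i" "prv \<noteq> i" "nxt \<noteq> i" "prv \<noteq> nxt"
  "B = z nxt" "nv prv = A"
proof -
  show "prv < n" "nxt < n" using i_less at_least_three by (auto simp: prv_def nxt_def)
  show s: "Suc prv mod n = i" using i_less at_least_three by (auto simp: prv_def)
  show "nxt \<noteq> i" "prv \<noteq> i" "prv \<noteq> nxt" "B = z nxt" "nv prv = A"
    using i_less at_least_three s
    by (auto simp: prv_def nxt_def next_vertex_def mod_Suc split: if_splits)
qed

text \<open>Cosine and sine of the exterior angles at the end (\<open>f\<close>) and at the start (\<open>g\<close>) of side \<open>i\<close>. Then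
  \<open>xa\<close> and \<open>xb\<close> are the cotangents of half the interior angles: moving a side inwards by \<open>\<epsilon>\<close>
  shortens it by \<open>\<epsilon> xa\<close> at its start and by \<open>\<epsilon> xb\<close> at its end.\<close>

definition cf :: real where "cf = Re (cnj e * dir nxt)"
definition sf :: real where "sf = Im (cnj e * dir nxt)"
definition cg :: real where "cg = Re (cnj (dir prv) * e)"
definition sg :: real where "sg = Im (cnj (dir prv) * e)"
definition xa :: real where "xa = (1 - cg) / sg"
definition xb :: real where "xb = (1 - cf) / sf"

text \<open>Cartesian coordinates with side \<open>i\<close> as first axis and the polygon above it.\<close>

definition pt :: "real \<Rightarrow> real \<Rightarrow> complex" where "pt x y = A + e * Complex x y"

lemma L_pos: "L > 0" using side_length_pos i_less by blast

lemma B_eq: "B = A + complex_of_real L * e" using next_vertex_eq[of n z i] by (simp add: algebra_simps)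

lemma nxt_next_eq: "nv nxt = B + complex_of_real (side_length n z nxt) * dir nxt"
  using next_vertex_eq[of n z nxt] prv_nxt by (simp add: algebra_simps)

lemma prv_eq: "z prv = A - complex_of_real (side_length n z prv) * dir prv"
  using next_vertex_eq[of n z prv] prv_nxt by (simp add: algebra_simps)

text \<open>The exterior angles lie strictly between \<open>0\<close> and \<open>\<pi>\<close>, as the next vertex but one is strictly to the
  left of side \<open>i\<close>.\<close>

lemma sf_pos: "sf > 0"
proof -
  have n1: "Suc nxt mod n \<noteq> i" "Suc nxt mod n \<noteq> nxt"
    using i_less at_least_three by (auto simp: nxt_def mod_Suc split: if_splits)
  then have "ldist i (nv nxt) > 0"
    unfolding next_vertex_def using prv_nxt i_less by (intro line_dist_vertex_pos) (auto simp: nxt_def)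
  moreover have "cnj e * (nv nxt - A)
      = complex_of_real L * (cnj e * e) + complex_of_real (side_length n z nxt) * (cnj e * dir nxt)"
    unfolding nxt_next_eq B_eq by (simp add: algebra_simps)
  then have "ldist i (nv nxt) = side_length n z nxt * sf"
    unfolding line_dist_def sf_def by (simp only: cnj_mult_side_dir plus_complex.sel Im_of_real_mult) simp
  ultimately show ?thesis using side_length_pos[of nxt] prv_nxt by (simp add: zero_less_mult_iff)
qed

lemma sg_pos: "sg > 0"
proof -
  have "ldist i (z prv) > 0"
    using prv_nxt i_less by (intro line_dist_vertex_pos) (auto simp: nxt_def)
  moreover have "cnj e * (z prv - A) = complex_of_real (- side_length n z prv) * cnj (cnj (dir prv) * e)"
    unfolding prv_eq by (simp add: algebra_simps)
  then have *: "cnj e * (z prv - A) = complex_of_real (- side_length n z prv) * cnj (cnj (dir prv) * e)" .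
  have "ldist i (z prv) = side_length n z prv * sg"
    unfolding line_dist_def sg_def * by (simp only: Im_of_real_mult complex_cnj) (simp add: algebra_simps)
  ultimately show ?thesis using side_length_pos[of prv] prv_nxt by (simp add: zero_less_mult_iff)
qed

lemma cf_cg_less: "cf < 1" "cg < 1"
proof -
  have "cf\<^sup>2 + sf\<^sup>2 = 1" "cg\<^sup>2 + sg\<^sup>2 = 1"
    unfolding cf_def sf_def cg_def sg_def cmod_power2[symmetric] by (simp_all add: norm_mult)
  then have "cf\<^sup>2 < 1" "cg\<^sup>2 < 1" using sf_pos sg_pos zero_less_power[of sf 2] zero_less_power[of sg 2] by linarith+
  then show "cf < 1" "cg < 1" by (simp_all add: power_less_one_iff abs_square_less_1 abs_less_iff)
qed

lemma xa_pos: "xa > 0" and xb_pos: "xb > 0"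
  unfolding xa_def xb_def using sf_pos sg_pos cf_cg_less by simp_all

lemma xa_sg: "xa * sg = 1 - cg" and xb_sf: "xb * sf = 1 - cf"
  unfolding xa_def xb_def using sf_pos sg_pos by simp_all

lemma pt_surj: "w = pt (Re (cnj e * (w - A))) (Im (cnj e * (w - A)))"
proof -
  have "e * (cnj e * (w - A)) = (cnj e * e) * (w - A)" by (simp only: mult_ac)
  then have *: "e * (cnj e * (w - A)) = w - A" by (simp only: cnj_mult_side_dir mult_1_left)
  show ?thesis unfolding pt_def complex_surj * by simp
qed

lemma cnj_e_pt: "cnj e * (pt x y - A) = Complex x y"
proof -
  have "cnj e * (pt x y - A) = (cnj e * e) * Complex x y" unfolding pt_def by (simp add: mult.assoc)
  then show ?thesis by simp
qed

lemma line_dist_i_pt: "ldist i (pt x y) = y"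
  unfolding line_dist_def cnj_e_pt by simp

lemma line_dist_prv_pt: "ldist prv (pt x y) = y * cg + x * sg"
proof -
  let ?g = "dir prv"
  have "cnj ?g * (pt x y - z prv)
     = (cnj ?g * e) * Complex x y + complex_of_real (side_length n z prv) * (cnj ?g * ?g)"
    unfolding pt_def prv_eq by (simp add: algebra_simps)
  also have "\<dots> = Complex cg sg * Complex x y + complex_of_real (side_length n z prv)"
    unfolding cg_def sg_def complex_surj cnj_mult_side_dir by simp
  finally show ?thesis unfolding line_dist_def by (simp add: algebra_simps)
qed

lemma line_dist_nxt_pt: "ldist nxt (pt x y) = y * cf + (L - x) * sf"
proof -
  let ?f = "dir nxt"
  have "cnj ?f * (pt x y - z nxt) = cnj (cnj e * ?f) * (Complex x y - complex_of_real L)"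
    unfolding prv_nxt(7)[symmetric] pt_def B_eq by (simp add: algebra_simps)
  also have "\<dots> = cnj (Complex cf sf) * (Complex x y - complex_of_real L)"
    unfolding cf_def sf_def complex_surj by simp
  finally have *: "cnj ?f * (pt x y - z nxt) = cnj (Complex cf sf) * (Complex x y - complex_of_real L)" .
  show ?thesis unfolding line_dist_def * by (simp add: algebra_simps)
qed

lemma pt_A: "pt 0 0 = A" and pt_B: "pt L 0 = B"
  unfolding pt_def B_eq by (simp_all add: complex_eq_iff)

text \<open>The triangles that side \<open>i\<close> spans with the preceding and with the following vertex cover a
  neighbourhood of the side, as far as it lies to the left of the three lines involved.\<close>

lemma near_side_in_hull:
  "\<exists>\<delta>>0. \<forall>x y. 0 < y \<longrightarrow> y < \<delta> \<longrightarrow> ldist prv (pt x y) > 0 \<longrightarrow> ldist nxt (pt x y) > 0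
     \<longrightarrow> pt x y \<in> convex hull (z ` {..<n})"
proof -
  let ?h = "side_length n z prv" and ?k = "side_length n z nxt"
  have hk: "?h > 0" "?k > 0" using side_length_pos prv_nxt by auto
  have BA: "B - A = complex_of_real L * e" unfolding B_eq by simp
  have AB: "A - B = complex_of_real (- L) * e" unfolding B_eq by simp
  have nBA: "norm (B - A) = L" "norm (A - B) = L" unfolding BA AB using L_pos by (simp_all add: norm_mult)
  have p1: "z prv - A = e * (complex_of_real (- ?h) * cnj (Complex cg sg))"
  proof -
    have "e * (complex_of_real (- ?h) * cnj (Complex cg sg)) = complex_of_real (- ?h) * (dir prv * (cnj e * e))"
      unfolding cg_def sg_def complex_surj by (simp add: mult_ac)
    then have *: "e * (complex_of_real (- ?h) * cnj (Complex cg sg)) = complex_of_real (- ?h) * dir prv"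
      by (simp only: cnj_mult_side_dir mult_1_right)
    show ?thesis unfolding * prv_eq by simp
  qed
  have p2: "nv nxt - B = e * (complex_of_real ?k * Complex cf sf)"
  proof -
    have "e * (complex_of_real ?k * Complex cf sf) = complex_of_real ?k * (dir nxt * (cnj e * e))"
      unfolding cf_def sf_def complex_surj by (simp add: mult_ac)
    then have *: "e * (complex_of_real ?k * Complex cf sf) = complex_of_real ?k * dir nxt"
      by (simp only: cnj_mult_side_dir mult_1_right)
    show ?thesis unfolding * nxt_next_eq by simp
  qed
  have q1: "pt x y - A = e * Complex x y" for x y by (simp add: pt_def)
  have q2: "pt x y - B = e * Complex (x - L) y" for x y
    unfolding pt_def B_eq by (simp add: complex_eq_iff algebra_simps)
  have ee: "cnj (e * u) * (e * v) = cnj u * v" "cnj (complex_of_real c * e) * (e * v) = complex_of_real c * v" for u v c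
  proof -
    have "cnj (e * u) * (e * v) = (cnj e * e) * (cnj u * v)" by (simp only: complex_cnj_mult mult_ac)
    then show "cnj (e * u) * (e * v) = cnj u * v" by simp
    have "cnj (complex_of_real c * e) * (e * v) = (cnj e * e) * (complex_of_real c * v)"
      by (simp only: complex_cnj_mult complex_cnj_complex_of_real mult_ac)
    then show "cnj (complex_of_real c * e) * (e * v) = complex_of_real c * v" by simp
  qed
  have D1: "Im (cnj (B - A) * (z prv - A)) = L * ?h * sg" unfolding BA p1 ee by simp
  have D2: "Im (cnj (A - B) * (nv nxt - B)) = - L * ?k * sf" unfolding AB p2 ee by simp
  have n1: "L * ?h * sg \<noteq> 0" "- L * ?k * sf \<noteq> 0" using L_pos hk sg_pos sf_pos by simp_all
  obtain d1 where d1: "d1 > 0"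
    "\<And>q. 0 < Im (cnj (B - A) * (q - A)) / (L * ?h * sg) \<Longrightarrow> Im (cnj (B - A) * (q - A)) / (L * ?h * sg) < d1 \<Longrightarrow>
     0 < Im (cnj (q - A) * (z prv - A)) / (L * ?h * sg) \<Longrightarrow> Re (cnj (B - A) * (q - A)) \<le> L\<^sup>2 / 2 \<Longrightarrow>
     q \<in> convex hull {A, B, z prv}"
    using near_side_in_triangle[of B A "z prv", unfolded D1 nBA, OF n1(1)] by blast
  obtain d2 where d2: "d2 > 0"
    "\<And>q. 0 < Im (cnj (A - B) * (q - B)) / (- L * ?k * sf) \<Longrightarrow> Im (cnj (A - B) * (q - B)) / (- L * ?k * sf) < d2 \<Longrightarrow>
     0 < Im (cnj (q - B) * (nv nxt - B)) / (- L * ?k * sf) \<Longrightarrow> Re (cnj (A - B) * (q - B)) \<le> L\<^sup>2 / 2 \<Longrightarrow>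
     q \<in> convex hull {B, A, nv nxt}"
    using near_side_in_triangle[of A B "nv nxt", unfolded D2 nBA, OF n1(2)] by blast
  have sub: "convex hull {A, B, z prv} \<subseteq> convex hull (z ` {..<n})"
    "convex hull {B, A, nv nxt} \<subseteq> convex hull (z ` {..<n})"
  proof -
    have "z k \<in> z ` {..<n}" if "k < n" for k using that by simp
    moreover have "nv nxt = z (Suc nxt mod n)" "Suc nxt mod n < n"
      using at_least_three by (simp_all add: next_vertex_def)
    ultimately have subs: "{A, B, z prv} \<subseteq> z ` {..<n}" "{B, A, nv nxt} \<subseteq> z ` {..<n}"
      using prv_nxt(1,2,7) i_less by simp_all
    show "convex hull {A, B, z prv} \<subseteq> convex hull (z ` {..<n})"
      by (rule hull_mono[OF subs(1)])
    show "convex hull {B, A, nv nxt} \<subseteq> convex hull (z ` {..<n})"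
      by (rule hull_mono[OF subs(2)])
  qed
  show ?thesis
  proof (intro exI[of _ "min (d1 * (?h * sg)) (d2 * (?k * sf))"] conjI allI impI)
    show "0 < min (d1 * (?h * sg)) (d2 * (?k * sf))" using d1(1) d2(1) hk sg_pos sf_pos by simp
    fix x y assume y: "0 < y" "y < min (d1 * (?h * sg)) (d2 * (?k * sf))"
      and "ldist prv (pt x y) > 0" "ldist nxt (pt x y) > 0"
    then have lp: "0 < y * cg + x * sg" and ln: "0 < y * cf + (L - x) * sf"
      by (simp_all add: line_dist_prv_pt line_dist_nxt_pt)
    show "pt x y \<in> convex hull (z ` {..<n})"
    proof (cases "x \<le> L / 2")
      case True
      have "pt x y \<in> convex hull {A, B, z prv}"
      proof (rule d1(2))
        have 1: "Im (cnj (B - A) * (pt x y - A)) / (L * ?h * sg) = y / (?h * sg)"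
          unfolding BA q1 ee using L_pos by simp
        show "0 < Im (cnj (B - A) * (pt x y - A)) / (L * ?h * sg)"
          unfolding 1 using y hk sg_pos by simp
        show "Im (cnj (B - A) * (pt x y - A)) / (L * ?h * sg) < d1"
          unfolding 1 using y hk sg_pos by (simp add: divide_less_eq)
        have "Im (cnj (pt x y - A) * (z prv - A)) = ?h * (y * cg + x * sg)"
          unfolding q1 p1 ee by (simp add: algebra_simps)
        then show "0 < Im (cnj (pt x y - A) * (z prv - A)) / (L * ?h * sg)"
          using L_pos hk sg_pos lp by simp
        show "Re (cnj (B - A) * (pt x y - A)) \<le> L\<^sup>2 / 2"
          unfolding BA q1 ee using L_pos True by (simp add: power2_eq_square)
      qed
      then show ?thesis using sub by blast
    next
      case False
      have "pt x y \<in> convex hull {B, A, nv nxt}"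
      proof (rule d2(2))
        have 1: "Im (cnj (A - B) * (pt x y - B)) / (- L * ?k * sf) = y / (?k * sf)"
          unfolding AB q2 ee using L_pos by simp
        show "0 < Im (cnj (A - B) * (pt x y - B)) / (- L * ?k * sf)"
          unfolding 1 using y hk sf_pos by simp
        show "Im (cnj (A - B) * (pt x y - B)) / (- L * ?k * sf) < d2"
          unfolding 1 using y hk sf_pos by (simp add: divide_less_eq)
        have "Im (cnj (pt x y - B) * (nv nxt - B)) / (- L * ?k * sf)
           = (y * cf + (L - x) * sf) / (L * sf)"
          unfolding q2 p2 ee using L_pos hk sf_pos by (simp add: field_simps)
        then show "0 < Im (cnj (pt x y - B) * (nv nxt - B)) / (- L * ?k * sf)"
          using L_pos sf_pos ln by simp
        have "L * (L - x) \<le> L * (L / 2)" using L_pos False by (intro mult_left_mono) auto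
        then show "Re (cnj (A - B) * (pt x y - B)) \<le> L\<^sup>2 / 2"
          unfolding AB q2 ee by (simp add: power2_eq_square algebra_simps)
      qed
      then show ?thesis using sub by blast
    qed
  qed
qed

lemma linepath_pt: "linepath (pt x y) (pt x' y') t = pt ((1 - t) * x + t * x') ((1 - t) * y + t * y')"
  unfolding linepath_def pt_def by (simp add: complex_eq_iff algebra_simps)

lemma side_nonempty: "side n z i \<noteq> {}"
proof -
  have "A \<noteq> B" using L_pos by (simp add: side_length_def)
  then show ?thesis by (simp add: side_def)
qed

lemma frontier_nonempty:
  assumes "w \<in> polygon_interior n z" shows "frontier (polygon_interior n z) \<noteq> {}"
proof -
  have "pt 0 0 \<notin> polygon_interior n z"
    using interior_line_dist_pos[OF i_less, of "pt 0 0"] by (auto simp: line_dist_i_pt)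
  then show ?thesis using assms by (auto simp: frontier_eq_empty)
qed

lemma infdist_side_ge: "ldist i w \<le> infdist w (side n z i)"
proof -
  have "ldist i w \<le> dist w q" if q: "q \<in> side n z i" for q
  proof -
    obtain t where "q = (1 - t) *\<^sub>R A + t *\<^sub>R B" using q by (auto simp: side_def in_segment)
    then have "ldist i q = 0" by (simp add: line_dist_linepath)
    then show ?thesis using line_dist_diff_le[of i w q] by simp
  qed
  then show ?thesis unfolding infdist_def using side_nonempty by (auto intro: cINF_greatest)
qed

text \<open>A point at distance at least \<open>\<epsilon>\<close> from the frontier has signed distance at least \<open>\<epsilon>\<close> from each
  side line, and at height \<open>\<epsilon>\<close> the two adjacent lines leave exactly the segment. Conversely the
  \<open>\<epsilon>\<close>-disc about a point of the segment respects side \<open>i\<close> and its neighbours, which by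
  \<open>near_side_in_hull\<close> is all that matters for small \<open>\<epsilon>\<close>.\<close>

lemma inner_side_eq:
  "\<exists>\<epsilon>0>0. \<forall>\<epsilon>. 0 < \<epsilon> \<longrightarrow> \<epsilon> < \<epsilon>0 \<longrightarrow> \<epsilon> * xa < L - \<epsilon> * xb \<and>
     inner_side n z \<epsilon> i = closed_segment (pt (\<epsilon> * xa) \<epsilon>) (pt (L - \<epsilon> * xb) \<epsilon>) \<and>
     inner_side n z \<epsilon> i \<subseteq> polygon_interior n z"
proof -
  obtain \<delta> where \<delta>: "\<delta> > 0" "\<And>x y. 0 < y \<Longrightarrow> y < \<delta> \<Longrightarrow> ldist prv (pt x y) > 0 \<Longrightarrow>
     ldist nxt (pt x y) > 0 \<Longrightarrow> pt x y \<in> convex hull (z ` {..<n})"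
    using near_side_in_hull by blast
  define \<epsilon>0 where "\<epsilon>0 = min (\<delta> / 2) (L / (1 + xa + xb))"
  have den: "1 + xa + xb > 0" using xa_pos xb_pos by linarith
  have \<epsilon>0: "\<epsilon>0 > 0" unfolding \<epsilon>0_def using \<delta>(1) L_pos den by simp
  show ?thesis
  proof (intro exI[of _ \<epsilon>0] conjI allI impI \<epsilon>0)
    fix \<epsilon> assume e: "0 < \<epsilon>" "\<epsilon> < \<epsilon>0"
    have "\<epsilon> < L / (1 + xa + xb)" using e(2) by (simp add: \<epsilon>0_def)
    then have "\<epsilon> * (1 + xa + xb) < L" using den by (simp add: pos_less_divide_eq)
    then show xx: "\<epsilon> * xa < L - \<epsilon> * xb" using e(1) by (simp add: algebra_simps)
    have e2: "2 * \<epsilon> < \<delta>" using e(2) by (simp add: \<epsilon>0_def)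
    have ball: "ball w \<epsilon> \<subseteq> polygon_interior n z"
      if w: "w = pt x \<epsilon>" "\<epsilon> * xa \<le> x" "x \<le> L - \<epsilon> * xb" for w x
    proof -
      have "\<epsilon> * (xa * sg) \<le> x * sg" "\<epsilon> * (xb * sf) \<le> (L - x) * sf"
        using w sg_pos sf_pos by (simp_all flip: mult.assoc)
      then have d: "ldist prv w \<ge> \<epsilon>" "ldist nxt w \<ge> \<epsilon>" "ldist i w = \<epsilon>"
        unfolding w(1) line_dist_prv_pt line_dist_nxt_pt line_dist_i_pt xa_sg xb_sf
        by (simp_all add: algebra_simps)
      have "q \<in> convex hull (z ` {..<n})" if q: "q \<in> ball w \<epsilon>" for q
      proof -
        have "dist w q < \<epsilon>" using q by simp
        then have dq: "ldist prv q > 0" "ldist nxt q > 0" "ldist i q > 0"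
           "ldist i q < 2 * \<epsilon>"
          using line_dist_diff_le[of prv w q] line_dist_diff_le[of nxt w q] line_dist_diff_le[of i w q] d
          by linarith+
        define x' y' where "x' = Re (cnj e * (q - A))" and "y' = Im (cnj e * (q - A))"
        have qp: "q = pt x' y'" using pt_surj[of q] unfolding x'_def y'_def .
        have "pt x' y' \<in> convex hull (z ` {..<n})"
          by (rule \<delta>(2)) (use dq e2 in \<open>simp_all add: qp line_dist_i_pt\<close>)
        then show ?thesis using qp by simp
      qed
      then show ?thesis unfolding polygon_interior_def by (intro interior_maximal) auto
    qed
    have seg: "closed_segment (pt (\<epsilon> * xa) \<epsilon>) (pt (L - \<epsilon> * xb) \<epsilon>)
        = {pt x \<epsilon> | x. \<epsilon> * xa \<le> x \<and> x \<le> L - \<epsilon> * xb}"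
    proof (intro set_eqI iffI)
      fix w assume "w \<in> closed_segment (pt (\<epsilon> * xa) \<epsilon>) (pt (L - \<epsilon> * xb) \<epsilon>)"
      then obtain t where t: "0 \<le> t" "t \<le> 1" "w = linepath (pt (\<epsilon> * xa) \<epsilon>) (pt (L - \<epsilon> * xb) \<epsilon>) t"
        unfolding in_segment linepath_def by blast
      let ?x = "(1 - t) * (\<epsilon> * xa) + t * (L - \<epsilon> * xb)"
      have "w = pt ?x \<epsilon>" unfolding t(3) linepath_pt by (simp add: algebra_simps)
      moreover have "t * (\<epsilon> * xa) \<le> t * (L - \<epsilon> * xb)" "(1 - t) * (\<epsilon> * xa) \<le> (1 - t) * (L - \<epsilon> * xb)"
        using t xx by (intro mult_left_mono; simp)+
      then have "\<epsilon> * xa \<le> ?x" "?x \<le> L - \<epsilon> * xb" by (simp_all add: algebra_simps)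
      ultimately show "w \<in> {pt x \<epsilon> | x. \<epsilon> * xa \<le> x \<and> x \<le> L - \<epsilon> * xb}" by blast
    next
      fix w assume "w \<in> {pt x \<epsilon> | x. \<epsilon> * xa \<le> x \<and> x \<le> L - \<epsilon> * xb}"
      then obtain x where x: "w = pt x \<epsilon>" "\<epsilon> * xa \<le> x" "x \<le> L - \<epsilon> * xb" by blast
      define D where "D = L - \<epsilon> * xb - \<epsilon> * xa"
      have D: "D > 0" using xx by (simp add: D_def)
      define t where "t = (x - \<epsilon> * xa) / D"
      have t: "0 \<le> t" "t \<le> 1" using x D by (simp_all add: t_def D_def divide_le_eq)
      have "t * D = x - \<epsilon> * xa" using D by (simp add: t_def)
      then have "(1 - t) * (\<epsilon> * xa) + t * (L - \<epsilon> * xb) = x" by (simp add: D_def algebra_simps)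
      then have "w = linepath (pt (\<epsilon> * xa) \<epsilon>) (pt (L - \<epsilon> * xb) \<epsilon>) t"
        unfolding linepath_pt x(1) by (simp add: algebra_simps)
      then show "w \<in> closed_segment (pt (\<epsilon> * xa) \<epsilon>) (pt (L - \<epsilon> * xb) \<epsilon>)"
        using t unfolding in_segment linepath_def by blast
    qed
    show "inner_side n z \<epsilon> i \<subseteq> polygon_interior n z"
      by (auto simp: inner_side_def inner_polygon_def)
    show "inner_side n z \<epsilon> i = closed_segment (pt (\<epsilon> * xa) \<epsilon>) (pt (L - \<epsilon> * xb) \<epsilon>)"
      unfolding seg
    proof (intro set_eqI iffI)
      fix w assume "w \<in> inner_side n z \<epsilon> i"
      then have w: "w \<in> polygon_interior n z" "infdist w (frontier (polygon_interior n z)) \<ge> \<epsilon>"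
        "infdist w (side n z i) = \<epsilon>" by (auto simp: inner_side_def inner_polygon_def)
      have d: "ldist j w \<ge> \<epsilon>" if "j < n" for j
        using infdist_frontier_le_line_dist[OF that w(1)] w(2) by simp
      have "ldist i w = \<epsilon>" using d[OF i_less] infdist_side_ge[of w] w(3) by simp
      define x where "x = Re (cnj e * (w - A))"
      have wx: "w = pt x \<epsilon>" using pt_surj[of w] \<open>ldist i w = \<epsilon>\<close> unfolding x_def line_dist_def by simp
      have "\<epsilon> \<le> \<epsilon> * cg + x * sg" "\<epsilon> \<le> \<epsilon> * cf + (L - x) * sf"
        using d[of prv] d[of nxt] prv_nxt unfolding wx line_dist_prv_pt line_dist_nxt_pt by auto
      then have "(\<epsilon> * xa) * sg \<le> x * sg" "(\<epsilon> * xb) * sf \<le> (L - x) * sf"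
        unfolding mult.assoc xa_sg xb_sf by (simp_all add: algebra_simps)
      then have "\<epsilon> * xa \<le> x" "\<epsilon> * xb \<le> L - x" using sg_pos sf_pos by (simp_all only: mult_le_cancel_right_pos)
      then show "w \<in> {pt x \<epsilon> | x. \<epsilon> * xa \<le> x \<and> x \<le> L - \<epsilon> * xb}" using wx by auto
    next
      fix w assume "w \<in> {pt x \<epsilon> | x. \<epsilon> * xa \<le> x \<and> x \<le> L - \<epsilon> * xb}"
      then obtain x where x: "w = pt x \<epsilon>" "\<epsilon> * xa \<le> x" "x \<le> L - \<epsilon> * xb" by blast
      have bw: "ball w \<epsilon> \<subseteq> polygon_interior n z" by (rule ball[OF x])
      have wi: "w \<in> polygon_interior n z" using bw e(1) by auto
      have op: "open (polygon_interior n z)" by (simp add: polygon_interior_def)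
      have "\<epsilon> \<le> dist w q" if "q \<in> frontier (polygon_interior n z)" for q
      proof (rule ccontr)
        assume "\<not> \<epsilon> \<le> dist w q"
        then have "q \<in> polygon_interior n z" using bw by auto
        then show False using that op by (simp add: frontier_def interior_open)
      qed
      then have i1: "\<epsilon> \<le> infdist w (frontier (polygon_interior n z))"
        unfolding infdist_def using frontier_nonempty[OF wi] by (auto intro: cINF_greatest)
      have "pt x 0 \<in> side n z i"
      proof -
        have "0 < x" "x < L" using x(2,3) mult_pos_pos[OF e(1) xa_pos] mult_pos_pos[OF e(1) xb_pos] by linarith+
        then have "0 < x / L" "x / L < 1" using L_pos by simp_all
        moreover have "pt x 0 = (1 - x / L) *\<^sub>R A + (x / L) *\<^sub>R B"
          using linepath_pt[of 0 0 L 0 "x / L"] L_pos unfolding pt_A pt_B linepath_def by simp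
        moreover have "A \<noteq> B" using L_pos by (simp add: side_length_def)
        ultimately show ?thesis unfolding side_def in_segment by blast
      qed
      then have "infdist w (side n z i) \<le> dist w (pt x 0)" by (rule infdist_le)
      also have "\<dots> = \<epsilon>"
      proof -
        have "w - pt x 0 = e * Complex 0 \<epsilon>" unfolding x(1) pt_def by (simp add: complex_eq_iff algebra_simps)
        then show ?thesis using e(1) by (simp add: dist_norm norm_mult complex_norm)
      qed
      finally have i2: "infdist w (side n z i) = \<epsilon>"
        using infdist_side_ge[of w] unfolding x(1) line_dist_i_pt by simp
      show "w \<in> inner_side n z \<epsilon> i"
        unfolding inner_side_def inner_polygon_def using wi i1 i2 by simp
    qed
  qed
qed

text \<open>A segment determines its end points as extreme points, and the orientation determines their
  order.\<close>

lemma inner_ends_eq: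
  assumes "inner_side n z \<epsilon> i = closed_segment (pt (\<epsilon> * xa) \<epsilon>) (pt (L - \<epsilon> * xb) \<epsilon>)"
    and xx: "\<epsilon> * xa < L - \<epsilon> * xb"
  shows "inner_ends n z \<epsilon> i = (pt (\<epsilon> * xa) \<epsilon>, pt (L - \<epsilon> * xb) \<epsilon>)"
proof -
  define P R where "P = pt (\<epsilon> * xa) \<epsilon>" and "R = pt (L - \<epsilon> * xb) \<epsilon>"
  define c where "c = (L - \<epsilon> * xb - \<epsilon> * xa) / L"
  have c: "c > 0" using xx L_pos by (simp add: c_def)
  have "c * L = L - \<epsilon> * xb - \<epsilon> * xa" using L_pos by (simp add: c_def)
  moreover have "R - P = complex_of_real (L - \<epsilon> * xb - \<epsilon> * xa) * e"
    unfolding P_def R_def pt_def by (simp add: complex_eq_iff algebra_simps)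
  ultimately have RP: "R - P = c *\<^sub>R (B - A)"
    unfolding B_eq by (simp add: scaleR_conv_of_real flip: of_real_mult mult.assoc)
  have BA: "B - A \<noteq> 0" using L_pos by (auto simp: side_length_def)
  show ?thesis
    unfolding inner_ends_def assms(1) P_def[symmetric] R_def[symmetric]
  proof (rule the_equality)
    show "case (P, R) of (a, b) \<Rightarrow> closed_segment a b = closed_segment P R \<and> (\<exists>c>0. b - a = c *\<^sub>R (B - A))"
      using c RP by auto
    fix p :: "complex \<times> complex"
    assume "case p of (a, b) \<Rightarrow> closed_segment a b = closed_segment P R \<and> (\<exists>c>0. b - a = c *\<^sub>R (B - A))"
    then obtain a b c' where p: "p = (a, b)" and seg: "closed_segment a b = closed_segment P R"
      and c': "c' > 0" "b - a = c' *\<^sub>R (B - A)" by (cases p) auto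
    have "x = a \<or> x = b \<longleftrightarrow> x = P \<or> x = R" for x
      using extreme_point_of_segment[of x a b] extreme_point_of_segment[of x P R] seg by simp
    moreover have "\<not> (a = R \<and> b = P)"
    proof
      assume "a = R \<and> b = P"
      then have "c' *\<^sub>R (B - A) = - (c *\<^sub>R (B - A))" using c'(2) RP by (metis minus_diff_eq)
      then have "(c' + c) *\<^sub>R (B - A) = 0" by (simp add: scaleR_add_left)
      then show False using BA c c'(1) by simp
    qed
    ultimately show "p = (P, R)" using p by metis
  qed
qed

lemma inner_param_eq:
  "\<exists>\<epsilon>0>0. \<forall>\<epsilon>. 0 < \<epsilon> \<longrightarrow> \<epsilon> < \<epsilon>0 \<longrightarrow>
     (\<forall>t. inner_param n z \<epsilon> i t = pt ((1 - t) * (\<epsilon> * xa) + t * (L - \<epsilon> * xb)) \<epsilon>) \<and>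
     (\<forall>t\<in>{0..1}. pt ((1 - t) * (\<epsilon> * xa) + t * (L - \<epsilon> * xb)) \<epsilon> \<in> polygon_interior n z)"
proof -
  obtain \<epsilon>0 where \<epsilon>0: "\<epsilon>0 > 0" "\<And>\<epsilon>. 0 < \<epsilon> \<Longrightarrow> \<epsilon> < \<epsilon>0 \<Longrightarrow> \<epsilon> * xa < L - \<epsilon> * xb \<and>
     inner_side n z \<epsilon> i = closed_segment (pt (\<epsilon> * xa) \<epsilon>) (pt (L - \<epsilon> * xb) \<epsilon>) \<and>
     inner_side n z \<epsilon> i \<subseteq> polygon_interior n z"
    using inner_side_eq by blast
  have lp: "linepath (pt (\<epsilon> * xa) \<epsilon>) (pt (L - \<epsilon> * xb) \<epsilon>) t = pt ((1 - t) * (\<epsilon> * xa) + t * (L - \<epsilon> * xb)) \<epsilon>"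
    for \<epsilon> t unfolding linepath_pt by (simp add: algebra_simps)
  show ?thesis
  proof (intro exI[of _ \<epsilon>0] conjI allI impI ballI \<epsilon>0(1))
    fix \<epsilon> assume e: "0 < \<epsilon>" "\<epsilon> < \<epsilon>0"
    note f = \<epsilon>0(2)[OF e]
    show "inner_param n z \<epsilon> i t = pt ((1 - t) * (\<epsilon> * xa) + t * (L - \<epsilon> * xb)) \<epsilon>" for t
      unfolding inner_param_def inner_ends_eq[OF conjunct1[OF conjunct2[OF f]] conjunct1[OF f]]
      by (simp add: lp)
    fix t :: real assume "t \<in> {0..1}"
    then have "linepath (pt (\<epsilon> * xa) \<epsilon>) (pt (L - \<epsilon> * xb) \<epsilon>) t \<in> inner_side n z \<epsilon> i"
      using f by (auto simp: linepath_in_path)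
    then show "pt ((1 - t) * (\<epsilon> * xa) + t * (L - \<epsilon> * xb)) \<epsilon> \<in> polygon_interior n z"
      using f unfolding lp by blast
  qed
qed

text \<open>An affine function of \<open>t\<close> that is at least \<open>c1\<close> at \<open>0\<close> and at least \<open>c2\<close> at \<open>1\<close> is at least
  \<open>(1 - t) c1 + t c2\<close>, which exceeds \<open>(c1 + c2) t (1 - t)\<close>.\<close>

lemma margin_from_ends:
  assumes c: "c1 \<ge> 0" "c2 \<ge> 0"
    and 1: "\<And>q. q \<in> {q0, q1} \<Longrightarrow> c1 \<le> Im (u * (pt x1 y - q))"
    and 2: "\<And>q. q \<in> {q0, q1} \<Longrightarrow> c2 \<le> Im (u * (pt x2 y - q))"
    and t: "t \<in> {0..1}" and q: "q \<in> closed_segment q0 q1"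
  shows "(c1 + c2) * (t * (1 - t)) \<le> Im (u * (pt ((1 - t) * x1 + t * x2) y - q))"
proof -
  obtain s where s: "0 \<le> s" "s \<le> 1" "q = (1 - s) *\<^sub>R q0 + s *\<^sub>R q1" using q by (auto simp: in_segment)
  have end_bound: "c \<le> Im (u * (v - q))"
    if "\<And>q. q \<in> {q0, q1} \<Longrightarrow> c \<le> Im (u * (v - q))" for c v
  proof -
    have "c = (1 - s) * c + s * c" by (simp add: algebra_simps)
    also have "\<dots> \<le> (1 - s) * Im (u * (v - q0)) + s * Im (u * (v - q1))"
      using s that by (intro add_mono mult_left_mono) auto
    also have "\<dots> = Im (u * (v - q))" unfolding s(3) by (simp add: scaleR_conv_of_real algebra_simps)
    finally show ?thesis .
  qed
  have "pt ((1 - t) * x1 + t * x2) y = (1 - t) *\<^sub>R pt x1 y + t *\<^sub>R pt x2 y"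
    unfolding pt_def by (simp add: complex_eq_iff algebra_simps)
  then have pe: "pt ((1 - t) * x1 + t * x2) y = (1 - t) *\<^sub>R pt x1 y + t *\<^sub>R pt x2 y" .
  have eq: "Im (u * (pt ((1 - t) * x1 + t * x2) y - q)) =
     (1 - t) * Im (u * (pt x1 y - q)) + t * Im (u * (pt x2 y - q))"
    unfolding pe by (simp add: scaleR_conv_of_real algebra_simps)
  have "t * (1 - t) \<le> 1 - t" "t * (1 - t) \<le> t"
    using t by (simp_all add: mult_left_le mult_left_le_one_le)
  then have "c1 * (t * (1 - t)) \<le> c1 * (1 - t)" "c2 * (t * (1 - t)) \<le> c2 * t"
    using c by (intro mult_left_mono; simp)+
  moreover have "(1 - t) * c1 \<le> (1 - t) * Im (u * (pt x1 y - q))" "t * c2 \<le> t * Im (u * (pt x2 y - q))"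
    using t end_bound[OF 1] end_bound[OF 2] by (intro mult_left_mono; simp)+
  ultimately show ?thesis unfolding eq by (simp add: algebra_simps)
qed

text \<open>For every other side there is one direction of the spectral variable that makes the
  kernel decay both at the points of the inner side and at their mirror images in side \<open>i\<close>,
  at a rate that degenerates only linearly at the two corners. At an adjacent corner the ray of the
  adjacent side works if the exterior angle is at least \<open>\<pi> / 3\<close>; otherwise a ray along which the
  kernel decays in the direction of side \<open>i\<close> does.\<close>

lemma common_direction:
  assumes j: "j < n" "j \<noteq> i"
  shows "\<exists>u c \<epsilon>1. norm u = 1 \<and> c > 0 \<and> \<epsilon>1 > 0 \<and>
    (\<forall>\<epsilon> t q y. 0 < \<epsilon> \<longrightarrow> \<epsilon> < \<epsilon>1 \<longrightarrow> t \<in> {0..1} \<longrightarrow> (y = \<epsilon> \<or> y = - \<epsilon>) \<longrightarrow>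
       q \<in> closed_segment (z j) (nv j) \<longrightarrow>
       c * (t * (1 - t)) \<le> Im (u * (pt ((1 - t) * (\<epsilon> * xa) + t * (L - \<epsilon> * xb)) y - q)))"
proof -
  have main: ?thesis if u: "norm u = 1" and c: "c1 \<ge> 0" "c2 \<ge> 0" "c1 + c2 > 0" and e: "\<epsilon>1 > 0"
    and 1: "\<And>\<epsilon> y q. 0 < \<epsilon> \<Longrightarrow> \<epsilon> < \<epsilon>1 \<Longrightarrow> y = \<epsilon> \<or> y = - \<epsilon> \<Longrightarrow> q \<in> {z j, nv j} \<Longrightarrow>
       c1 \<le> Im (u * (pt (\<epsilon> * xa) y - q))"
    and 2: "\<And>\<epsilon> y q. 0 < \<epsilon> \<Longrightarrow> \<epsilon> < \<epsilon>1 \<Longrightarrow> y = \<epsilon> \<or> y = - \<epsilon> \<Longrightarrow> q \<in> {z j, nv j} \<Longrightarrow>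
       c2 \<le> Im (u * (pt (L - \<epsilon> * xb) y - q))"
    for u c1 c2 \<epsilon>1
  proof (rule exI[of _ u], rule exI[of _ "c1 + c2"], rule exI[of _ \<epsilon>1], intro conjI allI impI u c(3) e)
    fix \<epsilon> t y :: real and q assume a: "0 < \<epsilon>" "\<epsilon> < \<epsilon>1" "t \<in> {0..1}" "y = \<epsilon> \<or> y = - \<epsilon>"
      "q \<in> closed_segment (z j) (nv j)"
    show "(c1 + c2) * (t * (1 - t)) \<le> Im (u * (pt ((1 - t) * (\<epsilon> * xa) + t * (L - \<epsilon> * xb)) y - q))"
      by (rule margin_from_ends[OF c(1,2) _ _ a(3,5)]) (fact 1[OF a(1,2,4)] 2[OF a(1,2,4)])+
  qed
  define \<epsilon>L where "\<epsilon>L = L / (2 * (1 + xa + xb))"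
  have den: "1 + xa + xb > 0" using xa_pos xb_pos by linarith
  have \<epsilon>L: "\<epsilon>L > 0" using L_pos den by (simp add: \<epsilon>L_def)
  have small: "\<epsilon> * xa \<le> L / 2" "\<epsilon> * xb \<le> L / 2" if "0 < \<epsilon>" "\<epsilon> < \<epsilon>L" for \<epsilon>
  proof -
    have "\<epsilon> * (2 * (1 + xa + xb)) < L"
      using that(2) den unfolding \<epsilon>L_def by (subst (asm) pos_less_divide_eq) simp_all
    moreover have "0 < \<epsilon> * xa" "0 < \<epsilon> * xb" using that xa_pos xb_pos by simp_all
    ultimately show "\<epsilon> * xa \<le> L / 2" "\<epsilon> * xb \<le> L / 2" using that by (simp_all add: algebra_simps)
  qed
  have ldist: "Im (cnj (dir j) * (v - q)) = ldist j v"
    if "q \<in> {z j, nv j}" for v q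
  proof -
    have "Im (cnj (dir j) * (v - q)) = ldist j v - ldist j q"
      by (simp add: line_dist_def algebra_simps)
    then show ?thesis using that by auto
  qed
  have Re_eq: "Im (- \<i> * cnj e * (pt x y - q)) = Re (cnj e * (q - A)) - x"
    "Im (\<i> * cnj e * (pt x y - q)) = x - Re (cnj e * (q - A))" for x y q
  proof -
    have "cnj e * (pt x y - q) = cnj e * (pt x y - A) - cnj e * (q - A)" by (simp add: algebra_simps)
    then have *: "cnj e * (pt x y - q) = Complex x y - cnj e * (q - A)" unfolding cnj_e_pt .
    show "Im (- \<i> * cnj e * (pt x y - q)) = Re (cnj e * (q - A)) - x"
      "Im (\<i> * cnj e * (pt x y - q)) = x - Re (cnj e * (q - A))"
      unfolding mult.assoc * by simp_all
  qed
  consider (far) "j \<noteq> nxt" "j \<noteq> prv" | (is_nxt) "j = nxt" | (is_prv) "j = prv" by blast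
  then show ?thesis
  proof cases
    case far
    have "i \<noteq> Suc j mod n" "nxt \<noteq> Suc j mod n"
    proof -
      have Suc_mod: "Suc k mod n = (if Suc k = n then 0 else Suc k)" if "k < n" for k
        using that by auto
      show "i \<noteq> Suc j mod n" "nxt \<noteq> Suc j mod n"
        using far j i_less unfolding nxt_def prv_def Suc_mod[OF i_less] Suc_mod[OF j(1)]
        by (auto split: if_splits)
    qed
    then have pos: "ldist j A > 0" "ldist j B > 0"
      using far j i_less prv_nxt(2,7) by (simp_all add: line_dist_vertex_pos)
    define m where "m = min (ldist j A) (ldist j B) / 2"
    have m: "m > 0" using pos by (simp add: m_def)
    define \<epsilon>1 where "\<epsilon>1 = m / (1 + xa + xb)"
    have e: "\<epsilon>1 > 0" using m den by (simp add: \<epsilon>1_def)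
    have near: "ldist j (pt x y) \<ge> m"
      if "0 < \<epsilon>" "\<epsilon> < \<epsilon>1" "y = \<epsilon> \<or> y = - \<epsilon>" "x0 = 0 \<or> x0 = L" "\<bar>x - x0\<bar> \<le> \<epsilon> * (xa + xb)" for x x0 y \<epsilon>
    proof -
      have "pt x y - pt x0 0 = e * Complex (x - x0) y"
        unfolding pt_def by (simp add: complex_eq_iff algebra_simps)
      then have "dist (pt x y) (pt x0 0) = cmod (Complex (x - x0) y)" by (simp add: dist_norm norm_mult)
      also have "\<dots> \<le> \<bar>x - x0\<bar> + \<bar>y\<bar>" using cmod_le[of "Complex (x - x0) y"] by simp
      also have "\<dots> \<le> \<epsilon> * (1 + xa + xb)" using that by (auto simp: algebra_simps)
      also have "\<dots> \<le> m" using that den by (simp add: \<epsilon>1_def less_divide_eq)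
      finally have "\<bar>ldist j (pt x y) - ldist j (pt x0 0)\<bar> \<le> m"
        using line_dist_diff_le[of j "pt x y" "pt x0 0"] by linarith
      moreover have "ldist j (pt x0 0) \<ge> 2 * m" using that(4) by (auto simp: pt_A pt_B m_def)
      ultimately show ?thesis by linarith
    qed
    show ?thesis
    proof (rule main[of "cnj (dir j)" m m \<epsilon>1])
      fix \<epsilon> y q assume a: "0 < \<epsilon>" "\<epsilon> < \<epsilon>1" "y = \<epsilon> \<or> y = - \<epsilon>" "q \<in> {z j, nv j}"
      have p: "0 \<le> \<epsilon> * xa" "0 \<le> \<epsilon> * xb" using a(1) xa_pos xb_pos by simp_all
      show "m \<le> Im (cnj (dir j) * (pt (\<epsilon> * xa) y - q))"
        unfolding ldist[OF a(4)] by (rule near[OF a(1-3), of 0]) (use p in \<open>auto simp: algebra_simps\<close>)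
      show "m \<le> Im (cnj (dir j) * (pt (L - \<epsilon> * xb) y - q))"
        unfolding ldist[OF a(4)] by (rule near[OF a(1-3), of L]) (use p in \<open>auto simp: algebra_simps\<close>)
    qed (use m e in auto)
  next
    case is_nxt
    \<comment> \<open>At the corner, the mirror image of the inner side keeps to the left of side \<open>nxt\<close> iff
      \<open>cf \<le> 1 / 2\<close>, while the direction of side \<open>i\<close> separates iff \<open>cf \<ge> 0\<close>.\<close>
    show ?thesis
    proof (cases "cf \<le> 1 / 2")
      case True
      define \<epsilon>1 where "\<epsilon>1 = min \<epsilon>L (L * sf / 4)"
      have e: "\<epsilon>1 > 0" using \<epsilon>L L_pos sf_pos by (simp add: \<epsilon>1_def)
      have "\<bar>cf\<bar> \<le> 1" unfolding cf_def
        using abs_Re_le_cmod[of "cnj e * dir nxt"] by (simp add: norm_mult)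
      show ?thesis
      proof (rule main[of "cnj (dir j)" "L * sf / 4" 0 \<epsilon>1])
        fix \<epsilon> y q assume a: "0 < \<epsilon>" "\<epsilon> < \<epsilon>1" "y = \<epsilon> \<or> y = - \<epsilon>" "q \<in> {z j, nv j}"
        have "\<bar>y * cf\<bar> \<le> \<epsilon> * 1"
          unfolding abs_mult using a(1,3) \<open>\<bar>cf\<bar> \<le> 1\<close> by (intro mult_mono) auto
        moreover have "(L - \<epsilon> * xa) * sf \<ge> (L / 2) * sf"
          using small(1)[of \<epsilon>] a sf_pos by (intro mult_right_mono) (auto simp: \<epsilon>1_def)
        moreover have "\<epsilon> < L * sf / 4" using a(2) by (simp add: \<epsilon>1_def)
        ultimately show "L * sf / 4 \<le> Im (cnj (dir j) * (pt (\<epsilon> * xa) y - q))"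
          unfolding ldist[OF a(4)] unfolding is_nxt line_dist_nxt_pt by linarith
        have "(L - (L - \<epsilon> * xb)) * sf = \<epsilon> * (1 - cf)" using xb_sf by (simp add: mult.assoc)
        moreover have "0 \<le> \<epsilon> * (1 - 2 * cf)" using True a(1) by simp
        moreover have ycf: "y * cf = \<epsilon> * cf \<or> y * cf = - (\<epsilon> * cf)" using a(3) by auto
        ultimately show "0 \<le> Im (cnj (dir j) * (pt (L - \<epsilon> * xb) y - q))"
          unfolding ldist[OF a(4)] unfolding is_nxt line_dist_nxt_pt using a(1) unfolding right_diff_distrib by linarith
      qed (use e L_pos sf_pos in auto)
    next
      case False
      have qx: "L \<le> Re (cnj e * (q - A))" if "q \<in> {z j, nv j}" for q
      proof -
        have B: "Re (cnj e * (B - A)) = L" using cnj_e_pt[of L 0] pt_B by simp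
        have "cnj e * (nv nxt - A) = cnj e * (B - A)
            + complex_of_real (side_length n z nxt) * (cnj e * dir nxt)"
          unfolding nxt_next_eq by (simp add: algebra_simps)
        then have "Re (cnj e * (nv nxt - A)) = L + side_length n z nxt * cf"
          unfolding cf_def by (simp only: plus_complex.sel B Re_of_real_mult)
        moreover have "0 \<le> side_length n z nxt * cf"
          using False side_length_pos[of nxt] prv_nxt(2) by (intro mult_nonneg_nonneg) auto
        ultimately show ?thesis using that B[unfolded prv_nxt(7)] unfolding is_nxt by (elim insertE emptyE) (simp_all only:)
      qed
      show ?thesis
      proof (rule main[of "- \<i> * cnj e" "L / 2" 0 \<epsilon>L])
        fix \<epsilon> y q assume a: "0 < \<epsilon>" "\<epsilon> < \<epsilon>L" "y = \<epsilon> \<or> y = - \<epsilon>" "q \<in> {z j, nv j}"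
        show "L / 2 \<le> Im (- \<i> * cnj e * (pt (\<epsilon> * xa) y - q))"
          unfolding Re_eq using qx[OF a(4)] small(1)[OF a(1,2)] by linarith
        have "0 < \<epsilon> * xb" using a(1) xb_pos by simp
        then show "0 \<le> Im (- \<i> * cnj e * (pt (L - \<epsilon> * xb) y - q))"
          unfolding Re_eq using qx[OF a(4)] by linarith
      qed (use \<epsilon>L L_pos in \<open>auto simp: norm_mult\<close>)
    qed
  next
    case is_prv
    show ?thesis
    proof (cases "cg \<le> 1 / 2")
      case True
      define \<epsilon>1 where "\<epsilon>1 = min \<epsilon>L (L * sg / 4)"
      have e: "\<epsilon>1 > 0" using \<epsilon>L L_pos sg_pos by (simp add: \<epsilon>1_def)
      have "\<bar>cg\<bar> \<le> 1" unfolding cg_def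
        using abs_Re_le_cmod[of "cnj (dir prv) * e"] by (simp add: norm_mult)
      show ?thesis
      proof (rule main[of "cnj (dir j)" 0 "L * sg / 4" \<epsilon>1])
        fix \<epsilon> y q assume a: "0 < \<epsilon>" "\<epsilon> < \<epsilon>1" "y = \<epsilon> \<or> y = - \<epsilon>" "q \<in> {z j, nv j}"
        have "\<bar>y * cg\<bar> \<le> \<epsilon> * 1"
          unfolding abs_mult using a(1,3) \<open>\<bar>cg\<bar> \<le> 1\<close> by (intro mult_mono) auto
        moreover have "(L - \<epsilon> * xb) * sg \<ge> (L / 2) * sg"
          using small(2)[of \<epsilon>] a sg_pos by (intro mult_right_mono) (auto simp: \<epsilon>1_def)
        moreover have "\<epsilon> < L * sg / 4" using a(2) by (simp add: \<epsilon>1_def)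
        ultimately show "L * sg / 4 \<le> Im (cnj (dir j) * (pt (L - \<epsilon> * xb) y - q))"
          unfolding ldist[OF a(4)] unfolding is_prv line_dist_prv_pt by linarith
        have "\<epsilon> * xa * sg = \<epsilon> * (1 - cg)" using xa_sg by (simp add: mult.assoc)
        moreover have "0 \<le> \<epsilon> * (1 - 2 * cg)" using True a(1) by simp
        moreover have ycg: "y * cg = \<epsilon> * cg \<or> y * cg = - (\<epsilon> * cg)" using a(3) by auto
        ultimately show "0 \<le> Im (cnj (dir j) * (pt (\<epsilon> * xa) y - q))"
          unfolding ldist[OF a(4)] unfolding is_prv line_dist_prv_pt using a(1) unfolding right_diff_distrib by linarith
      qed (use e L_pos sg_pos in auto)
    next
      case False
      have qx: "Re (cnj e * (q - A)) \<le> 0" if "q \<in> {z j, nv j}" for q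
      proof -
        have "cnj e * (z prv - A) = complex_of_real (- side_length n z prv) * cnj (cnj (dir prv) * e)"
          unfolding prv_eq by (simp add: algebra_simps)
        then have "Re (cnj e * (z prv - A)) = - side_length n z prv * Re (cnj (cnj (dir prv) * e))"
          by (simp only: Re_of_real_mult)
        also have "\<dots> = - side_length n z prv * cg" unfolding cg_def by simp
        finally have "Re (cnj e * (z prv - A)) = - side_length n z prv * cg" .
        moreover have "0 \<le> side_length n z prv * cg"
          using False side_length_pos[of prv] prv_nxt(1) by (intro mult_nonneg_nonneg) auto
        ultimately show ?thesis using that unfolding is_prv prv_nxt(8) by (elim insertE emptyE) (simp_all only: diff_self mult_zero_right zero_complex.sel order_refl mult_minus_left neg_le_0_iff_le)
      qed
      show ?thesis
      proof (rule main[of "\<i> * cnj e" 0 "L / 2" \<epsilon>L])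
        fix \<epsilon> y q assume a: "0 < \<epsilon>" "\<epsilon> < \<epsilon>L" "y = \<epsilon> \<or> y = - \<epsilon>" "q \<in> {z j, nv j}"
        show "L / 2 \<le> Im (\<i> * cnj e * (pt (L - \<epsilon> * xb) y - q))"
          unfolding Re_eq using qx[OF a(4)] small(2)[OF a(1,2)] by linarith
        have "0 < \<epsilon> * xa" using a(1) xa_pos by simp
        then show "0 \<le> Im (\<i> * cnj e * (pt (\<epsilon> * xa) y - q))"
          unfolding Re_eq using qx[OF a(4)] by linarith
      qed (use \<epsilon>L L_pos in \<open>auto simp: norm_mult\<close>)
    qed
  qed
qed

end

section \<open>The kernel on a ray\<close>

lemma power_le_exp:
  fixes y :: real
  assumes "y \<ge> 0" shows "\<exists>K>0. \<forall>y\<ge>0. y ^ m \<le> K * exp (y::real)"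
proof (cases "m = 0")
  case False
  have "y ^ m \<le> real m ^ m * exp y" if "y \<ge> 0" for y :: real
  proof -
    have "y / m \<le> exp (y / m)" using exp_ge_add_one_self[of "y / m"] by linarith
    then have "(y / m) ^ m \<le> exp (y / m) ^ m" using that by (intro power_mono) auto
    also have "\<dots> = exp y" using False by (simp flip: exp_of_nat_mult)
    finally show ?thesis using False by (simp add: power_divide divide_le_eq mult.commute)
  qed
  then show ?thesis using False by (intro exI[of _ "real m ^ m"]) simp
qed (auto intro: exI[of _ 1])

text \<open>With \<open>M = 2\<close> the right-hand side is integrable in \<open>t\<close>, and the loss is a fixed power of \<open>1 / a\<close>. In
  the applications \<open>a\<close> is proportional to the distance to the corners, so that a test function
  makes up for the loss.\<close>

lemma cosh_power_exp_le:
  "\<exists>K>0. \<forall>a>0. \<forall>t::real. cosh t ^ N * exp (- (a * cosh t)) \<le> K / a ^ (N + M) / cosh t ^ M"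
proof -
  obtain K where K: "K > 0" "\<And>y::real. y \<ge> 0 \<Longrightarrow> y ^ (N + M) \<le> K * exp y"
    using power_le_exp[of 0 "N + M"] by auto
  have "cosh t ^ N * exp (- (a * cosh t)) \<le> K / a ^ (N + M) / cosh t ^ M" if "a > 0" for a t :: real
  proof -
    have "a ^ (N + M) * (cosh t ^ N * cosh t ^ M) \<le> K * exp (a * cosh t)"
      using K(2)[of "a * cosh t"] that by (simp add: power_mult_distrib power_add mult_ac)
    then show ?thesis using that by (simp add: exp_minus field_simps)
  qed
  then show ?thesis using K(1) by blast
qed

lemma integrable_inverse_cosh: "integrable lborel (\<lambda>t::real. 1 / cosh t ^ 2)"
proof -
  have "set_integrable lborel (einterval (- \<infinity>) \<infinity>) (\<lambda>t::real. 1 / cosh t ^ 2)"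
  proof (rule interval_integral_FTC_nonneg)
    show "DERIV tanh t :> 1 / cosh t ^ 2" for t :: real
    proof -
      have "DERIV tanh t :> 1 - tanh t ^ 2"
        by (auto intro!: derivative_eq_intros)
      moreover have "1 - tanh t ^ 2 = 1 / cosh t ^ 2"
        proof -
        have "1 - tanh t ^ 2 = (cosh t ^ 2 - sinh t ^ 2) / cosh t ^ 2"
          by (simp add: tanh_def power_divide diff_divide_distrib)
        then show ?thesis by (simp only: hyperbolic_pythagoras)
      qed
      ultimately show ?thesis by simp
    qed
    show "((tanh \<circ> real_of_ereal) \<longlongrightarrow> 1) (at_left \<infinity>)"
      unfolding ereal_tendsto_simps by (rule tanh_real_at_top)
    show "((tanh \<circ> real_of_ereal) \<longlongrightarrow> - 1) (at_right (- \<infinity>))"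
      unfolding ereal_tendsto_simps by (rule tanh_real_at_bot)
  qed (auto intro!: continuous_intros)
  then show ?thesis by (simp add: set_integrable_def)
qed

lemma integrable_if_cosh_decay:
  fixes f :: "real \<Rightarrow> complex"
  assumes "f \<in> borel_measurable borel" "\<And>t. norm (f t) \<le> C / cosh t ^ 2"
  shows "integrable lborel f"
proof (rule Bochner_Integration.integrable_bound)
  show "integrable lborel (\<lambda>t::real. C * (1 / cosh t ^ 2))"
    by (intro integrable_mult_right integrable_inverse_cosh)
  show "AE t in lborel. norm (f t) \<le> norm (C * (1 / cosh t ^ 2))"
    using order_trans[OF assms(2) abs_ge_self] by (intro AE_I2) simp
qed (use assms in simp)

text \<open>With \<open>\<mu> = \<beta> e\<^sup>t u\<close>, \<open>u\<close> a unit, the exponent of the kernel at \<open>v\<close> is \<open>wexp \<beta> t (u v)\<close>,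
  and \<open>\<mu> e + \<beta>\<^sup>2 / (\<mu> e)\<close> is \<open>rate \<beta> t (u e)\<close>.\<close>

definition wexp :: "real \<Rightarrow> real \<Rightarrow> complex \<Rightarrow> complex" where
  "wexp \<beta> t p = Complex (2 * \<beta> * Im p * cosh t) (- 2 * \<beta> * Re p * sinh t)"

definition rate :: "real \<Rightarrow> real \<Rightarrow> complex \<Rightarrow> complex" where
  "rate \<beta> t c = Complex (2 * \<beta> * Re c * cosh t) (2 * \<beta> * Im c * sinh t)"

abbreviation (input) ray_point :: "real \<Rightarrow> complex \<Rightarrow> real \<Rightarrow> complex" where
  "ray_point \<beta> u t \<equiv> complex_of_real (\<beta> * exp t) * u"

lemma exp_cosh_sinh: "exp t = cosh t + sinh (t::real)" "exp (- t) = cosh t - sinh t"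
  by (simp_all add: cosh_def sinh_def field_simps)

lemma inverse_ray_point:
  assumes "\<beta> > 0" "norm u = 1"
  shows "1 / ray_point \<beta> u t = complex_of_real (exp (- t) / \<beta>) * cnj u"
proof -
  have "u * cnj u = 1" using assms by (simp add: complex_norm_square[symmetric])
  then have "ray_point \<beta> u t * (complex_of_real (exp (- t) / \<beta>) * cnj u) = complex_of_real (\<beta> * exp t * (exp (- t) / \<beta>))"
    by (simp add: mult.assoc mult.left_commute[of u])
  also have "\<beta> * exp t * (exp (- t) / \<beta>) = 1" using assms by (simp flip: exp_add)
  finally have "ray_point \<beta> u t * (complex_of_real (exp (- t) / \<beta>) * cnj u) = 1" by (simp only: of_real_1)
  from inverse_unique[OF this] show ?thesis by (simp only: inverse_eq_divide)
qed

lemma exp_kernel_ray: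
  assumes "\<beta> > 0" "norm u = 1"
  shows "exp_kernel \<beta> (ray_point \<beta> u t) v = exp (wexp \<beta> t (u * v))"
proof -
  have "\<i> * (complex_of_real \<beta>)\<^sup>2 * cnj v / ray_point \<beta> u t
      = \<i> * (complex_of_real \<beta>)\<^sup>2 * cnj v * (complex_of_real (exp (- t) / \<beta>) * cnj u)"
    unfolding inverse_ray_point[OF assms, symmetric] by simp
  also have "\<dots> = \<i> * complex_of_real (\<beta> * exp (- t)) * cnj (u * v)"
    using assms by (simp add: power2_eq_square)
  finally have 1: "\<i> * (complex_of_real \<beta>)\<^sup>2 * cnj v / ray_point \<beta> u t
     = \<i> * complex_of_real (\<beta> * exp (- t)) * cnj (u * v)" .
  have 2: "- \<i> * ray_point \<beta> u t * v = - \<i> * complex_of_real (\<beta> * exp t) * (u * v)" by (simp add: mult.assoc)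
  have 3: "- \<i> * complex_of_real (\<beta> * exp t) * p + \<i> * complex_of_real (\<beta> * exp (- t)) * cnj p = wexp \<beta> t p" for p
    unfolding exp_cosh_sinh by (simp add: complex_eq_iff wexp_def algebra_simps)
  show ?thesis unfolding exp_kernel_def 1 2 3 ..
qed

lemma rate_ray:
  assumes "\<beta> > 0" "norm u = 1" "norm e = 1"
  shows "ray_point \<beta> u t * e + (complex_of_real \<beta>)\<^sup>2 / (ray_point \<beta> u t * e) = rate \<beta> t (u * e)"
proof -
  have n: "norm (u * e) = 1" using assms by (simp add: norm_mult)
  have "(complex_of_real \<beta>)\<^sup>2 / (ray_point \<beta> u t * e) = (complex_of_real \<beta>)\<^sup>2 * (1 / ray_point \<beta> (u * e) t)"
    by (simp add: mult.assoc)
  also have "\<dots> = complex_of_real (\<beta> * exp (- t)) * cnj (u * e)"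
    unfolding inverse_ray_point[OF assms(1) n] using assms by (simp add: power2_eq_square)
  finally have 1: "(complex_of_real \<beta>)\<^sup>2 / (ray_point \<beta> u t * e) = complex_of_real (\<beta> * exp (- t)) * cnj (u * e)" .
  have 2: "complex_of_real (\<beta> * exp t) * p + complex_of_real (\<beta> * exp (- t)) * cnj p = rate \<beta> t p" for p
    unfolding exp_cosh_sinh by (simp add: complex_eq_iff rate_def algebra_simps)
  show ?thesis unfolding 1 unfolding mult.assoc[of _ u e] 2 ..
qed

lemma wexp_add: "wexp \<beta> t (p + q) = wexp \<beta> t p + wexp \<beta> t q"
  by (simp add: wexp_def complex_eq_iff algebra_simps)

lemma wexp_scaleR: "wexp \<beta> t (complex_of_real c * p) = complex_of_real c * wexp \<beta> t p"
  by (simp add: wexp_def complex_eq_iff algebra_simps)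

lemma norm_exp_wexp: "norm (exp (wexp \<beta> t p)) = exp (2 * \<beta> * Im p * cosh t)"
  by (simp add: wexp_def)

lemma continuous_Complex: "continuous_on S f \<Longrightarrow> continuous_on S g \<Longrightarrow> continuous_on S (\<lambda>x. Complex (f x) (g x))"
  unfolding Complex_eq by (intro continuous_intros)

lemma continuous_wexp:
  "continuous_on S f \<Longrightarrow> continuous_on S g \<Longrightarrow> continuous_on S (\<lambda>x. wexp \<beta> (f x) (g x))"
  unfolding wexp_def by (intro continuous_Complex continuous_intros)

lemma continuous_rate: "continuous_on S f \<Longrightarrow> continuous_on S (\<lambda>x. rate \<beta> (f x) c)"
  unfolding rate_def by (intro continuous_Complex continuous_intros)

lemma abs_sinh_le: "\<bar>sinh t\<bar> \<le> cosh (t::real)"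
  using sinh_le_cosh_real[of t] sinh_le_cosh_real[of "- t"] by simp

lemma norm_rate_le:
  assumes "\<beta> > 0" shows "norm (rate \<beta> t c) \<le> 4 * \<beta> * norm c * cosh t"
proof -
  have "norm (rate \<beta> t c) \<le> \<bar>2 * \<beta> * Re c * cosh t\<bar> + \<bar>2 * \<beta> * Im c * sinh t\<bar>"
    using cmod_le[of "rate \<beta> t c"] by (simp add: rate_def)
  also have "\<dots> = 2 * \<beta> * (\<bar>Re c\<bar> * cosh t + \<bar>Im c\<bar> * \<bar>sinh t\<bar>)"
    using assms by (simp add: abs_mult algebra_simps)
  also have "\<dots> \<le> 2 * \<beta> * (norm c * cosh t + norm c * cosh t)"
    using assms abs_Re_le_cmod[of c] abs_Im_le_cmod[of c] abs_sinh_le[of t]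
    by (intro mult_left_mono add_mono mult_mono) auto
  finally show ?thesis by (simp add: algebra_simps)
qed

lemma norm_wexp_le:
  assumes "\<beta> > 0" shows "norm (wexp \<beta> t p) \<le> 4 * \<beta> * norm p * cosh t"
proof -
  have "wexp \<beta> t p = rate \<beta> t (- \<i> * p)" by (simp add: wexp_def rate_def)
  then show ?thesis using norm_rate_le[OF assms, of t "- \<i> * p"] by (simp add: norm_mult)
qed

section \<open>Functionals applied to exponentials\<close>

lemma exp_deriv_tower:
  "deriv_tower S (\<lambda>k x. c * a ^ k * exp (b + complex_of_real x * a))"
  unfolding deriv_tower_def
proof (intro allI ballI)
  fix k x
  show "((\<lambda>x. c * a ^ k * exp (b + complex_of_real x * a)) has_vector_derivative
      c * a ^ Suc k * exp (b + complex_of_real x * a)) (at x within S)"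
    by (rule has_vector_derivative_at_within)
      (auto intro!: derivative_eq_intros has_vector_derivative_real_field simp: mult_ac)
qed

text \<open>Along a segment the kernel is a one-parameter exponential, whose derivatives are powers of one factor.\<close>

lemma exp_linepath:
  "exp (wexp \<beta> t (u * (linepath p0 p1 x - w)))
     = exp (wexp \<beta> t (u * (p0 - w)) + complex_of_real x * wexp \<beta> t (u * (p1 - p0)))"
proof -
  have "u * (linepath p0 p1 x - w) = u * (p0 - w) + complex_of_real x * (u * (p1 - p0))"
    by (simp add: linepath_def scaleR_conv_of_real algebra_simps)
  then show ?thesis by (simp add: wexp_add wexp_scaleR)
qed

text \<open>\<open>layer\<close> is the spectral density, at the point \<open>\<beta> e\<^sup>t u\<close> of the ray through \<open>u\<close>, of the layer
  potential at \<open>w\<close> that is carried by the segment from \<open>p0\<close> to \<open>p1\<close> with density \<open>T\<close>.\<close>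

definition layer :: "real \<Rightarrow> complex \<Rightarrow> complex \<Rightarrow> ((real \<Rightarrow> complex) \<Rightarrow> complex) \<Rightarrow> complex \<Rightarrow> complex \<Rightarrow> real \<Rightarrow> complex" where
  "layer \<beta> p0 p1 T u w t = T (\<lambda>x. exp (wexp \<beta> t (u * (linepath p0 p1 x - w))))"

lemma exp_wexp_E01: "(\<lambda>x. exp (wexp \<beta> t (u * (linepath p0 p1 x - w)))) \<in> E01"
  unfolding exp_linepath
  by (rule E01_tower[OF exp_deriv_tower[of _ 1 "wexp \<beta> t (u * (p1 - p0))" "wexp \<beta> t (u * (p0 - w))"]]) simp

text \<open>The kernel is exponential in the position, so moving \<open>w\<close> only multiplies by a scalar; in particular all
  dependence on \<open>w\<close> is smooth, whatever the density \<open>T\<close>.\<close>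

lemma layer_shift:
  assumes "T \<in> E01_dual"
  shows "layer \<beta> p0 p1 T u (w + v) t = exp (wexp \<beta> t (- (u * v))) * layer \<beta> p0 p1 T u w t"
proof -
  have "exp (wexp \<beta> t (u * (linepath p0 p1 x - (w + v))))
     = exp (wexp \<beta> t (- (u * v))) * exp (wexp \<beta> t (u * (linepath p0 p1 x - w)))" for x
    unfolding exp_add[symmetric] wexp_add[symmetric] by (simp add: algebra_simps)
  then show ?thesis unfolding layer_def by (simp only: E01_dual_cmult[OF assms exp_wexp_E01])
qed

text \<open>Each derivative of the kernel along the segment costs one factor \<open>cosh t\<close>, and \<open>T\<close> sees
  only finitely many derivatives.\<close>

lemma layer_bound:
  assumes T: "T \<in> E01_dual" and b: "\<beta> > 0"
  shows "\<exists>C>0. \<exists>N. \<forall>u w t \<kappa>. norm u = 1 \<longrightarrow> (\<forall>x\<in>{0..1}. \<kappa> \<le> Im (u * (w - linepath p0 p1 x))) \<longrightarrow>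
     norm (layer \<beta> p0 p1 T u w t) \<le> C * cosh t ^ N * exp (- (2 * \<beta> * \<kappa> * cosh t))"
proof -
  obtain N C where "C > 0" "has_order T N C" using E01_dual_finite_order[OF T] .
  note NC = this(1) has_orderD[OF this(2)]
  define M where "M = max 1 (4 * \<beta> * norm (p1 - p0))"
  have M: "M \<ge> 1" by (simp add: M_def)
  have "norm (layer \<beta> p0 p1 T u w t) \<le> (C * M ^ N) * cosh t ^ N * exp (- (2 * \<beta> * \<kappa> * cosh t))"
    if u: "norm u = 1" and \<kappa>: "\<And>x. x \<in> {0..1} \<Longrightarrow> \<kappa> \<le> Im (u * (w - linepath p0 p1 x))" for u w t \<kappa>
  proof -
    let ?a = "wexp \<beta> t (u * (p1 - p0))" and ?b = "wexp \<beta> t (u * (p0 - w))"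
    have "norm (layer \<beta> p0 p1 T u w t) \<le> C * ((M * cosh t) ^ N * exp (- (2 * \<beta> * \<kappa> * cosh t)))"
      unfolding layer_def
    proof (rule NC(2)[OF exp_deriv_tower[of _ 1 ?a ?b]])
      show "exp (wexp \<beta> t (u * (linepath p0 p1 x - w))) = 1 * ?a ^ 0 * exp (?b + complex_of_real x * ?a)" for x
        by (simp add: exp_linepath)
      fix k x assume k: "k \<le> N" and x: "x \<in> {0..1::real}"
      have "norm ?a \<le> 4 * \<beta> * norm (p1 - p0) * cosh t"
        using norm_wexp_le[OF b, of t "u * (p1 - p0)"] u by (simp add: norm_mult)
      also have "\<dots> \<le> M * cosh t" by (intro mult_right_mono) (auto simp: M_def)
      finally have a: "norm ?a \<le> M * cosh t" .
      have "1 * 1 \<le> M * cosh t" using M cosh_real_ge_1[of t] by (intro mult_mono) auto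
      then have "norm ?a ^ k \<le> (M * cosh t) ^ N"
        using a k by (intro order_trans[OF power_mono power_increasing]) auto
      moreover have "norm (exp (?b + complex_of_real x * ?a)) \<le> exp (- (2 * \<beta> * \<kappa> * cosh t))"
      proof -
        have "Im (u * (linepath p0 p1 x - w)) \<le> - \<kappa>" using \<kappa>[OF x] by (simp add: algebra_simps)
        then have "2 * \<beta> * cosh t * Im (u * (linepath p0 p1 x - w)) \<le> 2 * \<beta> * cosh t * - \<kappa>"
          using b by (intro mult_left_mono) auto
        then show ?thesis unfolding exp_linepath[symmetric] norm_exp_wexp by (simp add: mult_ac)
      qed
      ultimately show "norm (1 * ?a ^ k * exp (?b + complex_of_real x * ?a))
          \<le> (M * cosh t) ^ N * exp (- (2 * \<beta> * \<kappa> * cosh t))"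
        unfolding norm_mult norm_power norm_one mult_1_left by (intro mult_mono) (use M in auto)
    qed
    then show ?thesis by (simp add: power_mult_distrib mult_ac)
  qed
  moreover have "C * M ^ N > 0" using NC(1) M by simp
  ultimately show ?thesis by blast
qed

lemma layer_continuous:
  assumes T: "T \<in> E01_dual"
  shows "continuous_on UNIV (\<lambda>t. layer \<beta> p0 p1 T u w t)"
proof -
  have "continuous_on UNIV (\<lambda>t. T ((\<lambda>k t x. 1 * wexp \<beta> t (u * (p1 - p0)) ^ k *
      exp (wexp \<beta> t (u * (p0 - w)) + complex_of_real x * wexp \<beta> t (u * (p1 - p0)))) 0 t))"
    by (rule E01_dual_continuous[OF T exp_deriv_tower])
      (auto simp: case_prod_unfold intro!: continuous_intros continuous_wexp)
  then show ?thesis by (simp add: layer_def exp_linepath)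
qed

lemma layer_integral:
  assumes T: "T \<in> E01_dual" and b: "\<beta> > 0" and u: "norm u = 1" and \<kappa>: "\<kappa> > 0"
    "\<And>x. x \<in> {0..1} \<Longrightarrow> \<kappa> \<le> Im (u * (w - linepath p0 p1 x))"
    and P: "continuous_on UNIV P" "\<And>t. norm (P t) \<le> CP * cosh t ^ m" "CP \<ge> 0"
  shows "integrable lborel (\<lambda>t. P t * layer \<beta> p0 p1 T u w t)"
    and "(LBINT t. P t * layer \<beta> p0 p1 T u w t)
      = T (\<lambda>x. LBINT t. P t * exp (wexp \<beta> t (u * (linepath p0 p1 x - w))))"
    and "(\<lambda>x. LBINT t. P t * exp (wexp \<beta> t (u * (linepath p0 p1 x - w)))) \<in> E01"
proof -
  define F where "F k t x = P t * wexp \<beta> t (u * (p1 - p0)) ^ k *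
      exp (wexp \<beta> t (u * (p0 - w)) + complex_of_real x * wexp \<beta> t (u * (p1 - p0)))" for k t x
  define a where "a = 2 * \<beta> * \<kappa>"
  have a: "a > 0" using b \<kappa> by (simp add: a_def)
  define D where "D = 4 * \<beta> * norm (p1 - p0)"
  have D: "D \<ge> 0" using b by (simp add: D_def)
  obtain K where K: "\<And>k. K k > 0"
    "\<And>k t. cosh t ^ (m + k) * exp (- (a * cosh t)) \<le> K k / a ^ (m + k + 2) / cosh t ^ 2"
  proof -
    have "\<forall>k. \<exists>K>0. \<forall>t. cosh t ^ (m + k) * exp (- (a * cosh t)) \<le> K / a ^ (m + k + 2) / cosh t ^ 2"
      using cosh_power_exp_le[of "m + _" 2] a by blast
    then show ?thesis using that by metis
  qed
  define g where "g k t = CP * D ^ k * (K k / a ^ (m + k + 2)) * (1 / cosh t ^ 2)" for k and t :: real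
  have tower: "deriv_tower {0..1} (\<lambda>k. F k t)" for t unfolding F_def by (rule exp_deriv_tower)
  have cont: "continuous_on (UNIV \<times> {0..1}) (\<lambda>(t, x). F k t x)" for k
  proof -
    have "continuous_on (UNIV \<times> {0..1::real}) (\<lambda>p. P (fst p))"
      by (rule continuous_on_compose2[OF P(1)]) (auto intro: continuous_intros)
    then show ?thesis unfolding F_def case_prod_unfold by (intro continuous_intros continuous_wexp)
  qed
  have bound: "norm (F k t x) \<le> g k t" if x: "x \<in> {0..1}" for k t x
  proof -
    have "norm (wexp \<beta> t (u * (p1 - p0))) \<le> D * cosh t"
      using norm_wexp_le[OF b, of t "u * (p1 - p0)"] u by (simp add: norm_mult D_def)
    then have 1: "norm (wexp \<beta> t (u * (p1 - p0))) ^ k \<le> (D * cosh t) ^ k" by (intro power_mono) auto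
    have "Im (u * (linepath p0 p1 x - w)) \<le> - \<kappa>" using \<kappa>(2)[OF x] by (simp add: algebra_simps)
    then have "2 * \<beta> * cosh t * Im (u * (linepath p0 p1 x - w)) \<le> 2 * \<beta> * cosh t * - \<kappa>"
      using b by (intro mult_left_mono) auto
    then have 2: "norm (exp (wexp \<beta> t (u * (p0 - w)) + complex_of_real x * wexp \<beta> t (u * (p1 - p0))))
        \<le> exp (- (a * cosh t))"
      unfolding exp_linepath[symmetric] norm_exp_wexp a_def by (simp add: mult_ac)
    have "norm (F k t x) \<le> (CP * cosh t ^ m) * (D * cosh t) ^ k * exp (- (a * cosh t))"
      unfolding F_def norm_mult norm_power using P(2,3) D by (intro mult_mono 1 2) auto
    also have "\<dots> = CP * D ^ k * (cosh t ^ (m + k) * exp (- (a * cosh t)))"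
      by (simp add: power_mult_distrib power_add mult_ac)
    also have "\<dots> \<le> CP * D ^ k * (K k / a ^ (m + k + 2) / cosh t ^ 2)"
      using P(3) D by (intro mult_left_mono K) auto
    finally show ?thesis by (simp add: g_def)
  qed
  have g: "integrable lborel (g k)" for k
    unfolding g_def by (intro integrable_mult_right integrable_inverse_cosh)
  have F0: "F 0 t = (\<lambda>x. P t * exp (wexp \<beta> t (u * (linepath p0 p1 x - w))))" for t
    unfolding F_def exp_linepath by simp
  have TF0: "T (F 0 t) = P t * layer \<beta> p0 p1 T u w t" for t
    unfolding F0 layer_def by (rule E01_dual_cmult[OF T exp_wexp_E01])
  show "integrable lborel (\<lambda>t. P t * layer \<beta> p0 p1 T u w t)"
    using E01_dual_integral(1)[OF T tower cont bound g] by (simp add: TF0)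
  show "(LBINT t. P t * layer \<beta> p0 p1 T u w t)
      = T (\<lambda>x. LBINT t. P t * exp (wexp \<beta> t (u * (linepath p0 p1 x - w))))"
    using E01_dual_integral(2)[OF T tower cont bound g] unfolding TF0 unfolding F0 by simp
  have "deriv_tower {0..1} (\<lambda>k x. LBINT t. F k t x)"
  proof (rule deriv_tower_integral[OF tower _ bound g])
    fix k and x :: real assume x: "x \<in> {0..1}"
    have "continuous_on UNIV (\<lambda>t. case (t, x) of (t, x) \<Rightarrow> F k t x)"
      by (rule continuous_on_compose2[OF cont[of k]]) (use x in \<open>auto intro!: continuous_intros\<close>)
    then show "(\<lambda>t. F k t x) \<in> borel_measurable lborel"
      using borel_measurable_continuous_onI by simp
  qed
  then show "(\<lambda>x. LBINT t. P t * exp (wexp \<beta> t (u * (linepath p0 p1 x - w)))) \<in> E01"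
    by (rule E01_tower) (simp add: F0)
qed

section \<open>Turning the ray\<close>

text \<open>For \<open>f\<close> holomorphic off \<open>0\<close>, moving the direction \<open>u\<close> of the ray \<open>e\<^sup>t u\<close> changes the integrand
  by a total \<open>t\<close>-derivative, so only the two ends of the ray contribute. The straight path from
  \<open>u1\<close> to \<open>u2\<close> keeps the kernel decaying when it decays at both ends.\<close>

lemma ray_integral_derivative:
  fixes f f' :: "complex \<Rightarrow> complex"
  assumes f: "\<And>\<mu>. \<mu> \<noteq> 0 \<Longrightarrow> (f has_field_derivative f' \<mu>) (at \<mu>)"
    and cf': "continuous_on (- {0}) f'"
    and u: "\<And>s. s \<in> {0..1} \<Longrightarrow> u s \<noteq> 0" and us: "\<And>s. u s = u1 + complex_of_real s * (u2 - u1)"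
    and b: "\<beta> > 0" and M: "M > 0" and s0: "s0 \<in> {0..1}"
  shows "((\<lambda>s. integral {- M..M} (\<lambda>t. f (ray_point \<beta> (u s) t))) has_vector_derivative
     ((u2 - u1) / u s0) * (f (ray_point \<beta> (u s0) M) - f (ray_point \<beta> (u s0) (- M)))) (at s0 within {0..1})"
proof -
  have nz: "ray_point \<beta> (u s) t \<noteq> 0" if "s \<in> {0..1}" for s t using b u[OF that] by simp
  have cu: "continuous_on S u" for S unfolding us by (intro continuous_intros)
  have cont: "continuous_on S (\<lambda>p. f' (ray_point \<beta> (u (fst p)) (snd p)))"
    if "S \<subseteq> {0..1} \<times> UNIV" for S :: "(real \<times> real) set"
  proof (rule continuous_on_compose2[OF cf'])
    have "continuous_on S (\<lambda>p. u (fst p))"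
      by (rule continuous_on_compose2[OF cu[of UNIV]]) (auto intro: continuous_intros)
    then show "continuous_on S (\<lambda>p. ray_point \<beta> (u (fst p)) (snd p))" by (intro continuous_intros)
    show "(\<lambda>p. ray_point \<beta> (u (fst p)) (snd p)) ` S \<subseteq> - {0}" using nz that by auto
  qed
  have ds: "((\<lambda>s. f (ray_point \<beta> (u s) t)) has_vector_derivative
      f' (ray_point \<beta> (u s) t) * (complex_of_real (\<beta> * exp t) * (u2 - u1))) (at s within {0..1})"
    if "s \<in> {0..1}" for s t
  proof -
    have "((\<lambda>s. ray_point \<beta> (u s) t) has_vector_derivative complex_of_real (\<beta> * exp t) * (u2 - u1)) (at s within {0..1})"
      unfolding us by (auto intro!: derivative_eq_intros)
    from field_vector_diff_chain_within[OF this has_field_derivative_at_within[OF f[OF nz[OF that]]]]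
    show ?thesis by (simp add: o_def mult.commute)
  qed
  have dt: "((\<lambda>t. f (ray_point \<beta> (u s) t)) has_vector_derivative
      f' (ray_point \<beta> (u s) t) * ray_point \<beta> (u s) t) (at t within S)"
    if "s \<in> {0..1}" for s t S
  proof -
    have "((\<lambda>t. ray_point \<beta> (u s) t) has_vector_derivative ray_point \<beta> (u s) t) (at t within S)"
      by (auto intro!: derivative_eq_intros)
    from field_vector_diff_chain_within[OF this has_field_derivative_at_within[OF f[OF nz[OF that]]]]
    show ?thesis by (simp add: o_def mult.commute)
  qed
  have "((\<lambda>s. integral (cbox (- M) M) (\<lambda>t. f (ray_point \<beta> (u s) t))) has_vector_derivative
     integral (cbox (- M) M) (\<lambda>t. f' (ray_point \<beta> (u s0) t) * (complex_of_real (\<beta> * exp t) * (u2 - u1))))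
     (at s0 within {0..1})"
  proof (rule leibniz_rule_vector_derivative[OF ds])
    show "(\<lambda>t. f (ray_point \<beta> (u s) t)) integrable_on cbox (- M) M" if "s \<in> {0..1}" for s
      by (rule integrable_continuous)
        (unfold continuous_on_eq_continuous_within, intro ballI has_vector_derivative_continuous[OF dt[OF that]])
    show "continuous_on ({0..1} \<times> cbox (- M) M)
        (\<lambda>(s, t). f' (ray_point \<beta> (u s) t) * (complex_of_real (\<beta> * exp t) * (u2 - u1)))"
      unfolding case_prod_unfold by (intro continuous_intros cont) auto
  qed (use s0 in auto)
  moreover have "integral {- M..M} (\<lambda>t. f' (ray_point \<beta> (u s0) t) * (complex_of_real (\<beta> * exp t) * (u2 - u1)))
     = ((u2 - u1) / u s0) * (f (ray_point \<beta> (u s0) M) - f (ray_point \<beta> (u s0) (- M)))"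
  proof -
    have "((\<lambda>t. f' (ray_point \<beta> (u s0) t) * ray_point \<beta> (u s0) t) has_integral
       f (ray_point \<beta> (u s0) M) - f (ray_point \<beta> (u s0) (- M))) {- M..M}"
      by (rule fundamental_theorem_of_calculus) (use M dt[OF s0] in auto)
    then have "((\<lambda>t. ((u2 - u1) / u s0) * (f' (ray_point \<beta> (u s0) t) * ray_point \<beta> (u s0) t)) has_integral
       ((u2 - u1) / u s0) * (f (ray_point \<beta> (u s0) M) - f (ray_point \<beta> (u s0) (- M)))) {- M..M}"
      by (rule has_integral_mult_right)
    moreover have "((u2 - u1) / u s0) * (f' (ray_point \<beta> (u s0) t) * ray_point \<beta> (u s0) t)
        = f' (ray_point \<beta> (u s0) t) * (complex_of_real (\<beta> * exp t) * (u2 - u1))" for t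
      using u[OF s0] by (simp add: field_simps)
    ultimately show ?thesis by (simp add: integral_unique)
  qed
  ultimately show ?thesis by simp
qed

lemma ray_integral_turn:
  fixes f f' :: "complex \<Rightarrow> complex"
  assumes f: "\<And>\<mu>. \<mu> \<noteq> 0 \<Longrightarrow> (f has_field_derivative f' \<mu>) (at \<mu>)"
    and cf': "continuous_on (- {0}) f'"
    and us: "\<And>s. u s = u1 + complex_of_real s * (u2 - u1)"
    and b: "\<beta> > 0" and m: "m > 0" "\<And>s. s \<in> {0..1} \<Longrightarrow> m \<le> norm (u s)"
    and g: "\<And>s t. s \<in> {0..1} \<Longrightarrow> norm (f (ray_point \<beta> (u s) t)) \<le> g t"
    and g0: "(\<lambda>k. g (real k)) \<longlonglongrightarrow> 0" "(\<lambda>k. g (- real k)) \<longlonglongrightarrow> 0"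
    and int: "integrable lborel (\<lambda>t. f (ray_point \<beta> u1 t))" "integrable lborel (\<lambda>t. f (ray_point \<beta> u2 t))"
  shows "(LBINT t. f (ray_point \<beta> u1 t)) = (LBINT t. f (ray_point \<beta> u2 t))"
proof -
  define h where "h k s = integral {- real k..real k} (\<lambda>t. f (ray_point \<beta> (u s) t))" for k s
  have u: "u s \<noteq> 0" if "s \<in> {0..1}" for s using m(2)[OF that] m(1) by auto
  have lim: "(\<lambda>k. integral {- real k..real k} \<phi>) \<longlonglongrightarrow> (LBINT t. \<phi> t)"
    if \<phi>: "integrable lborel \<phi>" for \<phi> :: "real \<Rightarrow> complex"
  proof -
    have "(\<lambda>k. LBINT t. indicator {- real k..real k} t *\<^sub>R \<phi> t) \<longlonglongrightarrow> (LBINT t. \<phi> t)"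
    proof (rule integral_dominated_convergence[where w = "\<lambda>t. norm (\<phi> t)"])
      show "AE t in lborel. (\<lambda>k. indicator {- real k..real k} t *\<^sub>R \<phi> t) \<longlonglongrightarrow> \<phi> t"
      proof (rule AE_I2, rule tendsto_eventually)
        fix t
        obtain k0 where k0: "\<bar>t\<bar> \<le> real k0" using real_arch_simple by blast
        show "\<forall>\<^sub>F k in sequentially. indicator {- real k..real k} t *\<^sub>R \<phi> t = \<phi> t"
          using eventually_ge_at_top[of k0] by eventually_elim (use k0 in \<open>auto simp: indicator_def abs_le_iff\<close>)
      qed
    qed (use \<phi> in \<open>auto simp: indicator_def\<close>)
    moreover have "(LBINT t. indicator {- real k..real k} t *\<^sub>R \<phi> t) = integral {- real k..real k} \<phi>" for k
    proof -
      have "set_integrable lborel {- real k..real k} \<phi>"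
        unfolding set_integrable_def by (intro integrable_mult_indicator \<phi>) auto
      from set_borel_integral_eq_integral(2)[OF this] show ?thesis by (simp add: set_lebesgue_integral_def)
    qed
    ultimately show ?thesis by simp
  qed
  have bound: "norm (h k 1 - h k 0) \<le> norm (u2 - u1) / m * (g (real k) + g (- real k))" if k: "k > 0" for k
  proof -
    have "norm (h k 1 - h k 0) \<le> norm (u2 - u1) / m * (g (real k) + g (- real k)) * \<bar>1 - 0\<bar>"
    proof (rule vector_derivative_bound[where S = "{0..1}"])
      fix s :: real assume s: "s \<in> {0..1}"
      show "(h k has_vector_derivative ((u2 - u1) / u s) *
          (f (ray_point \<beta> (u s) (real k)) - f (ray_point \<beta> (u s) (- real k)))) (at s within {0..1})"
        unfolding h_def by (rule ray_integral_derivative[OF f cf' u us b _ s]) (use k in simp_all)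
      have "norm (f (ray_point \<beta> (u s) (real k)) - f (ray_point \<beta> (u s) (- real k))) \<le> g (real k) + g (- real k)"
        by (intro order_trans[OF norm_triangle_ineq4] add_mono g s)
      moreover have "norm ((u2 - u1) / u s) \<le> norm (u2 - u1) / m"
        unfolding norm_divide using m(2)[OF s] m(1) u[OF s] by (intro divide_left_mono mult_pos_pos) auto
      ultimately show "norm (((u2 - u1) / u s) * (f (ray_point \<beta> (u s) (real k)) - f (ray_point \<beta> (u s) (- real k))))
          \<le> norm (u2 - u1) / m * (g (real k) + g (- real k))"
        unfolding norm_mult using m(1) by (intro mult_mono) auto
    qed auto
    then show ?thesis by simp
  qed
  have "(\<lambda>k. h k 1 - h k 0) \<longlonglongrightarrow> 0"
  proof (rule Lim_null_comparison)
    show "\<forall>\<^sub>F k in sequentially. norm (h k 1 - h k 0) \<le> norm (u2 - u1) / m * (g (real k) + g (- real k))"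
      using eventually_gt_at_top[of 0] by eventually_elim (rule bound)
    show "(\<lambda>k. norm (u2 - u1) / m * (g (real k) + g (- real k))) \<longlonglongrightarrow> 0"
      using tendsto_mult_left[OF tendsto_add[OF g0], of "norm (u2 - u1) / m"] by simp
  qed
  moreover have "(\<lambda>k. h k 1 - h k 0) \<longlonglongrightarrow> (LBINT t. f (ray_point \<beta> u2 t)) - (LBINT t. f (ray_point \<beta> u1 t))"
    unfolding h_def us using tendsto_diff[OF lim[OF int(2)] lim[OF int(1)]] by simp
  ultimately have "(LBINT t. f (ray_point \<beta> u2 t)) - (LBINT t. f (ray_point \<beta> u1 t)) = 0"
    by (rule LIMSEQ_unique[rotated])
  then show ?thesis by simp
qed

lemma cosh_at_ends: "filterlim (\<lambda>k. cosh (real k)) at_top sequentially"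
  by (rule filterlim_compose[OF cosh_real_at_top filterlim_real_sequentially])

lemma cosh_exp_tendsto_0:
  assumes a: "a > 0"
  shows "(\<lambda>k. C * cosh (real k) ^ N * exp (- (a * cosh (real k)))) \<longlonglongrightarrow> 0"
proof -
  obtain K where K: "\<And>t::real. cosh t ^ N * exp (- (a * cosh t)) \<le> K / a ^ (N + 1) / cosh t ^ 1"
    using cosh_power_exp_le[of N 1] a by blast
  have "(\<lambda>k. cosh (real k) ^ N * exp (- (a * cosh (real k)))) \<longlonglongrightarrow> 0"
  proof (rule tendsto_sandwich[of "\<lambda>_. 0" _ _ "\<lambda>k. K / a ^ (N + 1) / cosh (real k)"])
    show "(\<lambda>k. K / a ^ (N + 1) / cosh (real k)) \<longlonglongrightarrow> 0"
      by (rule real_tendsto_divide_at_top[OF tendsto_const cosh_at_ends])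
  qed (use K in \<open>auto intro!: always_eventually\<close>)
  from tendsto_mult_left[OF this, of C] show ?thesis by (simp add: mult.assoc)
qed

text \<open>On the straight path between two unit vectors \<open>\<bar>u\<bar> \<le> 1\<close> holds, and hence
  \<open>Re (\<i> \<mu> v - \<i> \<beta>\<^sup>2 v\<^sup>* / \<mu>) \<le> - 2 \<beta> \<kappa> cosh t\<close> for \<open>\<mu> = \<beta> e\<^sup>t u\<close> and \<open>Im (u v) \<ge> \<kappa>\<close>, where \<open>v\<^sup>*\<close> is the conjugate of \<open>v\<close>.\<close>

lemma kernel_ray_integral_turn:
  fixes v e1 e2 u1 u2 :: complex
  assumes b: "\<beta> > 0" and u: "norm u1 = 1" "norm u2 = 1" and e: "norm e1 = 1" "norm e2 = 1"
    and pos: "Im (u1 * v) > 0" "Im (u2 * v) > 0"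
  shows "(LBINT t. rate \<beta> t (u1 * e1) * rate \<beta> t (u1 * e2) ^ m * exp (wexp \<beta> t (u1 * - v)))
       = (LBINT t. rate \<beta> t (u2 * e1) * rate \<beta> t (u2 * e2) ^ m * exp (wexp \<beta> t (u2 * - v)))"
proof -
  define R where "R e \<mu> = \<mu> * e + (complex_of_real \<beta>)\<^sup>2 / (\<mu> * e)" for e \<mu>
  define R' where "R' e \<mu> = e - (complex_of_real \<beta>)\<^sup>2 / (\<mu>\<^sup>2 * e)" for e \<mu> :: complex
  define f where "f \<mu> = R e1 \<mu> * R e2 \<mu> ^ m * exp_kernel \<beta> \<mu> (- v)" for \<mu>
  define f' where "f' \<mu> = (R' e1 \<mu> * R e2 \<mu> ^ m + R e1 \<mu> * (of_nat m * R e2 \<mu> ^ (m - 1) * R' e2 \<mu>)) * exp_kernel \<beta> \<mu> (- v)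
      + R e1 \<mu> * R e2 \<mu> ^ m * (exp_kernel \<beta> \<mu> (- v) * (\<i> * v + \<i> * (complex_of_real \<beta>)\<^sup>2 * cnj v / \<mu>\<^sup>2))" for \<mu>
  have nz: "e1 \<noteq> 0" "e2 \<noteq> 0" using e by auto
  have f_ray: "f (ray_point \<beta> u t) = rate \<beta> t (u * e1) * rate \<beta> t (u * e2) ^ m * exp (wexp \<beta> t (u * - v))"
    if "norm u = 1" for u t
    unfolding f_def R_def rate_ray[OF b that e(1)] rate_ray[OF b that e(2)] exp_kernel_ray[OF b that] ..
  define us where "us s = u1 + complex_of_real s * (u2 - u1)" for s
  define \<kappa> where "\<kappa> = min (Im (u1 * v)) (Im (u2 * v))"
  have \<kappa>: "\<kappa> > 0" using pos by (simp add: \<kappa>_def)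
  have us_im: "\<kappa> \<le> Im (us s * v)" if "s \<in> {0..1}" for s
  proof -
    have "us s * v = complex_of_real (1 - s) * (u1 * v) + complex_of_real s * (u2 * v)"
      by (simp add: us_def algebra_simps)
    then have "Im (us s * v) = (1 - s) * Im (u1 * v) + s * Im (u2 * v)"
      by (simp only: plus_complex.sel Im_of_real_mult)
    moreover have "(1 - s) * \<kappa> + s * \<kappa> \<le> (1 - s) * Im (u1 * v) + s * Im (u2 * v)"
      using that by (intro add_mono mult_left_mono) (auto simp: \<kappa>_def)
    ultimately show ?thesis by (simp add: algebra_simps)
  qed
  have us_le: "norm (us s) \<le> 1" if "s \<in> {0..1}" for s
  proof -
    have "us s = complex_of_real (1 - s) * u1 + complex_of_real s * u2" by (simp add: us_def algebra_simps)
    then have "norm (us s) \<le> norm (complex_of_real (1 - s) * u1) + norm (complex_of_real s * u2)"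
      by (simp only: norm_triangle_ineq)
    moreover have "norm (complex_of_real (1 - s) * u1) = 1 - s" "norm (complex_of_real s * u2) = s"
      using that u by (simp_all only: norm_mult norm_of_real) auto
    ultimately show ?thesis by linarith
  qed
  have v: "norm v > 0" using pos by auto
  \<comment> \<open>the path keeps away from \<open>0\<close>\<close>
  define m0 where "m0 = \<kappa> / norm v"
  have m0: "m0 > 0" using \<kappa> v by (simp add: m0_def)
  have us_ge: "m0 \<le> norm (us s)" if "s \<in> {0..1}" for s
  proof -
    have "\<kappa> \<le> norm (us s * v)" using us_im[OF that] abs_Im_le_cmod[of "us s * v"] by linarith
    then show ?thesis using v by (simp add: m0_def norm_mult divide_le_eq)
  qed
  have m0_le: "m0 \<le> 1" using us_ge[of 0] us_le[of 0] by simp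
  define g where "g t = (2 * \<beta> / m0) ^ (m + 1) * cosh t ^ (m + 1) * exp (- (2 * \<beta> * \<kappa> * cosh t))" for t
  have bound: "norm (f (ray_point \<beta> (us s) t)) \<le> g t" if s: "s \<in> {0..1}" for s t
  proof -
    let ?\<mu> = "ray_point \<beta> (us s) t"
    have us0: "us s \<noteq> 0" using us_ge[OF s] m0 by auto
    have R: "norm (R e ?\<mu>) \<le> 2 * \<beta> / m0 * cosh t" if e: "norm e = 1" for e
    proof -
      have "norm (R e ?\<mu>) \<le> norm (?\<mu> * e) + norm ((complex_of_real \<beta>)\<^sup>2 / (?\<mu> * e))"
        unfolding R_def by (rule norm_triangle_ineq)
      also have "\<dots> = \<beta> * exp t * norm (us s) + \<beta> * exp (- t) / norm (us s)"
      proof -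
        have n1: "norm ?\<mu> = \<beta> * exp t * norm (us s)" using b by (simp add: norm_mult)
        have "\<beta>\<^sup>2 / (\<beta> * exp t * norm (us s)) = \<beta> * exp (- t) / norm (us s)"
          using b us0 by (simp add: power2_eq_square exp_minus field_simps)
        then show ?thesis unfolding norm_divide norm_mult[of _ e] e n1 norm_power using b by simp
      qed
      also have "\<dots> \<le> \<beta> * exp t * (1 / m0) + \<beta> * exp (- t) / m0"
      proof (intro add_mono mult_left_mono divide_left_mono)
        show "norm (us s) \<le> 1 / m0" using us_le[OF s] m0 m0_le by (simp add: le_divide_eq mult_le_one)
        show "m0 \<le> norm (us s)" by (rule us_ge[OF s])
      qed (use b m0 us0 in auto)
      also have "\<dots> = 2 * \<beta> / m0 * cosh t" unfolding exp_cosh_sinh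
        by (simp add: algebra_simps add_divide_distrib diff_divide_distrib)
      finally show ?thesis .
    qed
    have norm_exp_i: "norm (exp (\<i> * complex_of_real a * q - \<i> * complex_of_real c * cnj q)) = exp (- (a * Im q) - c * Im q)"
      for a c q by simp
    have E: "norm (exp_kernel \<beta> ?\<mu> (- v)) \<le> exp (- (2 * \<beta> * \<kappa> * cosh t))"
    proof -
      have "\<i> * (complex_of_real \<beta>)\<^sup>2 * cnj (- v) / ?\<mu>
          = - (\<i> * complex_of_real (\<beta> * exp (- t) / (norm (us s))\<^sup>2) * cnj (us s * v))"
      proof -
        have "us s * cnj (us s) = complex_of_real ((norm (us s))\<^sup>2)" by (rule complex_norm_square[symmetric])
        then have "1 / us s = cnj (us s) / complex_of_real ((norm (us s))\<^sup>2)"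
          using us0 by (simp add: field_simps)
        moreover have "1 / ?\<mu> = (1 / complex_of_real (\<beta> * exp t)) * (1 / us s)" by simp
        moreover have "1 / complex_of_real (\<beta> * exp t) = complex_of_real (exp (- t) / \<beta>)"
          by (simp add: exp_minus divide_inverse)
        ultimately have "1 / ?\<mu> = complex_of_real (exp (- t) / \<beta>) * (cnj (us s) / complex_of_real ((norm (us s))\<^sup>2))"
          by (simp only:)
        then have "\<i> * (complex_of_real \<beta>)\<^sup>2 * cnj (- v) * (1 / ?\<mu>) = \<i> * (complex_of_real \<beta>)\<^sup>2 * cnj (- v) *
            (complex_of_real (exp (- t) / \<beta>) * (cnj (us s) / complex_of_real ((norm (us s))\<^sup>2)))" by (simp only:)
        then show ?thesis using b by (simp add: power2_eq_square)
      qed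
      then have "exp_kernel \<beta> ?\<mu> (- v) = exp (\<i> * complex_of_real (\<beta> * exp t) * (us s * v)
          - \<i> * complex_of_real (\<beta> * exp (- t) / (norm (us s))\<^sup>2) * cnj (us s * v))"
        unfolding exp_kernel_def by (simp add: mult_ac)
      then have "norm (exp_kernel \<beta> ?\<mu> (- v)) = exp (- (\<beta> * exp t * Im (us s * v)) -
          \<beta> * exp (- t) / (norm (us s))\<^sup>2 * Im (us s * v))"
        by (simp only: norm_exp_i)
      also have "\<dots> \<le> exp (- (\<beta> * exp t * \<kappa>) - \<beta> * exp (- t) * \<kappa>)"
      proof -
        have "\<beta> * exp t * \<kappa> \<le> \<beta> * exp t * Im (us s * v)" using us_im[OF s] b by (intro mult_left_mono) auto
        moreover have "\<beta> * exp (- t) * \<kappa> \<le> \<beta> * exp (- t) / (norm (us s))\<^sup>2 * Im (us s * v)"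
        proof (intro mult_mono us_im[OF s])
          have "(norm (us s))\<^sup>2 \<le> 1" using us_le[OF s] by (simp add: power_le_one)
          then have "\<beta> * exp (- t) / 1 \<le> \<beta> * exp (- t) / (norm (us s))\<^sup>2"
            using b us0 by (intro divide_left_mono) auto
          then show "\<beta> * exp (- t) \<le> \<beta> * exp (- t) / (norm (us s))\<^sup>2" by simp
        qed (use b \<kappa> in auto)
        ultimately show ?thesis by simp
      qed
      also have "\<dots> = exp (- (2 * \<beta> * \<kappa> * cosh t))"
        unfolding exp_cosh_sinh by (simp add: algebra_simps)
      finally show ?thesis .
    qed
    have "norm (f ?\<mu>) \<le> (2 * \<beta> / m0 * cosh t) * (2 * \<beta> / m0 * cosh t) ^ m * exp (- (2 * \<beta> * \<kappa> * cosh t))"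
      unfolding f_def norm_mult norm_power using b m0
      by (intro mult_mono R e E power_mono) (auto intro: e)
    moreover have "g t = (2 * \<beta> / m0 * cosh t) * (2 * \<beta> / m0 * cosh t) ^ m * exp (- (2 * \<beta> * \<kappa> * cosh t))"
      unfolding g_def by (simp only: power_mult_distrib power_Suc Suc_eq_plus1[symmetric] mult_ac)
    ultimately show ?thesis by simp
  qed
  have a: "2 * \<beta> * \<kappa> > 0" using b \<kappa> by simp
  have int: "integrable lborel (\<lambda>t. f (ray_point \<beta> (us s) t))" if s: "s \<in> {0, 1}" for s
  proof -
    obtain K where K: "\<And>t::real. cosh t ^ (m + 1) * exp (- (2 * \<beta> * \<kappa> * cosh t))
        \<le> K / (2 * \<beta> * \<kappa>) ^ (m + 1 + 2) / cosh t ^ 2"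
      using cosh_power_exp_le[of "m + 1" 2] a by blast
    show ?thesis
    proof (rule integrable_if_cosh_decay)
      have nu: "norm (us s) = 1" using s u by (auto simp: us_def)
      show "(\<lambda>t. f (ray_point \<beta> (us s) t)) \<in> borel_measurable borel"
        unfolding f_ray[OF nu]
        by (intro borel_measurable_continuous_onI continuous_intros continuous_rate continuous_wexp)
      fix t
      have "norm (f (ray_point \<beta> (us s) t)) \<le> g t" using s by (intro bound) auto
      also have "\<dots> \<le> (2 * \<beta> / m0) ^ (m + 1) * (K / (2 * \<beta> * \<kappa>) ^ (m + 1 + 2) / cosh t ^ 2)"
        unfolding g_def mult.assoc[of "(2 * \<beta> / m0) ^ (m + 1)"] using b m0 by (intro mult_left_mono K) auto
      finally show "norm (f (ray_point \<beta> (us s) t)) \<le> (2 * \<beta> / m0) ^ (m + 1) * (K / (2 * \<beta> * \<kappa>) ^ (m + 1 + 2)) / cosh t ^ 2"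
        by (simp only: times_divide_eq_right)
    qed
  qed
  have "(LBINT t. f (ray_point \<beta> u1 t)) = (LBINT t. f (ray_point \<beta> u2 t))"
  proof (rule ray_integral_turn[of f f' us u1 u2 \<beta> m0 g])
    show "(f has_field_derivative f' \<mu>) (at \<mu>)" if "\<mu> \<noteq> 0" for \<mu>
    proof -
      have R: "(R e has_field_derivative R' e \<mu>) (at \<mu>)" if "e \<noteq> 0" for e
        unfolding R_def R'_def using \<open>\<mu> \<noteq> 0\<close> that
        by (auto intro!: derivative_eq_intros simp: field_simps power2_eq_square)
      have E: "((\<lambda>\<mu>. exp_kernel \<beta> \<mu> (- v)) has_field_derivative
          exp_kernel \<beta> \<mu> (- v) * (\<i> * v + \<i> * (complex_of_real \<beta>)\<^sup>2 * cnj v / \<mu>\<^sup>2)) (at \<mu>)"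
        unfolding exp_kernel_def using \<open>\<mu> \<noteq> 0\<close>
        by (auto intro!: derivative_eq_intros simp: field_simps power2_eq_square)
      have P: "((\<lambda>\<mu>. R e2 \<mu> ^ m) has_field_derivative of_nat m * R e2 \<mu> ^ (m - 1) * R' e2 \<mu>) (at \<mu>)"
        using DERIV_power[OF R[OF nz(2)], of m] by (simp add: mult_ac)
      show ?thesis
        unfolding f_def f'_def
        by (rule DERIV_cong[OF DERIV_mult[OF DERIV_mult[OF R[OF nz(1)] P] E]]) (simp add: algebra_simps)
    qed
    show "continuous_on (- {0}) f'"
      unfolding f'_def R_def R'_def exp_kernel_def using nz by (intro continuous_intros) auto
    show "(\<lambda>k. g (real k)) \<longlonglongrightarrow> 0" "(\<lambda>k. g (- real k)) \<longlonglongrightarrow> 0"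
      unfolding g_def cosh_minus by (rule cosh_exp_tendsto_0[OF a])+
    show "integrable lborel (\<lambda>t. f (ray_point \<beta> u1 t))" "integrable lborel (\<lambda>t. f (ray_point \<beta> u2 t))"
      using int[of 0] int[of 1] by (simp_all add: us_def)
  qed (use b m0 us_ge bound in \<open>auto simp: us_def\<close>)
  then show ?thesis unfolding f_ray[OF u(1)] f_ray[OF u(2)] .
qed

section \<open>Potentials\<close>

text \<open>For \<open>m = 0\<close> and \<open>m = 1\<close> these are, up to constants, the derivatives in the direction
  \<open>- \<i> e1\<close> of a single and of a double layer potential on the segment from \<open>p0\<close> to \<open>p1\<close>
  with direction \<open>e2\<close>.\<close>

definition weight :: "real \<Rightarrow> complex \<Rightarrow> complex \<Rightarrow> nat \<Rightarrow> complex \<Rightarrow> real \<Rightarrow> complex" where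
  "weight \<beta> e1 e2 m u t = rate \<beta> t (u * e1) * rate \<beta> t (u * e2) ^ m"

definition potential :: "real \<Rightarrow> complex \<Rightarrow> complex \<Rightarrow> nat \<Rightarrow> complex \<Rightarrow> complex \<Rightarrow>
    ((real \<Rightarrow> complex) \<Rightarrow> complex) \<Rightarrow> complex \<Rightarrow> complex \<Rightarrow> complex" where
  "potential \<beta> e1 e2 m p0 p1 T u w = (LBINT t. weight \<beta> e1 e2 m u t * layer \<beta> p0 p1 T u w t)"

text \<open>The ray through \<open>u\<close> is admissible at \<open>w\<close>: the kernel decays like \<open>exp (- 2 \<beta> \<kappa> cosh t)\<close> for all points of the
  segment.\<close>

definition separates :: "complex \<Rightarrow> complex \<Rightarrow> complex \<Rightarrow> real \<Rightarrow> complex \<Rightarrow> bool" where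
  "separates u p0 p1 \<kappa> w \<longleftrightarrow> (\<forall>x\<in>{0..1}. \<kappa> \<le> Im (u * (w - linepath p0 p1 x)))"

lemma separates_mono: "separates u p0 p1 \<kappa> w \<Longrightarrow> \<kappa>' \<le> \<kappa> \<Longrightarrow> separates u p0 p1 \<kappa>' w"
  unfolding separates_def by (meson order_trans)

lemma weight_continuous: "continuous_on UNIV (weight \<beta> e1 e2 m u)"
  unfolding weight_def by (intro continuous_intros continuous_rate)

lemma norm_weight_le:
  assumes "\<beta> > 0" "norm e1 = 1" "norm e2 = 1" "norm u = 1"
  shows "norm (weight \<beta> e1 e2 m u t) \<le> (4 * \<beta>) ^ (m + 1) * cosh t ^ (m + 1)"
proof -
  have "norm (rate \<beta> t (u * e1)) \<le> 4 * \<beta> * cosh t" "norm (rate \<beta> t (u * e2)) \<le> 4 * \<beta> * cosh t"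
    using norm_rate_le[of \<beta> t "u * e1"] norm_rate_le[of \<beta> t "u * e2"] assms by (simp_all add: norm_mult)
  then have "norm (weight \<beta> e1 e2 m u t) \<le> (4 * \<beta> * cosh t) * (4 * \<beta> * cosh t) ^ m"
    unfolding weight_def norm_mult norm_power using assms(1) by (intro mult_mono power_mono) auto
  then show ?thesis by (simp add: power_mult_distrib mult_ac)
qed

locale potential_data =
  fixes \<beta> :: real and e1 e2 p0 p1 :: complex and m :: nat and T :: "(real \<Rightarrow> complex) \<Rightarrow> complex"
  assumes beta: "\<beta> > 0" and e: "norm e1 = 1" "norm e2 = 1" and T: "T \<in> E01_dual"
begin

abbreviation (input) "pot \<equiv> potential \<beta> e1 e2 m p0 p1 T"
abbreviation (input) "wt \<equiv> weight \<beta> e1 e2 m"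
abbreviation (input) "lay \<equiv> layer \<beta> p0 p1 T"

lemma potential_integrable:
  assumes "norm u = 1" "\<kappa> > 0" "separates u p0 p1 \<kappa> w"
  shows "integrable lborel (\<lambda>t. wt u t * lay u w t)"
  by (rule layer_integral(1)[OF T beta assms(1,2) _ weight_continuous norm_weight_le[OF beta e assms(1)]])
    (use assms(3) beta in \<open>auto simp: separates_def\<close>)

text \<open>The kernels are integrated over the ray before \<open>T\<close> is applied, so the ray can be turned for
  each point of the segment separately.\<close>

lemma potential_turn:
  assumes u: "norm u1 = 1" "norm u2 = 1" and k: "\<kappa> > 0"
    and s: "separates u1 p0 p1 \<kappa> w" "separates u2 p0 p1 \<kappa> w"
  shows "pot u1 w = pot u2 w"
proof -
  let ?I = "\<lambda>u x. LBINT t. wt u t * exp (wexp \<beta> t (u * (linepath p0 p1 x - w)))"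
  have pot: "pot u w = T (?I u)" "?I u \<in> E01" if "norm u = 1" "separates u p0 p1 \<kappa> w" for u
    unfolding potential_def
    by (rule layer_integral(2,3)[OF T beta that(1) k _ weight_continuous norm_weight_le[OF beta e that(1)]];
        use that(2) beta in \<open>auto simp: separates_def\<close>)+
  have "?I u1 x = ?I u2 x" if x: "x \<in> {0..1}" for x
  proof -
    have "\<kappa> \<le> Im (u1 * (w - linepath p0 p1 x))" "\<kappa> \<le> Im (u2 * (w - linepath p0 p1 x))"
      using s x unfolding separates_def by blast+
    with k have "Im (u1 * (w - linepath p0 p1 x)) > 0" "Im (u2 * (w - linepath p0 p1 x)) > 0"
      by linarith+
    from kernel_ray_integral_turn[OF beta u e this, of m]
    show ?thesis by (simp add: weight_def)
  qed
  then have "T (?I u1) = T (?I u2)" by (rule E01_dual_cong[OF T pot(2)[OF u(2) s(2)]])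
  then show ?thesis using pot(1)[OF u(1) s(1)] pot(1)[OF u(2) s(2)] by simp
qed

lemma potential_integrand_bound:
  "\<exists>C>0. \<exists>M. \<forall>u w t \<kappa>. norm u = 1 \<longrightarrow> \<kappa> > 0 \<longrightarrow> separates u p0 p1 \<kappa> w \<longrightarrow>
     norm (wt u t * lay u w t) \<le> C / \<kappa> ^ M / cosh t ^ 2"
proof -
  obtain C N where C: "C > 0" "\<And>u w t \<kappa>. norm u = 1 \<Longrightarrow> (\<forall>x\<in>{0..1}. \<kappa> \<le> Im (u * (w - linepath p0 p1 x))) \<Longrightarrow>
     norm (lay u w t) \<le> C * cosh t ^ N * exp (- (2 * \<beta> * \<kappa> * cosh t))"
    using layer_bound[OF T beta] by blast
  obtain K where K: "K > 0" "\<And>a t::real. a > 0 \<Longrightarrow> cosh t ^ (m + 1 + N) * exp (- (a * cosh t))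
      \<le> K / a ^ (m + 1 + N + 2) / cosh t ^ 2"
    using cosh_power_exp_le[of "m + 1 + N" 2] by blast
  define C' where "C' = (4 * \<beta>) ^ (m + 1) * C * (K / (2 * \<beta>) ^ (m + 1 + N + 2))"
  have C': "C' > 0" using beta C(1) K(1) by (simp add: C'_def)
  have "norm (wt u t * lay u w t) \<le> C' / \<kappa> ^ (m + 1 + N + 2) / cosh t ^ 2"
    if u: "norm u = 1" and k: "\<kappa> > 0" and s: "separates u p0 p1 \<kappa> w" for u w t \<kappa>
  proof -
    have "norm (wt u t * lay u w t) \<le> ((4 * \<beta>) ^ (m + 1) * cosh t ^ (m + 1)) * (C * cosh t ^ N * exp (- (2 * \<beta> * \<kappa> * cosh t)))"
      unfolding norm_mult using beta C(1)
      by (intro mult_mono norm_weight_le[OF beta e u] C(2)[OF u s[unfolded separates_def]]) auto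
    also have "\<dots> = (4 * \<beta>) ^ (m + 1) * C * (cosh t ^ (m + 1 + N) * exp (- (2 * \<beta> * \<kappa> * cosh t)))"
      by (simp only: power_add mult_ac)
    also have "\<dots> \<le> (4 * \<beta>) ^ (m + 1) * C * (K / (2 * \<beta> * \<kappa>) ^ (m + 1 + N + 2) / cosh t ^ 2)"
      using beta C(1) k by (intro mult_left_mono K) auto
    also have "\<dots> = C' / \<kappa> ^ (m + 1 + N + 2) / cosh t ^ 2"
      unfolding C'_def power_mult_distrib[of "2 * \<beta>"] by (simp only: times_divide_eq_right divide_divide_eq_left mult_ac)
    finally show ?thesis .
  qed
  then show ?thesis using C' by blast
qed

lemma potential_bound:
  "\<exists>C>0. \<exists>M. \<forall>u w \<kappa>. norm u = 1 \<longrightarrow> \<kappa> > 0 \<longrightarrow> separates u p0 p1 \<kappa> w \<longrightarrow>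
     norm (pot u w) \<le> C / \<kappa> ^ M"
proof -
  obtain C M where C: "C > 0" "\<And>u w t \<kappa>. norm u = 1 \<Longrightarrow> \<kappa> > 0 \<Longrightarrow> separates u p0 p1 \<kappa> w \<Longrightarrow>
     norm (wt u t * lay u w t) \<le> C / \<kappa> ^ M / cosh t ^ 2"
    using potential_integrand_bound by blast
  define c where "c = (LBINT t. 1 / cosh (t::real) ^ 2)"
  have c: "c \<ge> 0" by (simp add: c_def)
  have "norm (pot u w) \<le> (C * (c + 1)) / \<kappa> ^ M"
    if u: "norm u = 1" and k: "\<kappa> > 0" and s: "separates u p0 p1 \<kappa> w" for u w \<kappa>
  proof -
    have "norm (pot u w) \<le> (LBINT t. C / \<kappa> ^ M * (1 / cosh t ^ 2))"
      unfolding potential_def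
    proof (rule Bochner_Integration.integral_norm_bound_integral)
      show "norm (wt u t * lay u w t) \<le> C / \<kappa> ^ M * (1 / cosh t ^ 2)" for t
        using C(2)[OF u k s, of t] by simp
    qed (intro potential_integrable[OF u k s] integrable_mult_right integrable_inverse_cosh)+
    also have "\<dots> = C / \<kappa> ^ M * c" unfolding c_def by (rule integral_mult_right_zero)
    also have "\<dots> \<le> C / \<kappa> ^ M * (c + 1)" using C(1) k by (intro mult_left_mono) auto
    finally show ?thesis by simp
  qed
  moreover have "C * (c + 1) > 0" using C(1) c by simp
  ultimately show ?thesis by blast
qed

lemma potential_tendsto:
  assumes u: "norm u = 1" and k: "\<kappa> > 0"
    and s: "\<And>n. separates u p0 p1 \<kappa> (w n)" "separates u p0 p1 \<kappa> w0" and lim: "w \<longlonglongrightarrow> w0"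
  shows "(\<lambda>n. pot u (w n)) \<longlonglongrightarrow> pot u w0"
proof -
  obtain C M where C: "\<And>u w t \<kappa>. norm u = 1 \<Longrightarrow> \<kappa> > 0 \<Longrightarrow> separates u p0 p1 \<kappa> w \<Longrightarrow>
     norm (wt u t * lay u w t) \<le> C / \<kappa> ^ M / cosh t ^ 2"
    using potential_integrand_bound by blast
  show ?thesis
    unfolding potential_def
  proof (rule integral_dominated_convergence[where w = "\<lambda>t. C / \<kappa> ^ M * (1 / cosh t ^ 2)"])
    show "AE t in lborel. (\<lambda>n. wt u t * lay u (w n) t) \<longlonglongrightarrow> wt u t * lay u w0 t"
    proof (rule AE_I2)
      fix t
      have eq: "lay u (w n) t = exp (wexp \<beta> t (- (u * (w n - w0)))) * lay u w0 t" for n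
        using layer_shift[OF T, of \<beta> p0 p1 u w0 "w n - w0" t] by simp
      have c: "isCont (\<lambda>v. exp (wexp \<beta> t (- (u * (v - w0))))) w0"
        by (rule continuous_on_interior[of UNIV]) (auto intro!: continuous_intros continuous_wexp)
      have "(\<lambda>n. exp (wexp \<beta> t (- (u * (w n - w0))))) \<longlonglongrightarrow> exp (wexp \<beta> t (- (u * (w0 - w0))))"
        by (rule isCont_tendsto_compose[OF c lim])
      moreover have "wexp \<beta> t (- (u * (w0 - w0))) = 0" by (simp add: wexp_def complex_eq_iff)
      ultimately have "(\<lambda>n. exp (wexp \<beta> t (- (u * (w n - w0))))) \<longlonglongrightarrow> 1" by simp
      from tendsto_mult_left[OF tendsto_mult_right[OF this, of "lay u w0 t"], of "wt u t"]
      show "(\<lambda>n. wt u t * lay u (w n) t) \<longlonglongrightarrow> wt u t * lay u w0 t" unfolding eq by simp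
    qed
    show "AE t in lborel. norm (wt u t * lay u (w n) t) \<le> C / \<kappa> ^ M * (1 / cosh t ^ 2)" for n
      using C[OF u k s(1)] by (intro AE_I2) simp
    have "(\<lambda>t. wt u t * lay u w t) \<in> borel_measurable borel" for w
      by (intro borel_measurable_continuous_onI continuous_intros weight_continuous layer_continuous[OF T])
    then show "(\<lambda>t. wt u t * lay u w0 t) \<in> borel_measurable lborel"
      "(\<lambda>t. wt u t * lay u (w n) t) \<in> borel_measurable lborel" for n by simp_all
  qed (intro integrable_mult_right integrable_inverse_cosh)
qed

end

text \<open>The extensions by zero of members of \<open>S01\<close> satisfy this; flatness at the ends is what tames the
  corners, where the layer kernels are not integrable uniformly.\<close>

locale flat_function =
  fixes Z :: "real \<Rightarrow> complex"
  assumes Z_cont: "continuous_on UNIV Z"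
    and Z_zero: "\<And>x. x \<notin> {0<..<1} \<Longrightarrow> Z x = 0"
    and Z_flat: "\<And>m. \<exists>C\<ge>0. \<forall>x\<in>{0..1}. norm (Z x) \<le> C * (x ^ m * (1 - x) ^ m)"

text \<open>The setting of a curve over \<open>(0, 1)\<close> that may approach the segment at its two ends, but at most
  linearly, against a test function \<open>Z\<close>.\<close>

locale flat_pairing = potential_data + flat_function +
  fixes u :: complex and c :: real
  assumes u: "norm u = 1" and c: "c > 0"
begin

lemma pairing_continuous:
  assumes W: "continuous_on UNIV W" and s: "\<And>x. x \<in> {0..1} \<Longrightarrow> separates u p0 p1 (c * (x * (1 - x))) (W x)"
  shows "continuous_on {0<..<1} (\<lambda>x. potential \<beta> e1 e2 m p0 p1 T u (W x))"
  unfolding continuous_on_sequentially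
proof (intro allI ballI impI)
  fix X and a :: real assume a: "a \<in> {0<..<1}" and X: "(\<forall>n. X n \<in> {0<..<1}) \<and> X \<longlonglongrightarrow> a"
  let ?p = "\<lambda>x. x * (1 - x :: real)"
  have pa: "?p a > 0" using a by simp
  have "(\<lambda>n. ?p (X n)) \<longlonglongrightarrow> ?p a" using X by (intro tendsto_intros) auto
  then have "\<forall>\<^sub>F n in sequentially. ?p a / 2 < ?p (X n)"
    using pa by (intro order_tendstoD(1)) auto
  then obtain N where N: "\<And>n. n \<ge> N \<Longrightarrow> ?p a / 2 < ?p (X n)" by (auto simp: eventually_sequentially)
  have mono: "separates u p0 p1 (c * (?p a / 2)) (W x)" if "x \<in> {0..1}" "?p a / 2 \<le> ?p x" for x
  proof -
    have "c * (?p a / 2) \<le> c * ?p x" using that c by (intro mult_left_mono) auto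
    then show ?thesis using separates_mono[OF s[OF that(1)]] by blast
  qed
  have "(\<lambda>n. potential \<beta> e1 e2 m p0 p1 T u (W (X (n + N)))) \<longlonglongrightarrow> potential \<beta> e1 e2 m p0 p1 T u (W a)"
  proof (rule potential_tendsto[OF u, of "c * (?p a / 2)"])
    show "separates u p0 p1 (c * (?p a / 2)) (W (X (n + N)))" for n
      using X N[of "n + N"] by (intro mono) (auto intro: less_imp_le)
    show "separates u p0 p1 (c * (?p a / 2)) (W a)" using a pa by (intro mono) auto
    have "(\<lambda>n. X (n + N)) \<longlonglongrightarrow> a" using X by (intro LIMSEQ_ignore_initial_segment) auto
    then show "(\<lambda>n. W (X (n + N))) \<longlonglongrightarrow> W a"
      using W by (intro isCont_tendsto_compose[of _ W]) (auto simp: continuous_on_eq_continuous_at)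
  qed (use c pa in auto)
  then show "((\<lambda>x. potential \<beta> e1 e2 m p0 p1 T u (W x)) \<circ> X) \<longlonglongrightarrow> potential \<beta> e1 e2 m p0 p1 T u (W a)"
    unfolding o_def by (rule LIMSEQ_offset)
qed

text \<open>The potential is at most a constant times \<open>(x (1 - x))\<^sup>-\<^sup>M\<close>, and \<open>Z\<close> vanishes to order \<open>M\<close> at both ends.\<close>

lemma pairing_bound:
  "\<exists>B. \<forall>w x. x \<in> {0<..<1} \<longrightarrow> separates u p0 p1 (c * (x * (1 - x))) w \<longrightarrow>
     norm (potential \<beta> e1 e2 m p0 p1 T u w * Z x) \<le> B"
proof -
  obtain C M where C: "C > 0" "\<And>w \<kappa>. \<kappa> > 0 \<Longrightarrow> separates u p0 p1 \<kappa> w \<Longrightarrow>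
      norm (potential \<beta> e1 e2 m p0 p1 T u w) \<le> C / \<kappa> ^ M"
    using potential_bound u by blast
  obtain D where D: "D \<ge> 0" "\<And>x. x \<in> {0..1} \<Longrightarrow> norm (Z x) \<le> D * (x ^ M * (1 - x) ^ M)"
    using Z_flat by blast
  have "norm (potential \<beta> e1 e2 m p0 p1 T u w * Z x) \<le> C / c ^ M * D"
    if x: "x \<in> {0<..<1}" and s: "separates u p0 p1 (c * (x * (1 - x))) w" for w x
  proof -
    have p: "x * (1 - x) > 0" using x by simp
    have "norm (potential \<beta> e1 e2 m p0 p1 T u w * Z x) \<le> C / (c * (x * (1 - x))) ^ M * (D * (x ^ M * (1 - x) ^ M))"
      unfolding norm_mult using C D x p c s by (intro mult_mono) auto
    also have "\<dots> = C / c ^ M * D * ((x * (1 - x)) ^ M / (x * (1 - x)) ^ M)"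
      by (simp add: power_mult_distrib)
    also have "(x * (1 - x)) ^ M / (x * (1 - x)) ^ M = 1" by (rule divide_self) (use x in auto)
    finally show ?thesis by simp
  qed
  then show ?thesis by blast
qed

lemma pairing_measurable:
  assumes "continuous_on UNIV W" "\<And>x. x \<in> {0..1} \<Longrightarrow> separates u p0 p1 (c * (x * (1 - x))) (W x)"
  shows "(\<lambda>x. indicator {0<..<1} x *\<^sub>R (potential \<beta> e1 e2 m p0 p1 T u (W x) * Z x)) \<in> borel_measurable borel"
  by (intro borel_measurable_continuous_on_indicator continuous_intros pairing_continuous[OF assms]
      continuous_on_subset[OF Z_cont]) auto

lemma integrable_indicator_unit: "integrable lborel (\<lambda>x. indicator {0<..<1::real} x *\<^sub>R (B::real))"
  by (cases "B = 0") (auto intro!: integrable_indicator)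

lemma pairing_integrable:
  assumes "continuous_on UNIV W" "\<And>x. x \<in> {0..1} \<Longrightarrow> separates u p0 p1 (c * (x * (1 - x))) (W x)"
  shows "set_integrable lborel {0<..<1} (\<lambda>x. potential \<beta> e1 e2 m p0 p1 T u (W x) * Z x)"
proof -
  obtain B where B: "\<And>w x. x \<in> {0<..<1} \<Longrightarrow> separates u p0 p1 (c * (x * (1 - x))) w \<Longrightarrow>
     norm (potential \<beta> e1 e2 m p0 p1 T u w * Z x) \<le> B" using pairing_bound by blast
  show ?thesis
    unfolding set_integrable_def
  proof (rule Bochner_Integration.integrable_bound[OF integrable_indicator_unit[of B]])
    show "AE x in lborel. norm (indicator {0<..<1} x *\<^sub>R (potential \<beta> e1 e2 m p0 p1 T u (W x) * Z x))
        \<le> norm (indicator {0<..<1::real} x *\<^sub>R B)"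
    proof (rule AE_I2)
      fix x :: real
      show "norm (indicator {0<..<1} x *\<^sub>R (potential \<beta> e1 e2 m p0 p1 T u (W x) * Z x))
        \<le> norm (indicator {0<..<1::real} x *\<^sub>R B)"
        using B[of x "W x"] assms(2)[of x] by (cases "x \<in> {0<..<1}") auto
    qed
  qed (use pairing_measurable[OF assms] in simp)
qed

lemma pairing_tendsto:
  assumes W: "\<And>n. continuous_on UNIV (W n)" "continuous_on UNIV W0"
    and s: "\<And>n x. x \<in> {0..1} \<Longrightarrow> separates u p0 p1 (c * (x * (1 - x))) (W n x)"
    and lim: "\<And>x. (\<lambda>n. W n x) \<longlonglongrightarrow> W0 x"
  shows "(\<lambda>n. LBINT x:{0<..<1}. potential \<beta> e1 e2 m p0 p1 T u (W n x) * Z x)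
    \<longlonglongrightarrow> (LBINT x:{0<..<1}. potential \<beta> e1 e2 m p0 p1 T u (W0 x) * Z x)"
proof -
  have s0: "separates u p0 p1 (c * (x * (1 - x))) (W0 x)" if x: "x \<in> {0..1}" for x
    unfolding separates_def
  proof
    fix y :: real assume y: "y \<in> {0..1}"
    have "(\<lambda>n. Im (u * (W n x - linepath p0 p1 y))) \<longlonglongrightarrow> Im (u * (W0 x - linepath p0 p1 y))"
      by (intro tendsto_intros lim)
    then show "c * (x * (1 - x)) \<le> Im (u * (W0 x - linepath p0 p1 y))"
      by (rule LIMSEQ_le_const) (use s[OF x] y in \<open>auto simp: separates_def\<close>)
  qed
  obtain B where B: "\<And>w x. x \<in> {0<..<1} \<Longrightarrow> separates u p0 p1 (c * (x * (1 - x))) w \<Longrightarrow>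
     norm (potential \<beta> e1 e2 m p0 p1 T u w * Z x) \<le> B" using pairing_bound by blast
  show ?thesis
    unfolding set_lebesgue_integral_def
  proof (rule integral_dominated_convergence[where w = "\<lambda>x. indicator {0<..<1::real} x *\<^sub>R B"])
    show "AE x in lborel. (\<lambda>n. indicator {0<..<1} x *\<^sub>R (potential \<beta> e1 e2 m p0 p1 T u (W n x) * Z x))
        \<longlonglongrightarrow> indicator {0<..<1} x *\<^sub>R (potential \<beta> e1 e2 m p0 p1 T u (W0 x) * Z x)"
    proof (rule AE_I2)
      fix x :: real
      show "(\<lambda>n. indicator {0<..<1} x *\<^sub>R (potential \<beta> e1 e2 m p0 p1 T u (W n x) * Z x))
        \<longlonglongrightarrow> indicator {0<..<1} x *\<^sub>R (potential \<beta> e1 e2 m p0 p1 T u (W0 x) * Z x)"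
      proof (cases "x \<in> {0<..<1}")
        case True
        then have "c * (x * (1 - x)) > 0" using c by simp
        from potential_tendsto[OF u this s s0 lim] True
        show ?thesis by (intro tendsto_intros) auto
      qed simp
    qed
    show "AE x in lborel. norm (indicator {0<..<1} x *\<^sub>R (potential \<beta> e1 e2 m p0 p1 T u (W n x) * Z x))
        \<le> indicator {0<..<1::real} x *\<^sub>R B" for n
    proof (rule AE_I2)
      fix x :: real
      show "norm (indicator {0<..<1} x *\<^sub>R (potential \<beta> e1 e2 m p0 p1 T u (W n x) * Z x))
        \<le> indicator {0<..<1::real} x *\<^sub>R B"
        using B[of x "W n x"] s[of x n] by (cases "x \<in> {0<..<1}") auto
    qed
  qed (use pairing_measurable[OF W(2) s0] pairing_measurable[OF W(1) s] integrable_indicator_unit in simp_all)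
qed

end

section \<open>The potential of the side itself\<close>

text \<open>Rapid decay in \<open>\<xi> = b sinh t\<close> is decay faster than every power of \<open>cosh t\<close>, uniformly for \<open>b\<close> away
  from \<open>0\<close>.\<close>

lemma rapid_cosh:
  fixes f :: "real \<Rightarrow> complex"
  assumes f: "\<And>\<xi>. norm (f \<xi>) * (1 + \<xi>\<^sup>2) ^ (N + 2) \<le> C" and a: "a > 0" "\<bar>b\<bar> \<ge> a"
  shows "cosh t ^ N * norm (f (b * sinh t)) \<le> C / (min 1 (a\<^sup>2)) ^ (N + 2) / cosh t ^ 2"
proof -
  define q where "q = min 1 (a\<^sup>2)"
  have q: "q > 0" using a by (simp add: q_def)
  have "a\<^sup>2 \<le> b\<^sup>2" using power_mono[of a "\<bar>b\<bar>" 2] a by simp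
  then have "q * sinh t ^ 2 \<le> b\<^sup>2 * sinh t ^ 2" by (intro mult_right_mono) (auto simp: q_def)
  then have "q * cosh t ^ 2 \<le> 1 + (b * sinh t)\<^sup>2"
    unfolding cosh_square_eq by (simp add: power_mult_distrib algebra_simps q_def)
  then have "(q * cosh t ^ 2) ^ (N + 2) \<le> (1 + (b * sinh t)\<^sup>2) ^ (N + 2)" using q by (intro power_mono) auto
  then have "norm (f (b * sinh t)) * (q * cosh t ^ 2) ^ (N + 2) \<le> norm (f (b * sinh t)) * (1 + (b * sinh t)\<^sup>2) ^ (N + 2)"
    by (rule mult_left_mono) simp
  also have "\<dots> \<le> C" by (rule f)
  finally have 1: "norm (f (b * sinh t)) * (q ^ (N + 2) * cosh t ^ (2 * (N + 2))) \<le> C"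
    by (simp only: power_mult_distrib power_mult)
  have "cosh t ^ N * cosh t ^ 2 \<le> cosh t ^ (2 * (N + 2))"
    unfolding power_add[symmetric] by (intro power_increasing cosh_real_ge_1) simp
  then have "norm (f (b * sinh t)) * (q ^ (N + 2) * (cosh t ^ N * cosh t ^ 2))
      \<le> norm (f (b * sinh t)) * (q ^ (N + 2) * cosh t ^ (2 * (N + 2)))"
    using q by (intro mult_left_mono) auto
  with 1 have "norm (f (b * sinh t)) * (q ^ (N + 2) * (cosh t ^ N * cosh t ^ 2)) \<le> C" by linarith
  then have "cosh t ^ N * norm (f (b * sinh t)) * (cosh t ^ 2 * q ^ (N + 2)) \<le> C" by (simp only: mult_ac)
  moreover have "cosh t ^ 2 * q ^ (N + 2) > 0" using q by simp
  ultimately have "cosh t ^ N * norm (f (b * sinh t)) \<le> C / (cosh t ^ 2 * q ^ (N + 2))"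
    by (simp add: pos_le_divide_eq)
  then show ?thesis unfolding q_def[symmetric] by (simp add: mult.commute)
qed

lemma integrable_inverse_1_plus_square: "integrable lborel (\<lambda>x::real. 1 / (1 + x\<^sup>2))"
proof -
  have "set_integrable lborel (einterval (- \<infinity>) \<infinity>) (\<lambda>x::real. 1 / (1 + x\<^sup>2))"
  proof (rule interval_integral_FTC_nonneg)
    show "DERIV arctan x :> 1 / (1 + x\<^sup>2)" for x
      using DERIV_arctan[of x] by (simp add: inverse_eq_divide)
    show "((arctan \<circ> real_of_ereal) \<longlongrightarrow> pi / 2) (at_left \<infinity>)"
      unfolding ereal_tendsto_simps by (rule tendsto_arctan_at_top)
    show "((arctan \<circ> real_of_ereal) \<longlongrightarrow> - (pi / 2)) (at_right (- \<infinity>))"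
      unfolding ereal_tendsto_simps by (rule tendsto_arctan_at_bot)
    have "1 + x\<^sup>2 \<noteq> 0" for x :: real by (metis add_pos_nonneg less_numeral_extra(1,3) zero_le_power2)
    then show "isCont (\<lambda>x. 1 / (1 + x\<^sup>2)) x" for x :: real by (intro continuous_intros)
  qed auto
  then show ?thesis by (simp add: set_integrable_def)
qed

locale own_side = flat_function +
  fixes \<beta> L :: real and A e :: complex and T :: "(real \<Rightarrow> complex) \<Rightarrow> complex"
  assumes beta: "\<beta> > 0" and L: "L > 0" and e: "norm e = 1" and T: "T \<in> E01_dual"
    and rapid: "\<And>m. \<exists>C\<ge>0. \<forall>\<xi>. norm (fourier Z \<xi>) * (1 + \<xi>\<^sup>2) ^ m \<le> C"
    and Z_E01: "Z \<in> E01"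
begin

abbreviation (input) "B \<equiv> A + complex_of_real L * e"
abbreviation (input) "place \<equiv> \<lambda>x y. A + e * Complex x y"

lemma cnj_e_e: "cnj e * e = 1" "e * cnj e = 1"
  using complex_norm_square[of e] e by (simp_all add: mult.commute)

lemma local_coordinates: "cnj e * (linepath A B x - place X y) = Complex (x * L - X) (- y)"
proof -
  have "linepath A B x - place X y = e * Complex (x * L - X) (- y)"
    by (simp add: linepath_def scaleR_conv_of_real complex_eq_iff algebra_simps)
  then have "cnj e * (linepath A B x - place X y) = (cnj e * e) * Complex (x * L - X) (- y)"
    by (simp only: mult.assoc)
  then show ?thesis by (simp only: cnj_e_e mult_1_left)
qed

text \<open>Reflection in the side and reversal \<open>t \<mapsto> - t\<close> of the ray leave the kernel unchanged but turn
  each factor \<open>\<mu> e + \<beta>\<^sup>2 / (\<mu> e)\<close> into its negative: the normal derivative of a single layer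
  potential is odd under reflection, that of a double layer potential is even.\<close>

lemma potential_reflect:
  "potential \<beta> e e m A B T (- cnj e) (place X (- y)) = (- 1) ^ (m + 1) * potential \<beta> e e m A B T (cnj e) (place X y)"
proof -
  have neg: "- cnj e * q = - (cnj e * q)" for q by simp
  have wexp_neg: "wexp \<beta> t (- Complex a (- (- y))) = wexp \<beta> (- t) (Complex a (- y))" for a t
    by (simp add: wexp_def complex_eq_iff)
  have "layer \<beta> A B T (- cnj e) (place X (- y)) t = layer \<beta> A B T (cnj e) (place X y) (- t)" for t
    unfolding layer_def neg local_coordinates wexp_neg ..
  moreover have "weight \<beta> e e m (- cnj e) t = (- 1) ^ (m + 1) * weight \<beta> e e m (cnj e) (- t)" for t
  proof -
    have "rate \<beta> t (- cnj e * e) = - rate \<beta> (- t) (cnj e * e)"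
      unfolding neg cnj_e_e by (simp add: rate_def complex_eq_iff)
    then show ?thesis unfolding weight_def by (simp add: power_minus[of "rate \<beta> (- t) (cnj e * e)"])
  qed
  ultimately have "potential \<beta> e e m A B T (- cnj e) (place X (- y))
     = (LBINT t. (- 1) ^ (m + 1) * (weight \<beta> e e m (cnj e) (0 + - 1 * t) * layer \<beta> A B T (cnj e) (place X y) (0 + - 1 * t)))"
    unfolding potential_def by (simp add: mult.assoc)
  also have "\<dots> = (- 1) ^ (m + 1) * (LBINT t. weight \<beta> e e m (cnj e) (0 + - 1 * t) * layer \<beta> A B T (cnj e) (place X y) (0 + - 1 * t))"
    by (rule integral_mult_right_zero)
  also have "(LBINT t. weight \<beta> e e m (cnj e) (0 + - 1 * t) * layer \<beta> A B T (cnj e) (place X y) (0 + - 1 * t))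
     = potential \<beta> e e m A B T (cnj e) (place X y)"
    unfolding potential_def
    using lborel_integral_real_affine[of "- 1" "\<lambda>t. weight \<beta> e e m (cnj e) t * layer \<beta> A B T (cnj e) (place X y) t" 0]
    by simp
  finally show ?thesis .
qed

text \<open>By \<open>layer_own\<close> the layer of side \<open>i\<close> at any point is this function of \<open>t\<close> times a scalar.\<close>

definition base :: "real \<Rightarrow> complex" where "base t = layer \<beta> A B T (cnj e) A t"

lemma base_continuous: "continuous_on S base"
  unfolding base_def using continuous_on_subset[OF layer_continuous[OF T]] by blast

lemma base_bound: "\<exists>C>0. \<exists>N. \<forall>t. norm (base t) \<le> C * cosh t ^ N"
proof -
  obtain C N where C: "C > 0" "\<And>u w t \<kappa>. norm u = 1 \<Longrightarrow> (\<forall>x\<in>{0..1}. \<kappa> \<le> Im (u * (w - linepath A B x))) \<Longrightarrow>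
     norm (layer \<beta> A B T u w t) \<le> C * cosh t ^ N * exp (- (2 * \<beta> * \<kappa> * cosh t))"
    using layer_bound[OF T beta] by blast
  have "Im (cnj e * (A - linepath A B x)) = 0" for x
  proof -
    have "cnj e * (A - linepath A B x) = - (cnj e * (linepath A B x - place 0 0))" by (simp add: complex_eq_iff algebra_simps)
    then show ?thesis unfolding local_coordinates by simp
  qed
  then have "norm (base t) \<le> C * cosh t ^ N" for t
    using C(2)[of "cnj e" 0 A t] e unfolding base_def by simp
  then show ?thesis using C(1) by blast
qed

lemma layer_own: "layer \<beta> A B T (cnj e) (place X y) t
    = complex_of_real (exp (- (2 * \<beta> * y * cosh t))) * cis (2 * \<beta> * sinh t * X) * base t"
proof -
  have *: "cnj e * (e * Complex X y) = Complex X y"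
    by (simp only: mult.assoc[symmetric] cnj_e_e mult_1_left)
  have "layer \<beta> A B T (cnj e) (place X y) t = exp (wexp \<beta> t (- Complex X y)) * base t"
    unfolding base_def layer_shift[OF T] * ..
  moreover have "exp (wexp \<beta> t (- Complex X y)) = complex_of_real (exp (- (2 * \<beta> * y * cosh t))) * cis (2 * \<beta> * sinh t * X)"
    unfolding exp_eq_polar wexp_def by (simp add: mult_ac)
  ultimately show ?thesis by simp
qed

lemma weight_own: "weight \<beta> e e 0 (cnj e) t = complex_of_real (2 * \<beta> * cosh t)"
  unfolding weight_def cnj_e_e by (simp add: rate_def complex_eq_iff)

lemma Z_integrable: "integrable lborel Z" by (rule integrable_supported[OF Z_cont Z_zero])

text \<open>The integrand over the ray once the pairing in \<open>x\<close> has been carried out first; that integration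
  produces the Fourier transform.\<close>

definition swapped_density :: "real \<Rightarrow> real \<Rightarrow> real \<Rightarrow> real \<Rightarrow> complex" where
  "swapped_density y x0 l t = complex_of_real (2 * \<beta> * cosh t * exp (- (2 * \<beta> * y * cosh t)))
     * cis (2 * \<beta> * sinh t * x0) * base t * fourier Z (2 * \<beta> * l * sinh t)"

lemma pairing_eq:
  assumes y: "y > 0"
  shows "(LBINT x:{0<..<1}. potential \<beta> e e 0 A B T (cnj e) (place (x0 + x * l) y) * Z x)
      = (LBINT t. swapped_density y x0 l t)" (is ?eq)
    and "set_integrable lborel {0<..<1} (\<lambda>x. potential \<beta> e e 0 A B T (cnj e) (place (x0 + x * l) y) * Z x)" (is ?int)
proof -
  define f where "f x t = Z x * (complex_of_real (2 * \<beta> * cosh t) *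
     (complex_of_real (exp (- (2 * \<beta> * y * cosh t))) * cis (2 * \<beta> * sinh t * (x0 + x * l)) * base t))" for x t
  obtain C N where C: "C > 0" "\<And>t. norm (base t) \<le> C * cosh t ^ N" using base_bound by blast
  obtain K where K: "\<And>t. cosh t ^ (N + 1) * exp (- (2 * \<beta> * y * cosh t)) \<le> K / (2 * \<beta> * y) ^ (N + 1 + 2) / cosh t ^ 2"
  proof -
    have "2 * \<beta> * y > 0" using beta y by simp
    then show ?thesis using that cosh_power_exp_le[of "N + 1" 2] by blast
  qed
  define b where "b t = 2 * \<beta> * C * (K / (2 * \<beta> * y) ^ (N + 1 + 2)) * (1 / cosh t ^ 2)" for t :: real
  have meas: "(\<lambda>(x, t). f x t) \<in> borel_measurable (lborel \<Otimes>\<^sub>M lborel)"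
  proof (rule borel_measurable_pair_continuous)
    have "continuous_on UNIV (\<lambda>p::real \<times> real. Z (fst p))" "continuous_on UNIV (\<lambda>p::real \<times> real. base (snd p))"
      by (rule continuous_on_compose2[OF Z_cont], auto intro: continuous_intros)
         (rule continuous_on_compose2[OF base_continuous[of UNIV]], auto intro: continuous_intros)
    then show "continuous_on UNIV (\<lambda>(x, t). f x t)"
      unfolding f_def case_prod_unfold by (intro continuous_intros)
  qed
  have bound: "norm (f x t) \<le> norm (Z x) * b t" for x t
  proof -
    have "norm (f x t) = norm (Z x) * (2 * \<beta> * cosh t * (exp (- (2 * \<beta> * y * cosh t)) * norm (base t)))"
      using beta unfolding f_def by (simp add: norm_mult)
    also have "\<dots> \<le> norm (Z x) * (2 * \<beta> * cosh t * (exp (- (2 * \<beta> * y * cosh t)) * (C * cosh t ^ N)))"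
      using beta by (intro mult_left_mono C) auto
    also have "\<dots> = norm (Z x) * (2 * \<beta> * C * (cosh t ^ (N + 1) * exp (- (2 * \<beta> * y * cosh t))))"
      by (simp add: mult_ac)
    also have "\<dots> \<le> norm (Z x) * (2 * \<beta> * C * (K / (2 * \<beta> * y) ^ (N + 1 + 2) / cosh t ^ 2))"
      using beta C(1) by (intro mult_left_mono K) auto
    finally show ?thesis unfolding b_def by (simp only: times_divide_eq_right mult_1_right)
  qed
  have int: "integrable lborel (\<lambda>x. norm (Z x))" "integrable lborel b"
    using Z_integrable unfolding b_def
    by (simp, intro integrable_mult_right integrable_inverse_cosh)
  note Fub = Fubini_dominated[OF meas int bound]
  have inner: "(LBINT t. f x t) = indicator {0<..<1} x *\<^sub>R (potential \<beta> e e 0 A B T (cnj e) (place (x0 + x * l) y) * Z x)" for x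
  proof -
    have "(LBINT t. f x t) = Z x * potential \<beta> e e 0 A B T (cnj e) (place (x0 + x * l) y)"
      unfolding f_def potential_def layer_own weight_own by (rule integral_mult_right_zero)
    then show ?thesis using Z_zero[of x] by (cases "x \<in> {0<..<1}") (auto simp: mult.commute)
  qed
  show ?int using Fub(2) unfolding set_integrable_def inner .
  have "(LBINT x. f x t) = swapped_density y x0 l t" for t
  proof -
    have "cis (2 * \<beta> * sinh t * (x0 + x * l)) = cis (2 * \<beta> * sinh t * x0) * cis (2 * \<beta> * l * sinh t * x)" for x
      by (simp add: cis_mult algebra_simps)
    then have "f x t = (complex_of_real (2 * \<beta> * cosh t * exp (- (2 * \<beta> * y * cosh t))) * cis (2 * \<beta> * sinh t * x0) * base t)
        * (Z x * cis (2 * \<beta> * l * sinh t * x))" for x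
      unfolding f_def by simp
    then show ?thesis unfolding swapped_density_def fourier_def by (simp only: integral_mult_right_zero)
  qed
  then show ?eq using Fub(1) unfolding inner set_lebesgue_integral_def by simp
qed

lemma swapped_density_continuous: "continuous_on UNIV (swapped_density y x0 l)"
proof -
  have "continuous_on UNIV (fourier Z)" by (rule fourier_continuous[OF Z_cont Z_zero])
  then have "continuous_on UNIV (\<lambda>t. fourier Z (2 * \<beta> * l * sinh t))"
    by (rule continuous_on_compose2) (auto intro!: continuous_intros)
  then show ?thesis unfolding swapped_density_def by (intro continuous_intros base_continuous)
qed

text \<open>The functional is pulled out of the ray integral. Under it, \<open>s = 2 \<beta> L sinh t\<close> turns the integral into the
  inversion formula, the weight \<open>cosh t\<close> being the Jacobian.\<close>

lemma own_limit_integral: "(LBINT t. swapped_density 0 0 L t) = 2 * pi / L * T Z"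
proof -
  define a where "a t = Complex 0 (- (2 * \<beta> * L * sinh t))" for t
  define h where "h t = complex_of_real (2 * \<beta> * cosh t) * fourier Z (2 * \<beta> * L * sinh t)" for t
  define F where "F k t x = h t * a t ^ k * exp (0 + complex_of_real x * a t)" for k t and x :: real
  have fc: "continuous_on UNIV (fourier Z)" by (rule fourier_continuous[OF Z_cont Z_zero])
  have hc: "continuous_on UNIV h"
    unfolding h_def by (intro continuous_intros continuous_on_compose2[OF fc]) auto
  have ac: "continuous_on S a" for S unfolding a_def by (intro continuous_Complex continuous_intros)
  have na: "norm (a t) \<le> 2 * \<beta> * L * cosh t" for t
  proof -
    have "norm (Complex 0 r) = \<bar>r\<bar>" for r by (simp add: cmod_def)
    then have "norm (a t) = 2 * \<beta> * L * \<bar>sinh t\<bar>" using beta L by (simp add: a_def abs_mult)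
    also have "\<dots> \<le> 2 * \<beta> * L * cosh t" using beta L abs_sinh_le by (intro mult_left_mono) auto
    finally show ?thesis .
  qed
  have bL: "2 * \<beta> * L > 0" using beta L by simp
  have base: "T (\<lambda>x. exp (complex_of_real x * a t)) = base t" for t
  proof -
    have "cnj e * (linepath A B x - A) = Complex (x * L) 0" for x
    proof -
      have "Complex 0 0 = 0" by (simp add: complex_eq_iff)
      then show ?thesis using local_coordinates[of x 0 0] by simp
    qed
    moreover have "wexp \<beta> t (Complex (x * L) 0) = complex_of_real x * a t" for x
      by (simp add: wexp_def a_def complex_eq_iff)
    ultimately have "exp (wexp \<beta> t (cnj e * (linepath A B x - A))) = exp (complex_of_real x * a t)" for x
      by simp
    then show ?thesis unfolding base_def layer_def by simp
  qed
  have "\<exists>K. \<forall>t. cosh t ^ (k + 1) * norm (fourier Z (2 * \<beta> * L * sinh t)) \<le> K / cosh t ^ 2" for k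
  proof -
    obtain C where C: "\<And>\<xi>. norm (fourier Z \<xi>) * (1 + \<xi>\<^sup>2) ^ (k + 1 + 2) \<le> C" using rapid by blast
    show ?thesis
      by (intro exI[of _ "C / (min 1 ((2 * \<beta> * L)\<^sup>2)) ^ (k + 1 + 2)"] allI rapid_cosh[OF C bL])
        (rule abs_ge_self)
  qed
  then obtain K where K: "\<And>k t. cosh t ^ (k + 1) * norm (fourier Z (2 * \<beta> * L * sinh t)) \<le> K k / cosh t ^ 2" by metis
  define g where "g k t = 2 * \<beta> * (2 * \<beta> * L) ^ k * K k * (1 / cosh t ^ 2)" for k and t :: real
  have bound: "norm (F k t x) \<le> g k t" for k t x
  proof -
    have n1: "norm (exp (0 + complex_of_real x * a t)) = 1" by (simp add: a_def)
    have n2: "norm (complex_of_real (2 * \<beta> * cosh t)) = 2 * \<beta> * cosh t"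
      unfolding norm_of_real using beta by simp
    have "norm (F k t x) = 2 * \<beta> * cosh t * norm (fourier Z (2 * \<beta> * L * sinh t)) * norm (a t) ^ k"
      unfolding F_def h_def norm_mult[of _ "exp _"] norm_mult[of _ "_ ^ k"] norm_mult[of _ "fourier Z _"] norm_power n1 n2
      by (rule mult_1_right)
    also have "\<dots> \<le> 2 * \<beta> * cosh t * norm (fourier Z (2 * \<beta> * L * sinh t)) * (2 * \<beta> * L * cosh t) ^ k"
      using beta by (intro mult_left_mono power_mono na) auto
    also have "\<dots> = 2 * \<beta> * (2 * \<beta> * L) ^ k * (cosh t ^ (k + 1) * norm (fourier Z (2 * \<beta> * L * sinh t)))"
      by (simp add: power_mult_distrib mult_ac)
    also have "\<dots> \<le> 2 * \<beta> * (2 * \<beta> * L) ^ k * (K k / cosh t ^ 2)"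
      using beta L by (intro mult_left_mono K) auto
    finally show ?thesis by (simp add: g_def)
  qed
  have gi: "integrable lborel (g k)" for k
    unfolding g_def by (intro integrable_mult_right integrable_inverse_cosh)
  have tower: "deriv_tower {0..1} (\<lambda>k. F k t)" for t unfolding F_def by (rule exp_deriv_tower)
  have cont: "continuous_on (UNIV \<times> {0..1}) (\<lambda>(t, x). F k t x)" for k
  proof -
    have "continuous_on (UNIV \<times> {0..1::real}) (\<lambda>p. h (fst p))" "continuous_on (UNIV \<times> {0..1::real}) (\<lambda>p. a (fst p))"
      by (rule continuous_on_compose2[OF hc], auto intro: continuous_intros)
         (rule continuous_on_compose2[OF ac[of UNIV]], auto intro: continuous_intros)
    then show ?thesis unfolding F_def case_prod_unfold by (intro continuous_intros)
  qed
  have F0: "F 0 t = (\<lambda>x. h t * exp (complex_of_real x * a t))" for t unfolding F_def by simp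
  have TF0: "T (F 0 t) = h t * base t" for t
  proof -
    have "(\<lambda>x. exp (complex_of_real x * a t)) \<in> E01"
      by (rule E01_tower[OF exp_deriv_tower[of _ 1 "a t" 0]]) simp
    from E01_dual_cmult[OF T this] show ?thesis unfolding F0 base by simp
  qed
  have "swapped_density 0 0 L t = T (F 0 t)" for t unfolding TF0 h_def swapped_density_def by simp
  then have "(LBINT t. swapped_density 0 0 L t) = (LBINT t. T (F 0 t))" by simp
  also have "\<dots> = T (\<lambda>x. LBINT t. F 0 t x)"
    using E01_dual_integral(2)[OF T tower cont bound gi] by simp
  also have "(\<lambda>x. LBINT t. F 0 t x) = (\<lambda>x. 2 * pi / L * Z x)"
  proof
    fix x :: real
    have fint: "integrable lborel (fourier Z)"
    proof -
      obtain C where C: "\<And>\<xi>. norm (fourier Z \<xi>) * (1 + \<xi>\<^sup>2) ^ 1 \<le> C" using rapid by blast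
      show ?thesis
      proof (rule Bochner_Integration.integrable_bound)
        show "integrable lborel (\<lambda>\<xi>::real. C * (1 / (1 + \<xi>\<^sup>2)))"
          by (intro integrable_mult_right integrable_inverse_1_plus_square)
        show "fourier Z \<in> borel_measurable lborel" using borel_measurable_continuous_onI[OF fc] by simp
        have "norm (fourier Z \<xi>) \<le> C * (1 / (1 + \<xi>\<^sup>2))" for \<xi>
        proof -
          have "1 + \<xi>\<^sup>2 > 0" by (simp add: add_pos_nonneg)
          then show ?thesis using C[of \<xi>] by (simp add: pos_le_divide_eq)
        qed
        then show "AE \<xi> in lborel. norm (fourier Z \<xi>) \<le> norm (C * (1 / (1 + \<xi>\<^sup>2)))"
          by (intro AE_I2) (metis abs_ge_self order_trans real_norm_def)
      qed
    qed
    have expa: "exp (complex_of_real x * a t) = cis (- (2 * \<beta> * L * sinh t) * x)" for t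
      unfolding cis_conv_exp a_def by (simp add: complex_eq_iff mult_ac Re_exp Im_exp)
    have eqF: "F 0 t x = complex_of_real (1 / L) * ((2 * \<beta> * L * cosh t) *\<^sub>R
        (fourier Z (2 * \<beta> * L * sinh t) * cis (- (2 * \<beta> * L * sinh t) * x)))" for t
      unfolding F0 expa h_def using L by (simp add: scaleR_conv_of_real)
    have "(LBINT t. (2 * \<beta> * L * cosh t) *\<^sub>R (fourier Z (2 * \<beta> * L * sinh t) * cis (- (2 * \<beta> * L * sinh t) * x)))
       = (LBINT s. indicator UNIV s *\<^sub>R (fourier Z s * cis (- s * x)))"
    proof (rule integral_substitution_line)
      show "((\<lambda>t. 2 * \<beta> * L * sinh t) has_real_derivative 2 * \<beta> * L * cosh t) (at t)" for t
        by (auto intro!: derivative_eq_intros)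
      show "0 < 2 * \<beta> * L * cosh t" for t using bL by simp
      show "range (\<lambda>t. 2 * \<beta> * L * sinh t) = UNIV"
      proof (rule surjI[of _ "\<lambda>s. arsinh (s / (2 * \<beta> * L))"])
        show "2 * \<beta> * L * sinh (arsinh (s / (2 * \<beta> * L))) = s" for s
        proof -
          have "c * sinh (arsinh (s / c)) = s" if "c > 0" for c using that by simp
          from this[OF bL] show ?thesis .
        qed
      qed
      show "(\<lambda>s. fourier Z s * cis (- s * x)) \<in> borel_measurable borel"
        by (intro borel_measurable_continuous_onI continuous_intros fc)
      have Fc: "continuous_on UNIV (\<lambda>t. F 0 t x)"
        unfolding F0 by (intro continuous_intros hc ac)
      have "integrable lborel (\<lambda>t. F 0 t x)"
        by (rule Bochner_Integration.integrable_bound[OF gi[of 0]])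
          (use borel_measurable_continuous_onI[OF Fc] order_trans[OF bound[of 0] abs_ge_self] in auto)
      then have "integrable lborel (\<lambda>t. complex_of_real L * F 0 t x)" by simp
      then show "integrable lborel (\<lambda>t. (2 * \<beta> * L * cosh t) *\<^sub>R (fourier Z (2 * \<beta> * L * sinh t) * cis (- (2 * \<beta> * L * sinh t) * x)))"
        unfolding eqF using L by (simp add: mult.assoc[symmetric] del: of_real_mult)
    qed simp
    also have "\<dots> = 2 * pi * Z x" using fourier_inversion[OF Z_cont Z_zero fint, of x] by simp
    finally show "(LBINT t. F 0 t x) = 2 * pi / L * Z x"
      unfolding eqF integral_mult_right_zero by simp
  qed
  also have "T (\<lambda>x. 2 * pi / L * Z x) = 2 * pi / L * T Z" by (rule E01_dual_cmult[OF T Z_E01])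
  finally show ?thesis .
qed

text \<open>The factor \<open>exp (- 2 \<beta> \<epsilon> cosh t)\<close> tends to \<open>1\<close>; in the limit the decay of the Fourier transform takes over as
  the source of convergence, since \<open>base\<close> grows at most like a power of \<open>cosh t\<close>.\<close>

lemma own_side_tendsto:
  assumes \<epsilon>: "\<And>n. \<epsilon> n > 0" "\<epsilon> \<longlonglongrightarrow> 0" and l: "\<And>n. l n \<ge> L / 2" "l \<longlonglongrightarrow> L" and x0: "x0 \<longlonglongrightarrow> 0"
  shows "(\<lambda>n. LBINT x:{0<..<1}. potential \<beta> e e 0 A B T (cnj e) (place (x0 n + x * l n) (\<epsilon> n)) * Z x)
     \<longlonglongrightarrow> 2 * pi / L * T Z"
  unfolding pairing_eq(1)[OF \<epsilon>(1)] own_limit_integral[symmetric]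
proof -
  have fc: "continuous_on UNIV (fourier Z)" by (rule fourier_continuous[OF Z_cont Z_zero])
  obtain C N where C: "C > 0" "\<And>t. norm (base t) \<le> C * cosh t ^ N" using base_bound by blast
  obtain D where D: "\<And>\<xi>. norm (fourier Z \<xi>) * (1 + \<xi>\<^sup>2) ^ (N + 1 + 2) \<le> D" using rapid by blast
  have bL: "\<beta> * L > 0" using beta L by simp
  define K where "K = D / (min 1 ((\<beta> * L)\<^sup>2)) ^ (N + 1 + 2)"
  have K: "cosh t ^ (N + 1) * norm (fourier Z (2 * \<beta> * l n * sinh t)) \<le> K / cosh t ^ 2" for n t
    unfolding K_def
  proof (rule rapid_cosh[OF D bL])
    have "\<beta> * L \<le> 2 * \<beta> * l n" using l(1)[of n] beta by simp
    then show "\<beta> * L \<le> \<bar>2 * \<beta> * l n\<bar>" by linarith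
  qed
  have m: "swapped_density y x0 l \<in> borel_measurable lborel" for y x0 l
    using borel_measurable_continuous_onI[OF swapped_density_continuous] by simp
  show "(\<lambda>n. LBINT t. swapped_density (\<epsilon> n) (x0 n) (l n) t) \<longlonglongrightarrow> (LBINT t. swapped_density 0 0 L t)"
  proof (rule integral_dominated_convergence[where w = "\<lambda>t. 2 * \<beta> * C * K * (1 / cosh t ^ 2)"])
    show "AE t in lborel. (\<lambda>n. swapped_density (\<epsilon> n) (x0 n) (l n) t) \<longlonglongrightarrow> swapped_density 0 0 L t"
    proof (rule AE_I2)
      fix t
      have c1: "isCont cis x" for x
        by (rule continuous_on_interior[of UNIV]) (auto intro!: continuous_intros)
      have "(\<lambda>n. 2 * \<beta> * sinh t * x0 n) \<longlonglongrightarrow> 2 * \<beta> * sinh t * 0" by (intro tendsto_intros x0)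
      then have 1: "(\<lambda>n. cis (2 * \<beta> * sinh t * x0 n)) \<longlonglongrightarrow> cis (2 * \<beta> * sinh t * 0)"
        by (rule isCont_tendsto_compose[OF c1])
      have "(\<lambda>n. 2 * \<beta> * l n * sinh t) \<longlonglongrightarrow> 2 * \<beta> * L * sinh t" by (intro tendsto_intros l)
      then have 2: "(\<lambda>n. fourier Z (2 * \<beta> * l n * sinh t)) \<longlonglongrightarrow> fourier Z (2 * \<beta> * L * sinh t)"
        using fc by (intro isCont_tendsto_compose[of _ "fourier Z"]) (auto simp: continuous_on_eq_continuous_at)
      show "(\<lambda>n. swapped_density (\<epsilon> n) (x0 n) (l n) t) \<longlonglongrightarrow> swapped_density 0 0 L t"
        unfolding swapped_density_def
        by (intro tendsto_mult tendsto_of_real tendsto_exp tendsto_minus tendsto_const 1 2 \<epsilon>)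
    qed
    show "AE t in lborel. norm (swapped_density (\<epsilon> n) (x0 n) (l n) t) \<le> 2 * \<beta> * C * K * (1 / cosh t ^ 2)" for n
    proof (rule AE_I2)
      fix t
      have "exp (- (2 * \<beta> * \<epsilon> n * cosh t)) \<le> 1" using beta \<epsilon>(1)[of n] by simp
      then have "2 * \<beta> * cosh t * exp (- (2 * \<beta> * \<epsilon> n * cosh t)) \<le> 2 * \<beta> * cosh t * 1"
        using beta by (intro mult_left_mono) auto
      then have "norm (complex_of_real (2 * \<beta> * cosh t * exp (- (2 * \<beta> * \<epsilon> n * cosh t)))) \<le> 2 * \<beta> * cosh t"
        using beta unfolding norm_of_real by simp
      then have "norm (swapped_density (\<epsilon> n) (x0 n) (l n) t)
          \<le> (2 * \<beta> * cosh t) * 1 * (C * cosh t ^ N) * norm (fourier Z (2 * \<beta> * l n * sinh t))"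
        unfolding swapped_density_def norm_mult[of _ "fourier Z _"] norm_mult[of _ "base _"] norm_mult[of _ "cis _"] norm_cis
        using beta C by (intro mult_mono) auto
      also have "\<dots> = 2 * \<beta> * C * (cosh t ^ (N + 1) * norm (fourier Z (2 * \<beta> * l n * sinh t)))" by simp
      also have "\<dots> \<le> 2 * \<beta> * C * (K / cosh t ^ 2)" using beta C(1) by (intro mult_left_mono K) auto
      finally show "norm (swapped_density (\<epsilon> n) (x0 n) (l n) t) \<le> 2 * \<beta> * C * K * (1 / cosh t ^ 2)" by simp
    qed
  qed (intro m integrable_mult_right integrable_inverse_cosh)+
qed

end

section \<open>The integral representation and its normal derivative\<close>

text \<open>Substitution \<open>r = \<beta> e\<^sup>t\<close>, which turns \<open>d\<mu> / \<mu>\<close> into \<open>dt\<close>.\<close>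

lemma ray_integral_eq:
  fixes G :: "complex \<Rightarrow> complex"
  assumes b: "\<beta> > 0" and cont: "continuous_on UNIV (\<lambda>t. G (ray_point \<beta> (cis (- \<alpha>)) t))"
    and int: "integrable lborel (\<lambda>t. G (ray_point \<beta> (cis (- \<alpha>)) t))"
  shows "ray_integral \<alpha> (\<lambda>\<mu>. G \<mu> / \<mu>) = (LBINT t. G (ray_point \<beta> (cis (- \<alpha>)) t))"
proof -
  define f where "f r = indicator {0<..} r *\<^sub>R (G (complex_of_real r * cis (- \<alpha>)) / complex_of_real r)" for r :: real
  have "continuous_on {0<..} (\<lambda>r. G (ray_point \<beta> (cis (- \<alpha>)) (ln (r / \<beta>))))"
    by (rule continuous_on_compose2[OF cont]) (use b in \<open>auto intro!: continuous_intros\<close>)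
  then have "continuous_on {0<..} (\<lambda>r. G (complex_of_real r * cis (- \<alpha>)))"
    by (rule continuous_on_eq) (use b in auto)
  then have f_meas: "f \<in> borel_measurable borel"
    unfolding f_def by (intro borel_measurable_continuous_on_indicator continuous_intros) auto
  have f_exp: "(\<beta> * exp t) *\<^sub>R f (\<beta> * exp t) = G (ray_point \<beta> (cis (- \<alpha>)) t)" for t
    using b by (simp add: f_def scaleR_conv_of_real)
  have "(LBINT t. (\<beta> * exp t) *\<^sub>R f (\<beta> * exp t)) = (LBINT r. indicator {0<..} r *\<^sub>R f r)"
  proof (rule integral_substitution_line)
    show "((\<lambda>t. \<beta> * exp t) has_real_derivative \<beta> * exp t) (at t)" for t
      by (auto intro!: derivative_eq_intros)
    show "range (\<lambda>t. \<beta> * exp t) = {0<..}"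
    proof (intro set_eqI iffI)
      fix r :: real assume "r \<in> {0<..}"
      then have "r = \<beta> * exp (ln (r / \<beta>))" using b by simp
      then show "r \<in> range (\<lambda>t. \<beta> * exp t)" by blast
    qed (use b in auto)
  qed (use b f_meas int f_exp in auto)
  also have "\<dots> = ray_integral \<alpha> (\<lambda>\<mu>. G \<mu> / \<mu>)"
    unfolding ray_integral_def set_lebesgue_integral_def f_def
    by (rule Bochner_Integration.integral_cong) (auto simp: indicator_def)
  finally show ?thesis unfolding f_exp ..
qed

lemma sum_mult_zero: "(\<Sum>j\<in>S. c * f j) = (0::complex)" if "(\<Sum>j\<in>S. f j) = 0"
  using that by (simp flip: sum_distrib_left)

locale transform_data = convex_polygon +
  fixes \<beta> :: real and q dq :: "nat \<Rightarrow> (real \<Rightarrow> complex) \<Rightarrow> complex"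
  assumes beta: "\<beta> > 0"
    and q: "\<And>j. j < n \<Longrightarrow> q j \<in> E01_dual" and dq: "\<And>j. j < n \<Longrightarrow> dq j \<in> E01_dual"
begin

abbreviation (input) "len \<equiv> \<lambda>j. complex_of_real (side_length n z j)"

definition density :: "nat \<Rightarrow> complex \<Rightarrow> complex \<Rightarrow> real \<Rightarrow> complex" where
  "density j u w t = layer \<beta> (z j) (nv j) (dq j) u w t
     + rate \<beta> t (u * dir j) * layer \<beta> (z j) (nv j) (q j) u w t"

text \<open>The contribution of side \<open>j\<close>, with the ray through \<open>u\<close>, to the derivative at \<open>w\<close> in the
  direction of the outward normal of side \<open>i\<close>.\<close>

definition normal_potential :: "nat \<Rightarrow> nat \<Rightarrow> complex \<Rightarrow> complex \<Rightarrow> complex" where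
  "normal_potential i j u w =
     potential \<beta> (dir i) (dir j) 0 (z j) (nv j) (dq j) u w +
     potential \<beta> (dir i) (dir j) 1 (z j) (nv j) (q j) u w"

abbreviation (input) "separated j u \<kappa> w \<equiv> separates u (z j) (nv j) \<kappa> w"

lemma pot_data:
  assumes "j < n"
  shows "potential_data \<beta> (dir i) (dir j) (dq j)"
    "potential_data \<beta> (dir i) (dir j) (q j)"
  using assms beta q dq by unfold_locales auto

lemma kernel_times_rho:
  assumes j: "j < n" and u: "norm u = 1"
  shows "exp_kernel \<beta> (ray_point \<beta> u t) (- w) * spectral_rho \<beta> n z q dq j (ray_point \<beta> u t)
     = \<i> * len j * density j u w t"
proof -
  have arg: "exp_kernel \<beta> (ray_point \<beta> u t) \<circ> side_param n z j
      = (\<lambda>x. exp (wexp \<beta> t (u * (linepath (z j) (nv j) x - 0))))"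
    by (rule ext) (simp only: o_def side_param_def exp_kernel_ray[OF beta u] diff_zero)
  have sh: "layer \<beta> (z j) (nv j) T u w t
      = exp_kernel \<beta> (ray_point \<beta> u t) (- w) * layer \<beta> (z j) (nv j) T u 0 t"
    if "T \<in> E01_dual" for T
    unfolding exp_kernel_ray[OF beta u]
    using layer_shift[OF that, of \<beta> "z j" "nv j" u 0 w t] by simp
  have "spectral_rho \<beta> n z q dq j (ray_point \<beta> u t) = \<i> * len j *
     (layer \<beta> (z j) (nv j) (dq j) u 0 t
       + rate \<beta> t (u * dir j) * layer \<beta> (z j) (nv j) (q j) u 0 t)"
    unfolding spectral_rho_def arg layer_def[symmetric] side_dir_def[symmetric]
      rate_ray[OF beta u norm_side_dir] ..
  then show ?thesis
    unfolding density_def sh[OF dq[OF j]] sh[OF q[OF j]] by (simp add: algebra_simps)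
qed

lemma density_continuous: "j < n \<Longrightarrow> continuous_on UNIV (density j u w)"
  unfolding density_def using q dq
  by (intro continuous_intros layer_continuous continuous_rate) auto

lemma density_integrable:
  assumes j: "j < n" and u: "norm u = 1" and s: "\<kappa> > 0" "separated j u \<kappa> w"
  shows "integrable lborel (density j u w)"
proof -
  have s': "\<And>x. x \<in> {0..1} \<Longrightarrow> \<kappa> \<le> Im (u * (w - linepath (z j) (nv j) x))"
    using s(2) by (simp add: separates_def)
  have "integrable lborel (\<lambda>t. 1 * layer \<beta> (z j) (nv j) (dq j) u w t)"
    by (rule layer_integral(1)[OF dq[OF j] beta u s(1) s', of _ 1 0]) (auto intro: continuous_intros)
  moreover have "integrable lborel (\<lambda>t. rate \<beta> t (u * dir j) * layer \<beta> (z j) (nv j) (q j) u w t)"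
  proof (rule layer_integral(1)[OF q[OF j] beta u s(1) s', of _ "4 * \<beta>" 1])
    show "norm (rate \<beta> t (u * dir j)) \<le> 4 * \<beta> * cosh t ^ 1" for t
      using norm_rate_le[OF beta, of t "u * dir j"] u by (simp add: norm_mult)
  qed (use beta in \<open>auto intro: continuous_intros continuous_rate\<close>)
  ultimately show ?thesis unfolding density_def[abs_def] by simp
qed

lemma rate_density:
  "rate \<beta> t (u * dir i) * density j u w t =
     weight \<beta> (dir i) (dir j) 0 u t * layer \<beta> (z j) (nv j) (dq j) u w t +
     weight \<beta> (dir i) (dir j) 1 u t * layer \<beta> (z j) (nv j) (q j) u w t"
  by (simp add: density_def weight_def algebra_simps)

lemma normal_potential_eq:
  assumes j: "j < n" and u: "norm u = 1" and s: "\<kappa> > 0" "separated j u \<kappa> w"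
  shows "normal_potential i j u w = (LBINT t. rate \<beta> t (u * dir i) * density j u w t)"
    and "integrable lborel (\<lambda>t. rate \<beta> t (u * dir i) * density j u w t)"
proof -
  note int = potential_data.potential_integrable[OF pot_data(1)[OF j] u s]
    potential_data.potential_integrable[OF pot_data(2)[OF j] u s]
  show "normal_potential i j u w = (LBINT t. rate \<beta> t (u * dir i) * density j u w t)"
    unfolding rate_density normal_potential_def potential_def
    by (rule Bochner_Integration.integral_add[OF int, symmetric])
  show "integrable lborel (\<lambda>t. rate \<beta> t (u * dir i) * density j u w t)"
    unfolding rate_density by (rule Bochner_Integration.integrable_add[OF int])
qed

lemma Q_fun_eq:
  assumes s: "\<And>j. j < n \<Longrightarrow> \<exists>\<kappa>>0. separated j (cnj (dir j)) \<kappa> w"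
  shows "Q_fun \<beta> n z q dq w = (\<Sum>j<n. len j / (4 * pi) * (LBINT t. density j (cnj (dir j)) w t))"
proof -
  have "ray_integral (side_angle n z j) (\<lambda>\<mu>. exp (\<i> * \<mu> * w - \<i> * (complex_of_real \<beta>)\<^sup>2 * cnj w / \<mu>) *
             spectral_rho \<beta> n z q dq j \<mu> / \<mu>) = \<i> * len j * (LBINT t. density j (cnj (dir j)) w t)"
    if j: "j < n" for j
  proof -
    have dir: "cis (- side_angle n z j) = cnj (dir j)" by (simp add: side_dir_def cis_cnj)
    have u: "norm (cnj (dir j)) = 1" by simp
    obtain \<kappa> where \<kappa>: "\<kappa> > 0" "separated j (cnj (dir j)) \<kappa> w" using s[OF j] by blast
    have ker: "exp (\<i> * \<mu> * w - \<i> * (complex_of_real \<beta>)\<^sup>2 * cnj w / \<mu>) = exp_kernel \<beta> \<mu> (- w)" for \<mu>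
      by (simp add: exp_kernel_def)
    have "ray_integral (side_angle n z j) (\<lambda>\<mu>. (exp_kernel \<beta> \<mu> (- w) * spectral_rho \<beta> n z q dq j \<mu>) / \<mu>)
      = (LBINT t. exp_kernel \<beta> (ray_point \<beta> (cis (- side_angle n z j)) t) (- w) *
           spectral_rho \<beta> n z q dq j (ray_point \<beta> (cis (- side_angle n z j)) t))"
    proof (rule ray_integral_eq[OF beta])
      show "continuous_on UNIV (\<lambda>t. exp_kernel \<beta> (ray_point \<beta> (cis (- side_angle n z j)) t) (- w) *
           spectral_rho \<beta> n z q dq j (ray_point \<beta> (cis (- side_angle n z j)) t))"
        unfolding dir kernel_times_rho[OF j u] by (intro continuous_intros density_continuous[OF j])
      show "integrable lborel (\<lambda>t. exp_kernel \<beta> (ray_point \<beta> (cis (- side_angle n z j)) t) (- w) *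
           spectral_rho \<beta> n z q dq j (ray_point \<beta> (cis (- side_angle n z j)) t))"
        unfolding dir kernel_times_rho[OF j u] by (intro integrable_mult_right density_integrable[OF j u \<kappa>])
    qed
    also have "\<dots> = \<i> * len j * (LBINT t. density j (cnj (dir j)) w t)"
      unfolding dir kernel_times_rho[OF j u] by (rule integral_mult_right_zero)
    finally show ?thesis unfolding ker .
  qed
  then have "Q_fun \<beta> n z q dq w = 1 / (4 * complex_of_real pi * \<i>) *
      (\<Sum>j<n. \<i> * len j * (LBINT t. density j (cnj (dir j)) w t))"
    unfolding Q_fun_def by (intro arg_cong2[where f = "(*)"] sum.cong refl) auto
  then show ?thesis by (simp add: sum_distrib_left field_simps)
qed

text \<open>Differentiation in the direction \<open>- \<i> dir i\<close>, the outward normal of side \<open>i\<close>, is multiplication by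
  \<open>rate \<beta> t (u * dir i)\<close>.\<close>

lemma density_shift:
  assumes j: "j < n"
  shows "density j u (w + complex_of_real h * (- \<i> * dir i)) t
     = exp (complex_of_real h * rate \<beta> t (u * dir i)) * density j u w t"
proof -
  have sh: "wexp \<beta> t (- (u * (complex_of_real h * (- \<i> * e)))) = complex_of_real h * rate \<beta> t (u * e)" for e
  proof -
    have "- (u * (complex_of_real h * (- \<i> * e))) = complex_of_real h * (\<i> * (u * e))" by simp
    moreover have "wexp \<beta> t (\<i> * c) = rate \<beta> t c" for c by (simp add: wexp_def rate_def)
    ultimately show ?thesis by (simp only: wexp_scaleR)
  qed
  show ?thesis
    unfolding density_def layer_shift[OF q[OF j]] layer_shift[OF dq[OF j]] sh by (simp add: algebra_simps)
qed

lemma density_integral_deriv: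
  assumes j: "j < n" and u: "norm u = 1" and s: "\<kappa> > 0" "separated j u \<kappa> w"
  shows "((\<lambda>h. LBINT t. density j u (w + complex_of_real h * (- \<i> * dir i)) t)
    has_vector_derivative normal_potential i j u w) (at 0)"
proof -
  let ?w = "\<lambda>h. w + complex_of_real h * (- \<i> * dir i)"
  let ?X = "{- (\<kappa> / 2)<..<\<kappa> / 2}"
  have sep: "separated j u (\<kappa> / 2) (?w h)" if h: "h \<in> ?X" for h
    unfolding separates_def
  proof
    fix x :: real assume x: "x \<in> {0..1}"
    let ?p = "linepath (z j) (nv j) x"
    have "u * (?w h - ?p) = u * (w - ?p) + u * (complex_of_real h * (- \<i> * dir i))" by (simp add: algebra_simps)
    then have "Im (u * (?w h - ?p)) = Im (u * (w - ?p)) + Im (u * (complex_of_real h * (- \<i> * dir i)))"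
      by (simp only: plus_complex.sel)
    moreover have "\<bar>Im (u * (complex_of_real h * (- \<i> * dir i)))\<bar> \<le> \<bar>h\<bar>"
      using abs_Im_le_cmod[of "u * (complex_of_real h * (- \<i> * dir i))"] u by (simp only: norm_mult) simp
    moreover have "\<kappa> \<le> Im (u * (w - ?p))" using s(2) x by (simp add: separates_def)
    moreover have "\<bar>h\<bar> \<le> \<kappa> / 2" using h by auto
    ultimately show "\<kappa> / 2 \<le> Im (u * (?w h - ?p))" by linarith
  qed
  have k2: "\<kappa> / 2 > 0" using s(1) by simp
  obtain C M where C: "\<And>u w t \<kappa>. norm u = 1 \<Longrightarrow> \<kappa> > 0 \<Longrightarrow> separated j u \<kappa> w \<Longrightarrow>
     norm (weight \<beta> (dir i) (dir j) 0 u t * layer \<beta> (z j) (nv j) (dq j) u w t) \<le> C / \<kappa> ^ M / cosh t ^ 2"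
    using potential_data.potential_integrand_bound[OF pot_data(1)[OF j]] by blast
  obtain C' M' where C': "\<And>u w t \<kappa>. norm u = 1 \<Longrightarrow> \<kappa> > 0 \<Longrightarrow> separated j u \<kappa> w \<Longrightarrow>
     norm (weight \<beta> (dir i) (dir j) 1 u t * layer \<beta> (z j) (nv j) (q j) u w t) \<le> C' / \<kappa> ^ M' / cosh t ^ 2"
    using potential_data.potential_integrand_bound[OF pot_data(2)[OF j]] by blast
  define g where "g t = C / (\<kappa> / 2) ^ M * (1 / cosh t ^ 2) + C' / (\<kappa> / 2) ^ M' * (1 / cosh t ^ 2)" for t :: real
  have "((\<lambda>h. LBINT t. density j u (?w h) t) has_vector_derivative
     (LBINT t. rate \<beta> t (u * dir i) * density j u (?w 0) t)) (at 0 within ?X)"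
  proof (rule has_vector_derivative_integral[where g = g])
    fix t h assume h: "h \<in> ?X"
    have "((\<lambda>h. exp (complex_of_real h * rate \<beta> t (u * dir i)) * density j u w t) has_vector_derivative
       rate \<beta> t (u * dir i) * (exp (complex_of_real h * rate \<beta> t (u * dir i)) * density j u w t)) (at h within ?X)"
      by (rule has_vector_derivative_at_within)
        (auto intro!: derivative_eq_intros has_vector_derivative_real_field simp: mult_ac)
    then show "((\<lambda>h. density j u (?w h) t) has_vector_derivative
       rate \<beta> t (u * dir i) * density j u (?w h) t) (at h within ?X)"
      unfolding density_shift[OF j] .
    show "norm (rate \<beta> t (u * dir i) * density j u (?w h) t) \<le> g t"
      unfolding rate_density g_def
      using C[OF u k2 sep[OF h], of t] C'[OF u k2 sep[OF h], of t]
      by (intro order_trans[OF norm_triangle_ineq] add_mono) simp_all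
  next
    show "integrable lborel g" unfolding g_def
      by (intro Bochner_Integration.integrable_add integrable_mult_right integrable_inverse_cosh)
    show "integrable lborel (density j u (?w h))" if "h \<in> ?X" for h
      by (rule density_integrable[OF j u k2 sep[OF that]])
    have "continuous_on UNIV (\<lambda>t. rate \<beta> t (u * dir i) * density j u (?w 0) t)"
      by (intro continuous_intros continuous_rate density_continuous[OF j])
    then show "(\<lambda>t. rate \<beta> t (u * dir i) * density j u (?w 0) t) \<in> borel_measurable lborel"
      using borel_measurable_continuous_onI by simp
  qed (use s(1) in auto)
  then have "((\<lambda>h. LBINT t. density j u (?w h) t) has_vector_derivative normal_potential i j u w) (at 0 within ?X)"
    using normal_potential_eq(1)[OF j u s] by simp
  then show ?thesis
    by (subst (asm) has_vector_derivative_within_open) (use s(1) in auto)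
qed

lemma interior_separated:
  assumes "j < n" "w \<in> polygon_interior n z"
  shows "ldist j w > 0" "separated j (cnj (dir j)) (ldist j w) w"
proof -
  show "ldist j w > 0" by (rule interior_line_dist_pos[OF assms])
  have "Im (cnj (dir j) * (w - linepath (z j) (nv j) x)) = ldist j w" for x
  proof -
    have "ldist j (linepath (z j) (nv j) x) = 0"
      unfolding linepath_def line_dist_linepath by simp
    then show ?thesis by (simp add: line_dist_def algebra_simps)
  qed
  then show "separated j (cnj (dir j)) (ldist j w) w" by (simp add: separates_def)
qed

lemma normal_derivative_eq:
  assumes i: "i < n" and w: "w \<in> polygon_interior n z"
  shows "directional_deriv (Q_fun \<beta> n z q dq) (outward_normal n z i) w
    = (\<Sum>j<n. len j / (4 * pi) * normal_potential i j (cnj (dir j)) w)"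
proof -
  let ?w = "\<lambda>h. w + complex_of_real h * (- \<i> * dir i)"
  let ?S = "\<lambda>h. \<Sum>j<n. len j / (4 * pi) * (LBINT t. density j (cnj (dir j)) (?w h) t)"
  have "open (polygon_interior n z)" by (simp add: polygon_interior_def)
  moreover have cw: "continuous_on UNIV ?w" by (intro continuous_intros)
  ultimately have op: "open (?w -` polygon_interior n z)" by (rule open_vimage)
  have Q: "Q_fun \<beta> n z q dq (?w h) = ?S h" if "h \<in> ?w -` polygon_interior n z" for h
    by (rule Q_fun_eq) (use interior_separated[of _ "?w h"] that in blast)
  have "(?S has_vector_derivative (\<Sum>j<n. len j / (4 * pi) * normal_potential i j (cnj (dir j)) w)) (at 0)"
    by (intro has_vector_derivative_sum has_vector_derivative_mult_right density_integral_deriv[OF _ _ interior_separated])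
      (use w in auto)
  then have "((\<lambda>h. Q_fun \<beta> n z q dq (?w h)) has_vector_derivative
      (\<Sum>j<n. len j / (4 * pi) * normal_potential i j (cnj (dir j)) w)) (at 0)"
    by (rule has_vector_derivative_transform_within_open[OF _ op]) (use w Q in auto)
  moreover have "w + h *\<^sub>R outward_normal n z i = ?w h" for h
    unfolding outward_normal_def side_dir_sgn[OF i] by (simp add: scaleR_conv_of_real)
  ultimately show ?thesis
    unfolding directional_deriv_def by (simp add: vector_derivative_at)
qed

text \<open>With a common ray for all sides the integrand is a multiple of the sum in the global relation.\<close>

lemma normal_potential_sum_zero:
  assumes global: "\<And>\<mu>. \<mu> \<noteq> 0 \<Longrightarrow> (\<Sum>j<n. spectral_rho \<beta> n z q dq j \<mu>) = 0"
    and u: "norm u = 1" and s: "\<kappa> > 0" "\<And>j. j < n \<Longrightarrow> separated j u \<kappa> w"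
  shows "(\<Sum>j<n. len j / (4 * pi) * normal_potential i j u w) = 0"
proof -
  have zero: "(\<Sum>j<n. len j / (4 * pi) * (rate \<beta> t (u * dir i) * density j u w t)) = 0" for t
  proof -
    let ?\<mu> = "ray_point \<beta> u t"
    have "?\<mu> \<noteq> 0" using beta u by auto
    from global[OF this] have "(\<Sum>j<n. exp_kernel \<beta> ?\<mu> (- w) * spectral_rho \<beta> n z q dq j ?\<mu>) = 0"
      by (rule sum_mult_zero)
    then have "(\<Sum>j<n. \<i> * len j * density j u w t) = 0"
      using kernel_times_rho[OF _ u] by simp
    then have "(\<Sum>j<n. (rate \<beta> t (u * dir i) / (4 * pi * \<i>)) * (\<i> * len j * density j u w t)) = 0"
      by (rule sum_mult_zero)
    then show ?thesis by (simp add: field_simps)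
  qed
  have "(\<Sum>j<n. len j / (4 * pi) * normal_potential i j u w)
     = (\<Sum>j<n. LBINT t. len j / (4 * pi) * (rate \<beta> t (u * dir i) * density j u w t))"
    by (intro sum.cong refl) (simp add: normal_potential_eq(1)[OF _ u s(1) s(2)])
  also have "\<dots> = (LBINT t. (\<Sum>j<n. len j / (4 * pi) * (rate \<beta> t (u * dir i) * density j u w t)))"
    by (rule Bochner_Integration.integral_sum[symmetric])
      (intro integrable_mult_right normal_potential_eq(2)[OF _ u s(1) s(2)]; simp)
  finally show ?thesis unfolding zero by simp
qed

end

section \<open>The limit on the boundary\<close>

lemma S01_flat_function:
  assumes "\<phi> \<in> S01"
  shows "flat_function (zero_ext \<phi>)" "zero_ext \<phi> \<in> E01"
    "\<And>m. \<exists>C\<ge>0. \<forall>\<xi>. norm (fourier (zero_ext \<phi>) \<xi>) * (1 + \<xi>\<^sup>2) ^ m \<le> C"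
proof -
  obtain Z where Z: "deriv_tower UNIV Z" "Z 0 = zero_ext \<phi>" "\<And>k x. x \<notin> {0<..<1} \<Longrightarrow> Z k x = 0"
    "\<And>m. \<exists>C\<ge>0. \<forall>x\<in>{0..1}. norm (Z 0 x) \<le> C * (x ^ m * (1 - x) ^ m)"
    using S01_tower[OF assms] by blast
  show "flat_function (zero_ext \<phi>)"
    unfolding flat_function_def Z(2)[symmetric] using Z(3,4) deriv_tower_continuous_on[OF Z(1)] by blast
  have "deriv_tower {0..1} Z"
    unfolding deriv_tower_def using deriv_towerD[OF Z(1)] by (auto intro: has_vector_derivative_at_within)
  then show "zero_ext \<phi> \<in> E01" by (rule E01_tower) (simp add: Z(2))
  show "\<exists>C\<ge>0. \<forall>\<xi>. norm (fourier (zero_ext \<phi>) \<xi>) * (1 + \<xi>\<^sup>2) ^ m \<le> C" for m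
    using fourier_rapid_decay[OF Z(1,3)] unfolding Z(2) by blast
qed

locale boundary_limit = transform_data + polygon_side +
  fixes \<phi> :: "real \<Rightarrow> complex"
  assumes phi: "\<phi> \<in> S01"
    and global: "\<And>\<mu>. \<mu> \<noteq> 0 \<Longrightarrow> (\<Sum>j<n. spectral_rho \<beta> n z q dq j \<mu>) = 0"
begin

definition curve :: "real \<Rightarrow> real \<Rightarrow> real \<Rightarrow> complex" where
  "curve \<epsilon> y x = pt ((1 - x) * (\<epsilon> * xa) + x * (L - \<epsilon> * xb)) y"

lemma curve_continuous: "continuous_on UNIV (curve \<epsilon> y)"
  unfolding curve_def pt_def by (intro continuous_intros continuous_Complex)

lemma curve_tendsto:
  assumes "\<epsilon> \<longlonglongrightarrow> 0" "y \<longlonglongrightarrow> 0"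
  shows "(\<lambda>k. curve (\<epsilon> k) (y k) x) \<longlonglongrightarrow> curve 0 0 x"
  unfolding curve_def pt_def using assms by (auto intro!: tendsto_eq_intros)

text \<open>The mirror image lies below the line of side \<open>i\<close> at distance \<open>\<epsilon>\<close>, and the polygon above it.\<close>

lemma reflected_separated:
  assumes "\<epsilon> > 0" "j < n"
  shows "separated j (- cnj e) \<epsilon> (pt X (- \<epsilon>))"
  unfolding separates_def
proof
  fix x :: real assume x: "x \<in> {0..1}"
  let ?p = "linepath (z j) (nv j) x"
  have "ldist i (z j) \<ge> 0" "ldist i (nv j) \<ge> 0"
    using assms(2) i_less at_least_three by (auto simp: next_vertex_def intro: line_dist_vertex_nonneg)
  then have "ldist i ?p \<ge> 0"
    using x unfolding linepath_def line_dist_linepath by simp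
  moreover have "Im (- cnj e * (pt X (- \<epsilon>) - ?p)) = ldist i ?p - ldist i (pt X (- \<epsilon>))"
    by (simp add: line_dist_def algebra_simps)
  ultimately show "\<epsilon> \<le> Im (- cnj e * (pt X (- \<epsilon>) - ?p))"
    unfolding line_dist_i_pt by linarith
qed

lemma own_difference:
  "normal_potential i i (cnj e) (pt X \<epsilon>) - normal_potential i i (- cnj e) (pt X (- \<epsilon>))
     = 2 * potential \<beta> e e 0 A B (dq i) (cnj e) (pt X \<epsilon>)"
proof -
  interpret S: own_side "zero_ext \<phi>" \<beta> L A e "dq i"
    using S01_flat_function[OF phi] beta L_pos dq[OF i_less]
    unfolding own_side_def own_side_axioms_def by auto
  interpret R: own_side "zero_ext \<phi>" \<beta> L A e "q i"
    using S01_flat_function[OF phi] beta L_pos q[OF i_less]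
    unfolding own_side_def own_side_axioms_def by auto
  show ?thesis
    unfolding normal_potential_def B_eq pt_def
    using S.potential_reflect[of 0 X \<epsilon>] R.potential_reflect[of 1 X \<epsilon>] by simp
qed

lemma far_difference:
  assumes j: "j < n" "j \<noteq> i"
  shows "\<exists>u c \<epsilon>1. norm u = 1 \<and> c > 0 \<and> \<epsilon>1 > 0 \<and>
    (\<forall>\<epsilon> x y. 0 < \<epsilon> \<longrightarrow> \<epsilon> < \<epsilon>1 \<longrightarrow> x \<in> {0..1} \<longrightarrow> (y = \<epsilon> \<or> y = - \<epsilon>) \<longrightarrow>
       separated j u (c * (x * (1 - x))) (curve \<epsilon> y x))"
proof -
  obtain u c \<epsilon>1 where uc: "norm u = 1" "c > 0" "\<epsilon>1 > 0"
    "\<And>\<epsilon> t q y. 0 < \<epsilon> \<Longrightarrow> \<epsilon> < \<epsilon>1 \<Longrightarrow> t \<in> {0..1} \<Longrightarrow> (y = \<epsilon> \<or> y = - \<epsilon>) \<Longrightarrow>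
       q \<in> closed_segment (z j) (nv j) \<Longrightarrow>
       c * (t * (1 - t)) \<le> Im (u * (pt ((1 - t) * (\<epsilon> * xa) + t * (L - \<epsilon> * xb)) y - q))"
    using common_direction[OF j] by blast
  have "separated j u (c * (x * (1 - x))) (curve \<epsilon> y x)"
    if "0 < \<epsilon>" "\<epsilon> < \<epsilon>1" "x \<in> {0..1}" "y = \<epsilon> \<or> y = - \<epsilon>" for \<epsilon> x y
    unfolding separates_def curve_def using uc(4)[OF that linepath_in_path] by blast
  then show ?thesis using uc(1-3) by blast
qed

lemma normal_potential_turn:
  assumes j: "j < n" and u: "norm u1 = 1" "norm u2 = 1"
    and s: "\<kappa>1 > 0" "\<kappa>2 > 0" "separated j u1 \<kappa>1 w" "separated j u2 \<kappa>2 w"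
  shows "normal_potential i j u1 w = normal_potential i j u2 w"
proof -
  have k: "min \<kappa>1 \<kappa>2 > 0" using s by simp
  have "separated j u1 (min \<kappa>1 \<kappa>2) w" "separated j u2 (min \<kappa>1 \<kappa>2) w"
    using s separates_mono by (meson min.cobounded1 min.cobounded2)+
  then show ?thesis
    unfolding normal_potential_def
    using potential_data.potential_turn[OF pot_data(1)[OF j] u k]
      potential_data.potential_turn[OF pot_data(2)[OF j] u k] by simp
qed

lemma normal_deriv_limit:
  assumes X: "\<And>k. X k > 0" "X \<longlonglongrightarrow> 0"
  shows "(\<lambda>k. normal_deriv_pairing \<beta> n z q dq i (X k) \<phi>) \<longlonglongrightarrow> dq i (zero_ext \<phi>)"
proof -
  let ?Z = "zero_ext \<phi>"
  let ?J = "{..<n} - {i}"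
  obtain \<epsilon>0 where \<epsilon>0: "\<epsilon>0 > 0"
    "\<And>\<epsilon> t. 0 < \<epsilon> \<Longrightarrow> \<epsilon> < \<epsilon>0 \<Longrightarrow> inner_param n z \<epsilon> i t = curve \<epsilon> \<epsilon> t"
    "\<And>\<epsilon> t. 0 < \<epsilon> \<Longrightarrow> \<epsilon> < \<epsilon>0 \<Longrightarrow> t \<in> {0..1} \<Longrightarrow> curve \<epsilon> \<epsilon> t \<in> polygon_interior n z"
    using inner_param_eq unfolding curve_def by blast
  have "\<forall>j\<in>?J. \<exists>u c \<epsilon>1. norm u = 1 \<and> c > 0 \<and> \<epsilon>1 > 0 \<and>
    (\<forall>\<epsilon> x y. 0 < \<epsilon> \<longrightarrow> \<epsilon> < \<epsilon>1 \<longrightarrow> x \<in> {0..1} \<longrightarrow> (y = \<epsilon> \<or> y = - \<epsilon>) \<longrightarrow>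
       separated j u (c * (x * (1 - x))) (curve \<epsilon> y x))"
    using far_difference by blast
  then obtain u c \<epsilon>1 where far: "\<And>j. j \<in> ?J \<Longrightarrow> norm (u j) = 1" "\<And>j. j \<in> ?J \<Longrightarrow> c j > 0" "\<And>j. j \<in> ?J \<Longrightarrow> \<epsilon>1 j > 0"
    "\<And>j \<epsilon> x y. j \<in> ?J \<Longrightarrow> 0 < \<epsilon> \<Longrightarrow> \<epsilon> < \<epsilon>1 j \<Longrightarrow> x \<in> {0..1} \<Longrightarrow> y = \<epsilon> \<or> y = - \<epsilon> \<Longrightarrow>
       separated j (u j) (c j * (x * (1 - x))) (curve \<epsilon> y x)"
    unfolding bchoice_iff by blast
  define \<epsilon>2 where "\<epsilon>2 = L / (2 * (1 + xa + xb))"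
  have den: "1 + xa + xb > 0" using xa_pos xb_pos by linarith
  have \<epsilon>2: "\<epsilon>2 > 0" using L_pos den by (simp add: \<epsilon>2_def)
  have ev: "\<forall>\<^sub>F k in sequentially. X k < \<epsilon>0 \<and> X k < \<epsilon>2 \<and> (\<forall>j\<in>?J. X k < \<epsilon>1 j)"
    using order_tendstoD(2)[OF X(2)] \<epsilon>0(1) \<epsilon>2 far(3)
    by (intro eventually_conj eventually_ball_finite) auto
  then obtain N where N: "\<And>k. k \<ge> N \<Longrightarrow> X k < \<epsilon>0 \<and> X k < \<epsilon>2 \<and> (\<forall>j\<in>?J. X k < \<epsilon>1 j)"
    unfolding eventually_sequentially by blast
  \<comment> \<open>drop finitely many terms to make every smallness condition hold throughout\<close>
  define Y where "Y k = X (k + N)" for k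
  have Y: "Y k > 0" "Y k < \<epsilon>0" "Y k < \<epsilon>2" "\<And>j. j \<in> ?J \<Longrightarrow> Y k < \<epsilon>1 j" for k
    using X(1) N[of "k + N"] unfolding Y_def by auto
  have Y0: "Y \<longlonglongrightarrow> 0" unfolding Y_def using X(2) by (rule LIMSEQ_ignore_initial_segment)
  interpret S: own_side ?Z \<beta> L A e "dq i"
    using S01_flat_function[OF phi] beta L_pos dq[OF i_less]
    unfolding own_side_def own_side_axioms_def by auto
  have fp: "flat_pairing \<beta> e (dir j) T ?Z (u j) (c j)"
    if "j \<in> ?J" "T \<in> E01_dual" for j T
    using that far(1,2)[OF that(1)] beta S01_flat_function(1)[OF phi]
    unfolding flat_pairing_def flat_pairing_axioms_def potential_data_def by auto
  have sep: "separated j (u j) (c j * (x * (1 - x))) (curve (Y k) (Y k) x)"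
    "separated j (u j) (c j * (x * (1 - x))) (curve (Y k) (- Y k) x)" if "j \<in> ?J" "x \<in> {0..1}" for j k x
    using far(4)[OF that(1) Y(1) Y(4)[OF that(1)] that(2)] by auto
  \<comment> \<open>other sides, after turning the ray, at height \<open>y\<close>, which is \<open>Y k\<close> at the inner side and \<open>- Y k\<close>
    at its mirror image\<close>
  define F where "F j y k x = normal_potential i j (u j) (curve (Y k) y x) * ?Z x" for j y k x
  \<comment> \<open>side \<open>i\<close>, after the double layers have cancelled\<close>
  define G where "G k x = potential \<beta> e e 0 A B (dq i) (cnj e) (curve (Y k) (Y k) x) * ?Z x" for k x
  define Far where "Far j k y = (LBINT x:{0<..<1}. F j y k x)" for j k y
  define own where "own k = (LBINT x:{0<..<1}. G k x)" for k
  \<comment> \<open>the line \<open>x \<mapsto> x0 + x l\<close> described by the inner side\<close>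
  have curve_place: "curve (Y k) y x = A + e * Complex (Y k * xa + x * (L - Y k * xb - Y k * xa)) y" for k y x
    unfolding curve_def pt_def by (simp add: algebra_simps)
  have l_ge: "L - Y k * xb - Y k * xa \<ge> L / 2" for k
  proof -
    have "Y k * (2 * (1 + xa + xb)) < L"
      using Y(3)[of k] den unfolding \<epsilon>2_def by (subst (asm) pos_less_divide_eq) simp_all
    then show ?thesis using Y(1)[of k] by (simp add: algebra_simps)
  qed
  have own_lim: "own \<longlonglongrightarrow> 2 * pi / L * dq i ?Z"
    unfolding own_def G_def curve_place B_eq
  proof (rule S.own_side_tendsto[OF Y(1) Y0 l_ge])
    show "(\<lambda>k. L - Y k * xb - Y k * xa) \<longlonglongrightarrow> L" "(\<lambda>k. Y k * xa) \<longlonglongrightarrow> 0"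
      using Y0 by (auto intro!: tendsto_eq_intros)
  qed
  have own_int: "set_integrable lborel {0<..<1} (G k)" for k
    unfolding G_def[abs_def] curve_place B_eq by (rule S.pairing_eq(2)[OF Y(1)])
  have far_int: "set_integrable lborel {0<..<1} (F j y k)"
    if j: "j \<in> ?J" and y: "y = Y k \<or> y = - Y k" for j k y
    unfolding F_def[abs_def] normal_potential_def distrib_right
    by (intro set_integral_add flat_pairing.pairing_integrable[OF fp[OF j]] curve_continuous)
      (use j y dq q sep[OF j] in auto)
  have far_lim: "(\<lambda>k. Far j k (Y k) - Far j k (- Y k)) \<longlonglongrightarrow> 0" if j: "j \<in> ?J" for j
  proof -
    define lim where "lim = (LBINT x:{0<..<1}. potential \<beta> e (dir j) 0 (z j) (nv j) (dq j) (u j) (curve 0 0 x) * ?Z x)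
       + (LBINT x:{0<..<1}. potential \<beta> e (dir j) 1 (z j) (nv j) (q j) (u j) (curve 0 0 x) * ?Z x)"
    have T: "dq j \<in> E01_dual" "q j \<in> E01_dual" using j q dq by auto
    have "(\<lambda>k. Far j k (y k)) \<longlonglongrightarrow> lim" if y: "y \<longlonglongrightarrow> 0" "\<And>k. y k = Y k \<or> y k = - Y k" for y
    proof -
      have s: "separated j (u j) (c j * (x * (1 - x))) (curve (Y k) (y k) x)" if "x \<in> {0..1}" for k x
        using sep[OF j that, of k] y(2)[of k] by auto
      have "Far j k (y k) = (LBINT x:{0<..<1}. potential \<beta> e (dir j) 0 (z j) (nv j) (dq j) (u j) (curve (Y k) (y k) x) * ?Z x)
       + (LBINT x:{0<..<1}. potential \<beta> e (dir j) 1 (z j) (nv j) (q j) (u j) (curve (Y k) (y k) x) * ?Z x)" for k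
        unfolding Far_def F_def normal_potential_def distrib_right
        by (intro set_integral_add flat_pairing.pairing_integrable[OF fp[OF j]] curve_continuous T s)
      then show ?thesis
        unfolding lim_def
        by (simp only:) (intro tendsto_add flat_pairing.pairing_tendsto[OF fp[OF j]] T curve_continuous s
            curve_tendsto[OF Y0 y(1)])
    qed
    from tendsto_diff[OF this[of Y] this[of "\<lambda>k. - Y k"]] show ?thesis
      using Y0 tendsto_minus[OF Y0] by simp
  qed
  have eq: "normal_deriv_pairing \<beta> n z q dq i (Y k) \<phi> =
     (\<Sum>j\<in>?J. len j / (4 * pi) * (Far j k (Y k) - Far j k (- Y k))) + L / (2 * pi) * own k" for k
  proof -
    have pointwise: "directional_deriv (Q_fun \<beta> n z q dq) (outward_normal n z i) (inner_param n z (Y k) i x) * \<phi> x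
      = (\<Sum>j\<in>?J. len j / (4 * pi) * (F j (Y k) k x - F j (- Y k) k x)) + L / (2 * pi) * G k x"
      if x: "x \<in> {0<..<1}" for x
    proof -
      let ?w = "curve (Y k) (Y k) x" and ?w' = "curve (Y k) (- Y k) x"
      have x': "x \<in> {0..1}" using x by simp
      have wi: "?w \<in> polygon_interior n z" by (rule \<epsilon>0(3)[OF Y(1,2) x'])
      have p: "x * (1 - x) > 0" using x by simp
      have neg_unit: "norm (- cnj e) = 1" by (simp only: norm_minus_cancel complex_mod_cnj norm_side_dir)
      have mirror: "separated j (- cnj e) (Y k) ?w'" if "j < n" for j
        unfolding curve_def by (rule reflected_separated[OF Y(1) that])
      have "directional_deriv (Q_fun \<beta> n z q dq) (outward_normal n z i) (inner_param n z (Y k) i x)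
        = (\<Sum>j<n. len j / (4 * pi) * normal_potential i j (cnj (dir j)) ?w)"
        unfolding \<epsilon>0(2)[OF Y(1,2)] by (rule normal_derivative_eq[OF i_less wi])
      also have "\<dots> = (\<Sum>j<n. len j / (4 * pi) * normal_potential i j (cnj (dir j)) ?w)
          - (\<Sum>j<n. len j / (4 * pi) * normal_potential i j (- cnj e) ?w')"
      proof -
        have "(\<Sum>j<n. len j / (4 * pi) * normal_potential i j (- cnj e) ?w') = 0"
          by (rule normal_potential_sum_zero[OF global neg_unit Y(1) mirror])
        then show ?thesis by simp
      qed
      also have "\<dots> = (\<Sum>j<n. len j / (4 * pi) * (normal_potential i j (cnj (dir j)) ?w - normal_potential i j (- cnj e) ?w'))"
        by (simp add: sum_subtractf right_diff_distrib)
      also have "\<dots> = (\<Sum>j\<in>?J. len j / (4 * pi) * (normal_potential i j (cnj (dir j)) ?w - normal_potential i j (- cnj e) ?w'))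
          + len i / (4 * pi) * (normal_potential i i (cnj e) ?w - normal_potential i i (- cnj e) ?w')"
        using i_less by (subst sum.remove[of _ i]) auto
      also have "(\<Sum>j\<in>?J. len j / (4 * pi) * (normal_potential i j (cnj (dir j)) ?w - normal_potential i j (- cnj e) ?w'))
          = (\<Sum>j\<in>?J. len j / (4 * pi) * (normal_potential i j (u j) ?w - normal_potential i j (u j) ?w'))"
      proof (rule sum.cong[OF refl])
        fix j assume j: "j \<in> ?J"
        then have jn: "j < n" by simp
        have cp: "c j * (x * (1 - x)) > 0" using far(2)[OF j] p by simp
        have 1: "normal_potential i j (cnj (dir j)) ?w = normal_potential i j (u j) ?w"
          by (rule normal_potential_turn[OF jn _ far(1)[OF j] interior_separated(1)[OF jn wi] cp
                interior_separated(2)[OF jn wi] sep(1)[OF j x']]) simp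
        have 2: "normal_potential i j (- cnj e) ?w' = normal_potential i j (u j) ?w'"
          by (rule normal_potential_turn[OF jn _ far(1)[OF j] Y(1) cp mirror[OF jn] sep(2)[OF j x']]) (rule neg_unit)
        show "len j / (4 * pi) * (normal_potential i j (cnj (dir j)) ?w - normal_potential i j (- cnj e) ?w')
          = len j / (4 * pi) * (normal_potential i j (u j) ?w - normal_potential i j (u j) ?w')"
          unfolding 1 2 ..
      qed
      also have "normal_potential i i (cnj e) ?w - normal_potential i i (- cnj e) ?w'
          = 2 * potential \<beta> e e 0 A B (dq i) (cnj e) ?w"
        unfolding curve_def by (rule own_difference)
      finally have *: "directional_deriv (Q_fun \<beta> n z q dq) (outward_normal n z i) (inner_param n z (Y k) i x)
        = (\<Sum>j\<in>?J. len j / (4 * pi) * (normal_potential i j (u j) ?w - normal_potential i j (u j) ?w'))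
          + len i / (4 * pi) * (2 * potential \<beta> e e 0 A B (dq i) (cnj e) ?w)" .
      have Zx: "?Z x = \<phi> x" using x by (simp add: zero_ext_def)
      show ?thesis
        unfolding * F_def G_def Zx by (simp add: distrib_right sum_distrib_right left_diff_distrib mult.assoc)
    qed
    have term_int: "set_integrable lborel {0<..<1} (\<lambda>x. len j / (4 * pi) * (F j (Y k) k x - F j (- Y k) k x))"
      if "j \<in> ?J" for j
      by (intro set_integrable_mult_right set_integral_diff(1) far_int[OF that]) auto
    have sum_int: "set_integrable lborel {0<..<1} (\<lambda>x. \<Sum>j\<in>?J. len j / (4 * pi) * (F j (Y k) k x - F j (- Y k) k x))"
      unfolding set_integrable_def scaleR_sum_right
      by (rule Bochner_Integration.integrable_sum) (rule term_int[unfolded set_integrable_def])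
    have "normal_deriv_pairing \<beta> n z q dq i (Y k) \<phi> = (LBINT x:{0<..<1}.
        (\<Sum>j\<in>?J. len j / (4 * pi) * (F j (Y k) k x - F j (- Y k) k x)) + L / (2 * pi) * G k x)"
      unfolding normal_deriv_pairing_def
      by (rule set_lebesgue_integral_cong) (simp, intro allI impI, rule pointwise)
    also have "\<dots> = (LBINT x:{0<..<1}. (\<Sum>j\<in>?J. len j / (4 * pi) * (F j (Y k) k x - F j (- Y k) k x)))
        + (LBINT x:{0<..<1}. L / (2 * pi) * G k x)"
      by (intro set_integral_add(2) sum_int set_integrable_mult_right own_int)
    also have "(LBINT x:{0<..<1}. L / (2 * pi) * G k x) = L / (2 * pi) * own k"
      unfolding own_def by (rule set_integral_mult_right)
    also have "(LBINT x:{0<..<1}. (\<Sum>j\<in>?J. len j / (4 * pi) * (F j (Y k) k x - F j (- Y k) k x)))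
        = (\<Sum>j\<in>?J. LBINT x:{0<..<1}. len j / (4 * pi) * (F j (Y k) k x - F j (- Y k) k x))"
      unfolding set_lebesgue_integral_def scaleR_sum_right
      by (rule Bochner_Integration.integral_sum) (rule term_int[unfolded set_integrable_def])
    also have "\<dots> = (\<Sum>j\<in>?J. len j / (4 * pi) * (Far j k (Y k) - Far j k (- Y k)))"
      unfolding Far_def set_integral_mult_right
      by (intro sum.cong refl arg_cong2[where f = "(*)"] set_integral_diff(2) far_int) auto
    finally show ?thesis .
  qed
  have "(\<lambda>k. normal_deriv_pairing \<beta> n z q dq i (Y k) \<phi>)
      \<longlonglongrightarrow> (\<Sum>j\<in>?J. len j / (4 * pi) * 0) + L / (2 * pi) * (2 * pi / L * dq i ?Z)"
    unfolding eq by (intro tendsto_add tendsto_sum tendsto_mult_left far_lim own_lim)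
  moreover have "(\<Sum>j\<in>?J. len j / (4 * pi) * 0) + L / (2 * pi) * (2 * pi / L * dq i ?Z) = dq i ?Z"
    using L_pos by simp
  ultimately have "(\<lambda>k. normal_deriv_pairing \<beta> n z q dq i (Y k) \<phi>) \<longlonglongrightarrow> dq i ?Z" by (simp only:)
  then show ?thesis unfolding Y_def by (rule LIMSEQ_offset)
qed

end

theorem mainTheorem2:
  fixes \<beta> :: real and n :: nat and z :: "nat \<Rightarrow> complex"
    and q dq :: "nat \<Rightarrow> (real \<Rightarrow> complex) \<Rightarrow> complex"
  assumes "\<beta> > 0"
    and "convex_polygon_ccw n z"
    and "\<And>i. i < n \<Longrightarrow> q i \<in> E01_dual"
    and "\<And>i. i < n \<Longrightarrow> dq i \<in> E01_dual"
    and global_relation: "\<And>\<mu>. \<mu> \<noteq> 0 \<Longrightarrow> (\<Sum>i<n. spectral_rho \<beta> n z q dq i \<mu>) = 0"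
  shows "\<forall>i<n. \<forall>\<phi>\<in>S01.
    ((\<lambda>\<epsilon>. normal_deriv_pairing \<beta> n z q dq i \<epsilon> \<phi>) \<longlongrightarrow> dq i (zero_ext \<phi>)) (at_right 0)"
proof (intro allI impI ballI)
  fix i \<phi> assume "i < n" "\<phi> \<in> S01"
  then interpret boundary_limit n z \<beta> q dq i \<phi>
    using assms by unfold_locales auto
  show "((\<lambda>\<epsilon>. normal_deriv_pairing \<beta> n z q dq i \<epsilon> \<phi>) \<longlongrightarrow> dq i (zero_ext \<phi>)) (at_right 0)"
    unfolding tendsto_at_iff_sequentially o_def by (auto intro: normal_deriv_limit)
qed

end
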